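(* Let $\mathbb{G}$ be a stratified group of step $\iota$ with homogeneous distance $d$ and Lie algebra norm $\|\cdot\|$, $\mathbb{M}$ a graded group, $\Omega\subset\mathbb{G}$ open and $f:\Omega\to\mathbb{M}$ continuously P-differentiable. Let $\overline x\in\Omega$ be such that $Df(\overline x):\mathbb{G}\to\mathbb{M}$ is an h-epimorphism, let $N$ be its kernel and $H$ a homogeneous subgroup complementary to $N$; let $(\overline n,\overline h)\in N\times H$ be the unique pair with $\overline x=\overline n\,\overline h$. Then there exist $r,s>0$ with $D^N_{\overline n,r}D^H_{\overline h,s}\subset\Omega$ and a unique map $\varphi:D^N_{\overline n,r}\to D^H_{\overline h,s}$ such that $$f^{-1}\big(f(\overline x)\big)\cap D^N_{\overline n,r}D^H_{\overline h,s}=\{n\varphi(n): n\in D^N_{\overline n,r}\}.$$ Moreover there is $\kappa>0$ such that $d(\varphi(n),\varphi(n'))\le\kappa\, d\big(\varphi(n')^{-1}n^{-1}n'\varphi(n'),e\big)$ for all $n,n'\in D^N_{\overline n,r}$. In particular $\varphi$ is $1/\iota$-Hölder: there is $C>0$ with $d(\varphi(n),\varphi(n'))\le C\,\|\exp^{-1}(n)-\exp^{-1}(n')\|^{1/\iota}$ for all $n,n'\in D^N_{\overline n,r}$.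
   Context: Graded group: connected simply connected real Lie group with Lie algebra $V_1\oplus\cdots\oplus V_\iota$, $[V_i,V_j]\subset V_{i+j}$; stratified if $[V_i,V_j]=V_{i+j}$; $\exp$ is a global diffeomorphism. Dilations $\delta_r$ act by $r^i$ on $V_i$. Homogeneous distance: continuous, left invariant, $d(\delta_rx,\delta_ry)=rd(x,y)$. h-homomorphism: group homomorphism commuting with dilations. P-differentiability of $f$ at $x$ (with homogeneous distance $\rho$ on $\mathbb{M}$): there is an h-homomorphism $Df(x)$ with $\rho(f(x)^{-1}f(xh),Df(x)(h))/d(h,e)\to0$ as $h\to e$; continuously P-differentiable means P-differentiable everywhere and $x\mapsto \exp^{-1}\circ Df(x)\circ\exp$ continuous. h-epimorphism: an h-homomorphism having a right inverse which is an h-homomorphism. Homogeneous subgroup: closed connected simply connected Lie subgroup invariant under all dilations. Two homogeneous subgroups $P,H$ are complementary if $PH=\mathbb{G}$ and $P\cap H=\{e\}$ (then each element factorizes uniquely). $D_{x,r}$ is the closed $d$-ball of center $x$ and radius $r$; $D^N_{x,r}=D_{x,r}\cap N$, $D^H_{x,r}=D_{x,r}\cap H$; for sets $A,B$, $AB=\{ab:a\in A,b\in B\}$. *)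

theory Defs
  imports "HOL-Analysis.Analysis"
begin

text \<open>A graded group is modelled in exponential coordinates: its points are the
elements of its (finite-dimensional, graded, nilpotent) Lie algebra, the group
law is the Baker-Campbell-Hausdorff product (finite, via Dynkin's formula), the
identity is 0, the inverse is uminus, and exp is the identity map.\<close>

definition lie_algebra :: "('a::real_vector \<Rightarrow> 'a \<Rightarrow> 'a) \<Rightarrow> bool" where
  "lie_algebra br \<longleftrightarrow> bilinear br \<and> (\<forall>x. br x x = 0) \<and>
     (\<forall>x y z. br x (br y z) + br y (br z x) + br z (br x y) = 0)"

definition fin_dim_space :: "'a::real_vector itself \<Rightarrow> bool" where
  "fin_dim_space _ \<longleftrightarrow> (\<exists>B::'a set. finite B \<and> span B = UNIV)"

definition layer :: "(nat \<Rightarrow> 'a::real_vector set) \<Rightarrow> nat \<Rightarrow> nat \<Rightarrow> 'a set" where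
  "layer V k i = (if i \<in> {1..k} then V i else {0})"

definition graded_alg :: "('a::real_vector \<Rightarrow> 'a \<Rightarrow> 'a) \<Rightarrow> (nat \<Rightarrow> 'a set) \<Rightarrow> nat \<Rightarrow> bool" where
  "graded_alg br V k \<longleftrightarrow> lie_algebra br \<and> fin_dim_space TYPE('a) \<and> 1 \<le> k \<and>
     (\<forall>i\<in>{1..k}. subspace (V i)) \<and>
     (\<forall>x. \<exists>!c. (\<forall>i\<in>{1..k}. c i \<in> V i) \<and> (\<forall>i. i \<notin> {1..k} \<longrightarrow> c i = 0) \<and>
            x = (\<Sum>i\<in>{1..k}. c i)) \<and>
     (\<forall>i\<in>{1..k}. \<forall>j\<in>{1..k}. \<forall>x\<in>V i. \<forall>y\<in>V j. br x y \<in> layer V k (i + j))"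

definition stratified_alg :: "('a::real_vector \<Rightarrow> 'a \<Rightarrow> 'a) \<Rightarrow> (nat \<Rightarrow> 'a set) \<Rightarrow> nat \<Rightarrow> bool" where
  "stratified_alg br V k \<longleftrightarrow> graded_alg br V k \<and> V k \<noteq> {0} \<and>
     (\<forall>i j. 1 \<le> i \<longrightarrow> 1 \<le> j \<longrightarrow> i + j \<le> k \<longrightarrow>
        span {br x y | x y. x \<in> V i \<and> y \<in> V j} = V (i + j))"

definition comp :: "(nat \<Rightarrow> 'a::real_vector set) \<Rightarrow> nat \<Rightarrow> nat \<Rightarrow> 'a \<Rightarrow> 'a" where
  "comp V k i x = (THE c. (\<forall>i\<in>{1..k}. c i \<in> V i) \<and> (\<forall>i. i \<notin> {1..k} \<longrightarrow> c i = 0) \<and>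
            x = (\<Sum>i\<in>{1..k}. c i)) i"

definition dil :: "(nat \<Rightarrow> 'a::real_vector set) \<Rightarrow> nat \<Rightarrow> real \<Rightarrow> 'a \<Rightarrow> 'a" where
  "dil V k r x = (\<Sum>i\<in>{1..k}. (r ^ i) *\<^sub>R comp V k i x)"

fun nbr :: "('a \<Rightarrow> 'a \<Rightarrow> 'a) \<Rightarrow> 'a list \<Rightarrow> 'a::zero" where
  "nbr br [] = 0"
| "nbr br [a] = a"
| "nbr br (a # b # w) = br a (nbr br (b # w))"

definition dyn_word :: "'a \<Rightarrow> 'a \<Rightarrow> (nat \<times> nat) list \<Rightarrow> 'a list" where
  "dyn_word X Y ps = concat (map (\<lambda>(r, s). replicate r X @ replicate s Y) ps)"

text \<open>Dynkin's formula; in a graded Lie algebra of step k all terms with n > k or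
  r_i + s_i > k vanish, so the truncated sum is exact.\<close>
definition bch :: "('a::real_vector \<Rightarrow> 'a \<Rightarrow> 'a) \<Rightarrow> nat \<Rightarrow> 'a \<Rightarrow> 'a \<Rightarrow> 'a" where
  "bch br k X Y = (\<Sum>n\<in>{1..k}. \<Sum>ps\<in>{ps. length ps = n \<and> (\<forall>(r, s)\<in>set ps. 1 \<le> r + s \<and> r + s \<le> k)}.
      (((-1) ^ (n - 1) / real n) /
        (real (sum_list (map (\<lambda>(r, s). r + s) ps)) *
         prod_list (map (\<lambda>(r, s). fact r * fact s) ps))) *\<^sub>R nbr br (dyn_word X Y ps))"

definition homog_dist :: "('a::real_normed_vector \<Rightarrow> 'a \<Rightarrow> 'a) \<Rightarrow> (nat \<Rightarrow> 'a set) \<Rightarrow> nat \<Rightarrow>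
    ('a \<Rightarrow> 'a \<Rightarrow> real) \<Rightarrow> bool" where
  "homog_dist br V k d \<longleftrightarrow>
     (\<forall>x y. d x y = 0 \<longleftrightarrow> x = y) \<and> (\<forall>x y. d x y = d y x) \<and>
     (\<forall>x y z. d x z \<le> d x y + d y z) \<and>
     continuous_on UNIV (\<lambda>p. d (fst p) (snd p)) \<and>
     (\<forall>z x y. d (bch br k z x) (bch br k z y) = d x y) \<and>
     (\<forall>r>0. \<forall>x y. d (dil V k r x) (dil V k r y) = r * d x y)"

definition gball :: "('a \<Rightarrow> 'a \<Rightarrow> real) \<Rightarrow> 'a \<Rightarrow> real \<Rightarrow> 'a set" where
  "gball d x r = {y. d x y \<le> r}"

definition setmul :: "('a::real_vector \<Rightarrow> 'a \<Rightarrow> 'a) \<Rightarrow> nat \<Rightarrow> 'a set \<Rightarrow> 'a set \<Rightarrow> 'a set" where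
  "setmul br k A B = {bch br k a b | a b. a \<in> A \<and> b \<in> B}"

definition h_hom :: "('a::real_vector \<Rightarrow> 'a \<Rightarrow> 'a) \<Rightarrow> (nat \<Rightarrow> 'a set) \<Rightarrow> nat \<Rightarrow>
    ('b::real_vector \<Rightarrow> 'b \<Rightarrow> 'b) \<Rightarrow> (nat \<Rightarrow> 'b set) \<Rightarrow> nat \<Rightarrow> ('a \<Rightarrow> 'b) \<Rightarrow> bool" where
  "h_hom brG VG kG brM VM kM L \<longleftrightarrow>
     (\<forall>x y. L (bch brG kG x y) = bch brM kM (L x) (L y)) \<and>
     (\<forall>r>0. \<forall>x. L (dil VG kG r x) = dil VM kM r (L x))"

definition h_epi :: "('a::real_vector \<Rightarrow> 'a \<Rightarrow> 'a) \<Rightarrow> (nat \<Rightarrow> 'a set) \<Rightarrow> nat \<Rightarrow>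
    ('b::real_vector \<Rightarrow> 'b \<Rightarrow> 'b) \<Rightarrow> (nat \<Rightarrow> 'b set) \<Rightarrow> nat \<Rightarrow> ('a \<Rightarrow> 'b) \<Rightarrow> bool" where
  "h_epi brG VG kG brM VM kM L \<longleftrightarrow> h_hom brG VG kG brM VM kM L \<and>
     (\<exists>R. h_hom brM VM kM brG VG kG R \<and> (\<forall>y. L (R y) = y))"

text \<open>P-differentiability of f at x with differential L (inverse of f x is -(f x)).\<close>
definition pdiff_at :: "('a::real_normed_vector \<Rightarrow> 'a \<Rightarrow> 'a) \<Rightarrow> (nat \<Rightarrow> 'a set) \<Rightarrow> nat \<Rightarrow> ('a \<Rightarrow> 'a \<Rightarrow> real) \<Rightarrow>
    ('b::real_vector \<Rightarrow> 'b \<Rightarrow> 'b) \<Rightarrow> (nat \<Rightarrow> 'b set) \<Rightarrow> nat \<Rightarrow> ('b \<Rightarrow> 'b \<Rightarrow> real) \<Rightarrow>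
    ('a \<Rightarrow> 'b) \<Rightarrow> 'a \<Rightarrow> ('a \<Rightarrow> 'b) \<Rightarrow> bool" where
  "pdiff_at brG VG kG d brM VM kM \<rho> f x L \<longleftrightarrow> h_hom brG VG kG brM VM kM L \<and>
     ((\<lambda>h. \<rho> (bch brM kM (- f x) (f (bch brG kG x h))) (L h) / d h 0) \<longlongrightarrow> 0) (at 0)"

text \<open>Continuous P-differentiability on \<Omega> with differential Df: P-differentiable at
  every point, and x \<mapsto> Df x (= exp^-1 o Df x o exp in exponential coordinates)
  continuous, for the topology of uniform convergence on the unit ball
  (the operator-norm topology on linear maps).\<close>
definition cont_pdiff :: "('a::real_normed_vector \<Rightarrow> 'a \<Rightarrow> 'a) \<Rightarrow> (nat \<Rightarrow> 'a set) \<Rightarrow> nat \<Rightarrow> ('a \<Rightarrow> 'a \<Rightarrow> real) \<Rightarrow>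
    ('b::real_normed_vector \<Rightarrow> 'b \<Rightarrow> 'b) \<Rightarrow> (nat \<Rightarrow> 'b set) \<Rightarrow> nat \<Rightarrow> ('b \<Rightarrow> 'b \<Rightarrow> real) \<Rightarrow>
    'a set \<Rightarrow> ('a \<Rightarrow> 'b) \<Rightarrow> ('a \<Rightarrow> 'a \<Rightarrow> 'b) \<Rightarrow> bool" where
  "cont_pdiff brG VG kG d brM VM kM \<rho> \<Omega> f Df \<longleftrightarrow>
     (\<forall>x\<in>\<Omega>. pdiff_at brG VG kG d brM VM kM \<rho> f x (Df x)) \<and>
     (\<forall>x\<in>\<Omega>. \<forall>e>0. \<exists>\<delta>>0. \<forall>y\<in>\<Omega>. dist y x < \<delta> \<longrightarrow>
        (\<forall>h. norm h \<le> 1 \<longrightarrow> norm (Df y h - Df x h) < e))"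

definition homog_subgroup :: "('a::real_normed_vector \<Rightarrow> 'a \<Rightarrow> 'a) \<Rightarrow> (nat \<Rightarrow> 'a set) \<Rightarrow> nat \<Rightarrow> 'a set \<Rightarrow> bool" where
  "homog_subgroup br V k H \<longleftrightarrow>
     0 \<in> H \<and> (\<forall>x\<in>H. \<forall>y\<in>H. bch br k x y \<in> H) \<and> (\<forall>x\<in>H. - x \<in> H) \<and>
     closed H \<and> connected H \<and> simply_connected H \<and>
     (\<forall>r>0. \<forall>x\<in>H. dil V k r x \<in> H)"

definition complementary :: "('a::real_normed_vector \<Rightarrow> 'a \<Rightarrow> 'a) \<Rightarrow> (nat \<Rightarrow> 'a set) \<Rightarrow> nat \<Rightarrow> 'a set \<Rightarrow> 'a set \<Rightarrow> bool" where
  "complementary br V k P H \<longleftrightarrow>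
     setmul br k P H = UNIV \<and> P \<inter> H = {0}"

end

theory Submission
  imports Defs "HOL-Computational_Algebra.Formal_Power_Series"
begin

text \<open>
  That the truncated Dynkin series is a group law is seen in the adjoint representation of the semidirect
  product of the graded algebra with its degree derivation. This representation is faithful and nilpotent,
  and in it the curve \<open>t \<mapsto> e\<^bsup>Z(t)\<^esup>\<close>, where \<open>Z(t)\<close> is the Dynkin series of \<open>tX\<close> and \<open>tY\<close>, satisfies the
  differential equation of \<open>e\<^bsup>tX\<^esup> e\<^bsup>tY\<^esup>\<close>.

  In a stratified group every element is a product of a fixed number of horizontal elements of
  comparable size. Along a horizontal segment the mean value inequality follows from Gronwall's lemma after
  rescaling to unit time; hence a continuously P-differentiable map is strictly P-differentiable:
  \<open>f(x)\<^sup>-\<^sup>1 f(y)\<close> differs from \<open>L(x\<^sup>-\<^sup>1 y)\<close>, with \<open>L\<close> the differential at the base point, by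
  \<open>\<epsilon> d(x,y)\<close>.

  The restriction of \<open>L\<close> to \<open>H\<close> is bijective and bounded below, so \<open>h \<mapsto> f(nh)\<close> is injective near the
  base point. It attains the prescribed value: a minimiser of the distance to the value over a compact
  ball could otherwise be improved by one step of the simplified Newton method. Applying strict
  differentiability to two points of the level set gives the estimate with \<open>\<kappa> = 1\<close>, because
  \<open>L\<close> only sees the factor \<open>\<phi>(n)\<^sup>-\<^sup>1 \<phi>(n')\<close>.
\<close>

text \<open>No uniqueness theorem for differential equations enters the group law. The velocity of
  Z(t) is governed by conjugation with e^(tX) e^(tY), whereas differentiating e^(Z(t)) produces
  conjugation with e^(Z(t)) itself. If both curves agree modulo one step of a finite filtration, the
  velocities agree modulo the next, and the induction ends with the filtration. The obstacle on the
  analytic side is that in a product of increments the error of an early factor is conjugated by all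
  later ones, and conjugation is not Lipschitz for a homogeneous distance. The first factor is
  therefore allotted a smaller error than the rest, found by compactness on the unit scale and
  carried to all scales by dilations. Strict differentiability is used with error c/2, where c is
  the lower bound of L on H. The other half gives injectivity, turns one Newton step into a halving
  of the distance, and leads to c|a| \<le> (c/2)(|a| + |b|), hence to \<kappa> = 1.\<close>

unbundle no vec_syntax
unbundle fps_syntax

text \<open>For multiplying truncated series: when all terms beyond the diagonal vanish, the Cauchy
  product up to degree k is the product of the truncations.\<close>

lemma sum_triangle_eq_square:
  fixes c :: "nat \<Rightarrow> nat \<Rightarrow> 'a::comm_monoid_add"
  assumes "\<And>i j. i + j > k \<Longrightarrow> c i j = 0"
  shows "(\<Sum>n\<le>k. \<Sum>j\<le>n. c j (n - j)) = (\<Sum>i\<le>k. \<Sum>j\<le>k. c i j)"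
proof -
  have "(\<Sum>n\<le>k. \<Sum>j\<le>n. c j (n - j)) = (\<Sum>(i,j)\<in>{(i,j). i + j \<le> k}. c i j)"
    by (rule sum.triangle_reindex_eq [symmetric])
  also have "\<dots> = (\<Sum>(i,j)\<in>{..k} \<times> {..k}. c i j)"
    by (rule sum.mono_neutral_left) (auto, metis assms not_le_imp_less)
  finally show ?thesis by (simp add: sum.cartesian_product)
qed

subsection \<open>Evaluating power series at nilpotent operators\<close>

text \<open>The nilpotency hypotheses below concern the single vector \<open>b\<close>, because
  \<open>ad a\<close> will be nilpotent only on the filtered part of the algebra.\<close>

definition fps_op :: "nat \<Rightarrow> ('a::real_vector \<Rightarrow> 'a) \<Rightarrow> real fps \<Rightarrow> 'a \<Rightarrow> 'a" where
  "fps_op k a f b = (\<Sum>i\<le>k. (f $ i) *\<^sub>R (a ^^ i) b)"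

lemma linear_funpow: "linear (a::'a::real_vector \<Rightarrow> 'a) \<Longrightarrow> linear (a ^^ n)"
  by (induction n) (auto simp: linear_iff)

lemma linear_fps_op: "linear (a::'a::real_vector \<Rightarrow> 'a) \<Longrightarrow> linear (fps_op k a f)"
  unfolding fps_op_def
  by (intro linear_compose_sum ballI linear_compose_scale_right linear_funpow)

lemma fps_op_1: "fps_op k a 1 b = b"
proof -
  have "fps_op k a 1 b = (\<Sum>i\<le>k. if i = 0 then b else 0)"
    unfolding fps_op_def by (rule sum.cong) auto
  then show ?thesis by simp
qed

text \<open>Multiplicativity of the truncated calculus turns identities between formal power series
  into identities between operators.\<close>

lemma fps_op_mult:
  assumes a: "linear a" and nil: "\<And>i. i > k \<Longrightarrow> (a ^^ i) b = 0"
  shows "fps_op k a (f * g) b = fps_op k a f (fps_op k a g b)"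
proof -
  define c where "c i j = (f $ i * g $ j) *\<^sub>R (a ^^ (i + j)) b" for i j
  have "fps_op k a f (fps_op k a g b) = (\<Sum>i\<le>k. \<Sum>j\<le>k. c i j)"
    by (simp add: fps_op_def c_def linear_sum[OF linear_funpow[OF a]] scaleR_sum_right
        linear_cmul[OF linear_funpow[OF a]] funpow_add)
  also have "\<dots> = (\<Sum>n\<le>k. \<Sum>j\<le>n. c j (n - j))"
    by (rule sum_triangle_eq_square [symmetric]) (simp add: c_def nil)
  also have "\<dots> = fps_op k a (f * g) b"
    by (simp add: fps_op_def c_def fps_mult_nth scaleR_left.sum atMost_atLeast0)
  finally show ?thesis by simp
qed

lemma funpow_fps_op_eq_0:
  assumes a: "linear a" and nil: "\<And>i. i > k \<Longrightarrow> (a ^^ i) b = 0" and i: "i > k"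
  shows "(a ^^ i) (fps_op k a f b) = 0"
proof -
  have "(a ^^ i) ((a ^^ j) b) = 0" for j
    using nil[of "i + j"] i by (simp add: funpow_add)
  then show ?thesis
    by (simp add: fps_op_def linear_sum[OF linear_funpow[OF a]] linear_cmul[OF linear_funpow[OF a]])
qed

lemma fps_op_power:
  assumes a: "linear a" and nil: "\<And>i. i > k \<Longrightarrow> (a ^^ i) b = 0"
  shows "fps_op k a (f ^ n) b = (fps_op k a f ^^ n) b"
    and "i > k \<Longrightarrow> (a ^^ i) ((fps_op k a f ^^ n) b) = 0"
proof -
  have "fps_op k a (f ^ n) b = (fps_op k a f ^^ n) b \<and> (\<forall>i>k. (a ^^ i) ((fps_op k a f ^^ n) b) = 0)"
  proof (induction n)
    case 0 then show ?case by (simp add: fps_op_1 nil)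
  next
    case (Suc n)
    have "fps_op k a (f ^ Suc n) b = fps_op k a f (fps_op k a (f ^ n) b)"
      by (simp add: fps_op_mult[OF a nil])
    with Suc show ?case
      by (auto intro!: funpow_fps_op_eq_0[OF a])
  qed
  then show "fps_op k a (f ^ n) b = (fps_op k a f ^^ n) b"
    and "i > k \<Longrightarrow> (a ^^ i) ((fps_op k a f ^^ n) b) = 0" by auto
qed

text \<open>Since \<open>g\<close> has no constant term, \<open>g ^ n\<close> starts in degree n, so
  coefficients of degree at most k only see the powers up to k.\<close>

lemma fps_op_compose:
  assumes a: "linear a" and nil: "\<And>i. i > k \<Longrightarrow> (a ^^ i) b = 0" and g: "g $ 0 = 0"
  shows "fps_op k a (f oo g) b = (\<Sum>n\<le>k. (f $ n) *\<^sub>R (fps_op k a g ^^ n) b)"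
proof -
  have *: "(f oo g) $ i = (\<Sum>n\<le>k. f $ n * (g ^ n) $ i)" if "i \<le> k" for i
    unfolding fps_compose_nth using that
    by (intro sum.mono_neutral_left) (auto simp: not_le startsby_zero_power_prefix[OF g])
  have "fps_op k a (f oo g) b = (\<Sum>i\<le>k. \<Sum>n\<le>k. (f $ n) *\<^sub>R ((g ^ n) $ i) *\<^sub>R (a ^^ i) b)"
    by (simp add: fps_op_def * scaleR_left.sum)
  also have "\<dots> = (\<Sum>n\<le>k. (f $ n) *\<^sub>R fps_op k a (g ^ n) b)"
    by (subst sum.swap) (simp add: fps_op_def scaleR_sum_right)
  finally show ?thesis by (simp add: fps_op_power[OF a nil])
qed

text \<open>The series (e^x - 1) / x, which occurs in the derivative of the exponential.\<close>

definition fps_phi :: "real fps" where "fps_phi = Abs_fps (\<lambda>n. 1 / fact (Suc n))"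
text \<open>The series log(1 + x) / x. Its coefficients are the outer coefficients of Dynkin's
  formula, with n shifted by one.\<close>

definition fps_q :: "real fps" where "fps_q = Abs_fps (\<lambda>n. (-1) ^ n / real (Suc n))"

lemma fps_exp_minus_1: "fps_exp (1::real) - 1 = fps_X * fps_phi"
  by (rule fps_ext) (auto simp: fps_phi_def fact_reduce simp del: fact_Suc)

lemma fps_ln_1: "fps_ln (1::real) = fps_X * fps_q"
  by (rule fps_ext) (auto simp: fps_q_def fps_ln_nth)

lemma fps_ln_compose_exp: "fps_ln (1::real) oo (fps_exp 1 - 1) = fps_X"
  by (simp add: fps_ln_fps_exp_inv fps_inv)

text \<open>The product of (e^x - 1) / x with log(1 + y) / y at y = e^x - 1. This is why the
  logarithmic series in Dynkin's formula undoes the derivative of the exponential.\<close>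

lemma fps_phi_q: "fps_phi * (fps_q oo (fps_exp 1 - 1)) = 1"
proof -
  have "fps_X * (fps_phi * (fps_q oo (fps_exp 1 - 1))) = fps_X * 1"
    using fps_ln_compose_exp
    by (simp add: fps_ln_1 fps_compose_mult_distrib fps_exp_minus_1 mult.assoc)
  then show ?thesis by (simp only: mult_cancel_left fps_X_neq_zero) simp
qed

subsection \<open>The Baker-Campbell-Hausdorff formula in a filtered nilpotent algebra\<close>

lemma infdist_translate:
  fixes S :: "'a::real_normed_vector set"
  assumes S: "subspace S" and s: "s \<in> S"
  shows "infdist (x + s) S = infdist x S"
proof -
  have "infdist (y + u) S \<le> infdist y S" if "u \<in> S" for y u
  proof (rule field_le_epsilon)
    fix e :: real assume "e > 0"
    have ne: "S \<noteq> {}" using s by auto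
    obtain b where b: "b \<in> S" "dist y b < infdist y S + e"
      using ne \<open>e > 0\<close>
      by (smt (verit) infdist_def cINF_less_iff bdd_below_image_dist)
    have "infdist (y + u) S \<le> dist (y + u) (b + u)"
      by (intro infdist_le subspace_add[OF S] b that)
    then show "infdist (y + u) S \<le> infdist y S + e"
      using b by simp
  qed
  from this[OF s, of x] this[OF subspace_neg[OF S s], of "x + s"] show ?thesis by simp
qed

text \<open>A velocity inside \<open>S\<close> cannot change the distance to \<open>S\<close>, which
  is therefore constant. Using this distance avoids both complements and continuous
  functionals.\<close>

lemma vector_derivative_in_closed_subspace:
  fixes c :: "real \<Rightarrow> 'a::real_normed_vector"
  assumes S: "subspace S" "closed S"
    and d: "\<And>t. 0 < t \<Longrightarrow> t < 1 \<Longrightarrow> \<exists>D\<in>S. (c has_vector_derivative D) (at t)"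
    and cont: "continuous_on {0..1} c" and 0: "c 0 \<in> S"
  shows "c 1 \<in> S"
proof -
  define g where "g t = infdist (c t) S" for t
  have "(g has_real_derivative 0) (at t)" if t: "0 < t" "t < 1" for t
  proof -
    obtain D where D: "D \<in> S" "(c has_vector_derivative D) (at t)" using d[OF t] by auto
    have "((\<lambda>y. norm (c y - c t - (y - t) *\<^sub>R D) / norm (y - t)) \<longlongrightarrow> 0) (at t)"
      using D(2) unfolding has_vector_derivative_def has_derivative_iff_norm by auto
    moreover have "norm ((g y - g t) / (y - t)) \<le> norm (c y - c t - (y - t) *\<^sub>R D) / norm (y - t)" for y
    proof -
      have "g y = infdist (c y - (y - t) *\<^sub>R D) S"
        using infdist_translate[OF S(1), of "- ((y - t) *\<^sub>R D)" "c y"] D(1)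
        by (auto simp: g_def subspace_neg[OF S(1)] subspace_scale[OF S(1)])
      moreover have "\<bar>infdist (c y - (y - t) *\<^sub>R D) S - g t\<bar> \<le> dist (c y - (y - t) *\<^sub>R D) (c t)"
        unfolding g_def by (rule infdist_triangle_abs)
      ultimately have "\<bar>g y - g t\<bar> \<le> norm (c y - c t - (y - t) *\<^sub>R D)"
        by (simp add: dist_norm algebra_simps)
      then show ?thesis by (simp add: divide_right_mono)
    qed
    ultimately have "((\<lambda>y. (g y - g t) / (y - t)) \<longlongrightarrow> 0) (at t)"
      by (intro Lim_null_comparison[where f="\<lambda>y. (g y - g t) / (y - t)"] always_eventually) auto
    then show ?thesis by (simp add: has_field_derivative_iff)
  qed
  moreover have "continuous_on {0..1} g"
    unfolding g_def by (intro continuous_intros cont)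
  ultimately have "g 1 = g 0"
    by (intro DERIV_isconst_end) auto
  then have "infdist (c 1) S = 0" using 0 by (simp add: g_def)
  then show ?thesis using S(2) 0 using in_closed_iff_infdist_zero[of S "c 1"] by auto
qed

section \<open>Commutators and derivatives of powers\<close>

definition ad :: "'a::ring \<Rightarrow> 'a \<Rightarrow> 'a" where "ad a b = a * b - b * a"

lemma linear_ad: "linear (ad (a::'a::real_algebra))"
  by (rule linearI) (auto simp: ad_def algebra_simps)

text \<open>Left multiplication by \<open>a\<close> is the sum of \<open>ad a\<close> and right
  multiplication by \<open>a\<close>. These two commute, so the binomial theorem applies.\<close>

lemma power_mult_ad:
  fixes a :: "'a::real_algebra_1"
  shows "a ^ n * b = (\<Sum>j\<le>n. real (n choose j) *\<^sub>R ((ad a ^^ j) b * a ^ (n - j)))"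
proof (induction n arbitrary: b)
  case 0 then show ?case by simp
next
  case (Suc n)
  have "a ^ Suc n * b = a ^ n * (a * b)" by (simp add: power_Suc2 mult.assoc del: power_Suc)
  also have "\<dots> = a ^ n * b * a + a ^ n * ad a b"
    by (simp add: ad_def algebra_simps)
  also have "\<dots> = (\<Sum>j\<le>n. real (n choose j) *\<^sub>R ((ad a ^^ j) b * a ^ (Suc n - j)))
     + (\<Sum>j\<le>n. real (n choose j) *\<^sub>R ((ad a ^^ Suc j) b * a ^ (Suc n - Suc j)))"
    by (simp add: Suc.IH sum_distrib_right mult.assoc power_Suc2 Suc_diff_le funpow_swap1
        del: power_Suc)
  also have "(\<Sum>j\<le>n. real (n choose j) *\<^sub>R ((ad a ^^ j) b * a ^ (Suc n - j)))
     = a ^ Suc n * 0 + (\<Sum>j\<le>Suc n. real (n choose j) *\<^sub>R ((ad a ^^ j) b * a ^ (Suc n - j)))"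
    by simp
  also have "\<dots> = b * a ^ Suc n + (\<Sum>j\<le>n. real (n choose Suc j) *\<^sub>R ((ad a ^^ Suc j) b * a ^ (Suc n - Suc j)))"
    by (subst sum.atMost_Suc_shift) simp
  finally show ?case
    by (subst sum.atMost_Suc_shift) (simp add: sum.distrib[symmetric] algebra_simps)
qed

text \<open>Moving Z' to the left of all powers of Z produces the iterated commutators; the
  coefficients combine by Pascal's rule.\<close>

lemma has_vector_derivative_power_ad:
  fixes Z :: "real \<Rightarrow> 'a::{real_normed_algebra,real_algebra_1}"
  assumes Z: "(Z has_vector_derivative Z') (at t)"
  shows "((\<lambda>t. Z t ^ n) has_vector_derivative
     (\<Sum>j<n. real (n choose Suc j) *\<^sub>R ((ad (Z t) ^^ j) Z' * Z t ^ (n - Suc j)))) (at t)"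
proof (induction n)
  case 0 then show ?case by simp
next
  case (Suc n)
  have "((\<lambda>t. Z t ^ n * Z t) has_vector_derivative
     Z t ^ n * Z' + (\<Sum>j<n. real (n choose Suc j) *\<^sub>R ((ad (Z t) ^^ j) Z' * Z t ^ (n - Suc j))) * Z t) (at t)"
    by (rule has_vector_derivative_mult[OF Suc Z])
  also have "(\<lambda>t. Z t ^ n * Z t) = (\<lambda>t. Z t ^ Suc n)" by (simp add: power_commutes)
  also have "(\<Sum>j<n. real (n choose Suc j) *\<^sub>R ((ad (Z t) ^^ j) Z' * Z t ^ (n - Suc j))) * Z t
     = (\<Sum>j\<le>n. real (n choose Suc j) *\<^sub>R ((ad (Z t) ^^ j) Z' * Z t ^ (n - j)))"
    unfolding sum_distrib_right lessThan_Suc_atMost[symmetric]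
    by (simp add: mult.assoc power_Suc2[symmetric] Suc_diff_Suc binomial_eq_0 del: power_Suc)
  also have "Z t ^ n * Z' = (\<Sum>j\<le>n. real (n choose j) *\<^sub>R ((ad (Z t) ^^ j) Z' * Z t ^ (n - j)))"
    by (rule power_mult_ad)
  finally show ?case
    by (simp add: sum.distrib[symmetric] lessThan_Suc_atMost algebra_simps)
qed

lemma nbr_map_scaleR:
  fixes br :: "'a::real_vector \<Rightarrow> 'a \<Rightarrow> 'a"
  assumes "\<And>c d a b. br (c *\<^sub>R a) (d *\<^sub>R b) = (c * d) *\<^sub>R br a b"
  shows "nbr br (map (\<lambda>x. t *\<^sub>R x) w) = t ^ length w *\<^sub>R nbr br w"
  by (induction w rule: induct_list012) (auto simp: assms)

lemma dyn_word_map: "map f (dyn_word X Y ps) = dyn_word (f X) (f Y) ps"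
  by (auto simp: dyn_word_def map_concat o_def case_prod_beta' intro!: arg_cong[where f=concat])

lemma length_dyn_word: "length (dyn_word X Y ps) = sum_list (map (\<lambda>(r, s). r + s) ps)"
  by (induction ps) (auto simp: dyn_word_def)

lemma dyn_word_Cons: "dyn_word X Y ((r, s) # ps) = replicate r X @ replicate s Y @ dyn_word X Y ps"
  by (simp add: dyn_word_def)

lemma dyn_word_Nil: "dyn_word X Y [] = []"
  by (simp add: dyn_word_def)

lemma nbr_replicate_append:
  "w \<noteq> [] \<Longrightarrow> nbr br (replicate r X @ w) = (br X ^^ r) (nbr br w)"
proof (induction r)
  case (Suc r)
  obtain b v where bv: "replicate r X @ w = b # v" using Suc.prems by (cases "replicate r X @ w") auto
  then show ?case using Suc by auto
qed simp

text \<open>\<open>F 0\<close> is a subalgebra and \<open>F 1\<close> a nilpotent ideal in it; the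
  ambient algebra may be larger than \<open>F 0\<close>. Closedness lets membership pass from the
  derivative of a curve to the curve.\<close>

locale nilpotent_algebra =
  fixes F :: "nat \<Rightarrow> 'a::{real_normed_algebra,real_algebra_1} set" and k :: nat
  assumes subspace_F: "subspace (F m)" and closed_F: "closed (F m)"
    and mult_F: "a \<in> F i \<Longrightarrow> b \<in> F j \<Longrightarrow> a * b \<in> F (i + j)"
    and F_Suc: "F (Suc m) \<subseteq> F m" and F_0: "1 \<in> F 0" and F_top: "F (Suc k) = {0}"
begin

lemma F_anti: "i \<le> j \<Longrightarrow> F j \<subseteq> F i"
  by (rule lift_Suc_antimono_le[where f=F, OF F_Suc])

lemma F_antiD: "a \<in> F j \<Longrightarrow> i \<le> j \<Longrightarrow> a \<in> F i"
  using F_anti by blast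

lemma F_nil: "a \<in> F m \<Longrightarrow> m > k \<Longrightarrow> a = 0"
  using F_antiD[of a m "Suc k"] F_top by auto

lemmas F_add = subspace_add[OF subspace_F] and F_diff = subspace_diff[OF subspace_F]
  and F_neg = subspace_neg[OF subspace_F] and F_scale = subspace_scale[OF subspace_F]
  and F_zero = subspace_0[OF subspace_F] and F_sum = subspace_sum[OF subspace_F]

lemma F_mult_right: "a \<in> F m \<Longrightarrow> b \<in> F 0 \<Longrightarrow> a * b \<in> F m"
  using mult_F[of a m b 0] by simp

lemma power_F: "a \<in> F 1 \<Longrightarrow> a ^ n \<in> F n"
  using mult_F[of a 1] by (induction n) (auto simp: F_0)

lemma ad_F: "a \<in> F i \<Longrightarrow> b \<in> F j \<Longrightarrow> ad a b \<in> F (i + j)"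
  unfolding ad_def using mult_F[of a i b j] mult_F[of b j a i] by (intro F_diff) (auto simp: add.commute)

lemma funpow_ad_F: "a \<in> F 1 \<Longrightarrow> b \<in> F j \<Longrightarrow> (ad a ^^ n) b \<in> F (n + j)"
  using ad_F[of a 1] by (induction n) auto

lemma funpow_ad_nil: "a \<in> F 1 \<Longrightarrow> b \<in> F j \<Longrightarrow> n + j > k \<Longrightarrow> (ad a ^^ n) b = 0"
  using funpow_ad_F F_nil by blast

definition texp :: "'a \<Rightarrow> 'a" where "texp a = (\<Sum>i\<le>k. a ^ i /\<^sub>R fact i)"
text \<open>The exponential of \<open>ad a\<close>, which by \<open>tead_mult_texp\<close> is
  conjugation by \<open>texp a\<close>.\<close>

definition tead :: "'a \<Rightarrow> 'a \<Rightarrow> 'a" where "tead a b = fps_op k (ad a) (fps_exp 1) b"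

lemma tead_altdef: "tead a b = (\<Sum>i\<le>k. (ad a ^^ i) b /\<^sub>R fact i)"
  by (simp add: tead_def fps_op_def inverse_eq_divide)

lemma linear_tead: "linear (tead a)"
  unfolding tead_def by (intro linear_fps_op linear_ad)

lemma fps_op_ad_F: "a \<in> F 1 \<Longrightarrow> b \<in> F j \<Longrightarrow> fps_op k (ad a) f b \<in> F j"
  unfolding fps_op_def
  by (intro F_sum F_scale) (auto intro: F_antiD[OF funpow_ad_F])

lemma tead_F: "a \<in> F 1 \<Longrightarrow> b \<in> F j \<Longrightarrow> tead a b \<in> F j"
  unfolding tead_def by (rule fps_op_ad_F)

lemma tead_minus_F:
  assumes "a \<in> F 1" "b \<in> F j" shows "tead a b - b \<in> F (Suc j)"
proof -
  have "tead a b - b = (\<Sum>i<k. (ad a ^^ Suc i) b /\<^sub>R fact (Suc i))"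
    by (simp add: tead_altdef lessThan_Suc_atMost[symmetric] sum.lessThan_Suc_shift del: sum.lessThan_Suc)
  also have "\<dots> \<in> F (Suc j)"
    by (intro F_sum F_scale F_antiD[OF funpow_ad_F[OF assms, of "Suc _"]]) auto
  finally show ?thesis .
qed

lemma texp_F0: "a \<in> F 1 \<Longrightarrow> texp a \<in> F 0"
  unfolding texp_def by (intro F_sum F_scale) (auto intro: F_antiD[OF power_F])

text \<open>Conjugation by e^a is e^(ad a), here without an inverse. It is
  \<open>power_mult_ad\<close> divided by n! and regrouped as a Cauchy product.\<close>

lemma tead_mult_texp:
  assumes "a \<in> F 1" "b \<in> F j" shows "tead a b * texp a = texp a * b"
proof -
  have "texp a * b = (\<Sum>n\<le>k. \<Sum>j\<le>n. ((ad a ^^ j) b * a ^ (n - j)) /\<^sub>R (fact j * fact (n - j)))"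
    by (simp add: texp_def sum_distrib_right power_mult_ad scaleR_sum_right binomial_fact field_simps)
  also have "\<dots> = (\<Sum>i\<le>k. \<Sum>j\<le>k. ((ad a ^^ i) b * a ^ j) /\<^sub>R (fact i * fact j))"
    by (rule sum_triangle_eq_square)
      (subst F_nil[OF mult_F[OF funpow_ad_F[OF assms] power_F[OF assms(1)]]], auto)
  also have "\<dots> = tead a b * texp a"
    by (simp add: texp_def tead_altdef sum_product mult.commute)
  finally show ?thesis ..
qed

lemma funpow_mult_left: "((\<lambda>b. c * b) ^^ n) b = c ^ n * (b::'a)"
  by (induction n) (auto simp: mult.assoc)

lemma linear_mult_left: "linear (\<lambda>b. c * (b::'a))"
  by (rule linearI) (auto simp: algebra_simps)

lemma fps_op_mult_left: "fps_op k (\<lambda>b. c * b) f b = fps_op k (\<lambda>b. c * b) f 1 * (b::'a)"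
  by (simp add: fps_op_def funpow_mult_left sum_distrib_right)

lemma texp_scaleR: "texp (s *\<^sub>R a) = fps_op k (\<lambda>b. a * b) (fps_exp s) 1"
proof -
  have "(s *\<^sub>R a) ^ i = s ^ i *\<^sub>R a ^ i" for i by (induction i) auto
  then show ?thesis by (simp add: texp_def fps_op_def funpow_mult_left divide_inverse mult.commute)
qed

lemma texp_scaleR_add:
  assumes "a \<in> F 1" shows "texp ((s + t) *\<^sub>R a) = texp (s *\<^sub>R a) * texp (t *\<^sub>R a)"
proof -
  have "fps_op k (\<lambda>b. a * b) (fps_exp s * fps_exp t) 1 =
      fps_op k (\<lambda>b. a * b) (fps_exp s) (fps_op k (\<lambda>b. a * b) (fps_exp t) 1)"
    by (rule fps_op_mult[OF linear_mult_left]) (use F_nil[OF power_F[OF assms]] in \<open>simp add: funpow_mult_left\<close>)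
  then show ?thesis
    unfolding texp_scaleR fps_exp_add_mult by (subst (asm) (2) fps_op_mult_left)
qed

lemma texp_0 [simp]: "texp 0 = 1"
proof -
  have "texp 0 = (\<Sum>i\<le>k. if i = 0 then 1 else 0)"
    unfolding texp_def by (rule sum.cong) (auto simp: zero_power)
  then show ?thesis by simp
qed

lemma texp_minus: "a \<in> F 1 \<Longrightarrow> texp a * texp (- a) = 1"
  using texp_scaleR_add[of a 1 "- 1"] by simp

lemma texp_F:
  assumes "a \<in> F 1" "a \<in> F j" shows "texp a - 1 \<in> F j"
proof -
  have "texp a - 1 = (\<Sum>i<k. (a * a ^ i) /\<^sub>R fact (Suc i))"
    by (simp add: texp_def lessThan_Suc_atMost[symmetric] sum.lessThan_Suc_shift del: sum.lessThan_Suc)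
  also have "\<dots> \<in> F j"
    by (intro F_sum F_scale F_mult_right F_antiD[OF power_F[OF assms(1)]] assms) simp
  finally show ?thesis .
qed

text \<open>The identity log(e^x) = x, evaluated at the operator of left multiplication by
  \<open>a\<close> and applied to 1.\<close>

lemma tlog_texp:
  assumes a: "a \<in> F 1"
  shows "a = (\<Sum>n\<le>k. (fps_ln 1 $ n) *\<^sub>R (texp a - 1) ^ n)"
proof (cases "k = 0")
  \<comment> \<open>The truncated sum then has no linear term, but \<open>F 1\<close> is
    zero.\<close>
  case True
  with F_nil[OF a] show ?thesis by simp
next
  case False
  define l where "l = (\<lambda>b. a * b)"
  have lin: "linear l" unfolding l_def by (rule linear_mult_left)
  note pow = funpow_mult_left
  have nil: "(l ^^ i) b = 0" if "i > k" for i b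
    using F_nil[OF power_F[OF a] that] by (simp add: pow l_def)
  have exp: "fps_op k l (fps_exp 1 - 1) = (\<lambda>b. (texp a - 1) * b)"
  proof
    fix b
    have "fps_op k l (fps_exp 1 - 1) b = fps_op k l (fps_exp 1) b - fps_op k l 1 b"
      unfolding fps_op_def by (simp add: sum_subtractf[symmetric] scaleR_left_diff_distrib)
    also have "\<dots> = fps_op k l (fps_exp 1) b - b" by (simp only: fps_op_1)
    also have "\<dots> = (texp a - 1) * b"
      by (simp add: fps_op_def l_def pow texp_def left_diff_distrib sum_distrib_right inverse_eq_divide)
    finally show "fps_op k l (fps_exp 1 - 1) b = (texp a - 1) * b" .
  qed
  have "fps_op k l fps_X 1 = fps_op k l (fps_ln 1 oo (fps_exp 1 - 1)) 1"
    by (simp only: fps_ln_compose_exp)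
  also have "\<dots> = (\<Sum>n\<le>k. (fps_ln 1 $ n) *\<^sub>R (fps_op k l (fps_exp 1 - 1) ^^ n) 1)"
    by (rule fps_op_compose[OF lin nil]) auto
  also have "fps_op k l fps_X 1 = (\<Sum>i\<le>k. if i = 1 then a else 0)"
    unfolding fps_op_def l_def by (rule sum.cong) (auto simp: fps_X_def)
  also have "\<dots> = a" using False by simp
  finally show ?thesis by (simp add: exp pow)
qed

lemma texp_inj: "a \<in> F 1 \<Longrightarrow> b \<in> F 1 \<Longrightarrow> texp a = texp b \<Longrightarrow> a = b"
  using tlog_texp by metis

text \<open>The logarithm equals its linear term up to products of at least two elements of
  \<open>F m\<close>, and these lie in \<open>F (2 * m)\<close>, hence in \<open>F (Suc m)\<close>
  as m \<ge> 1.\<close>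

lemma texp_leading:
  assumes a: "a \<in> F 1" and c: "texp a - 1 - c \<in> F (Suc m)" "c \<in> F m" and m: "m \<ge> 1"
  shows "a - c \<in> F (Suc m)"
proof (cases "k = 0")
  case True
  with F_nil[OF a] F_nil[OF c(2)] m show ?thesis by (simp add: F_zero)
next
  case False
  define e where "e = texp a - 1"
  have e: "e \<in> F m" using F_add[OF F_antiD[OF c(1), of m] c(2)] by (simp add: e_def)
  have pw: "e ^ Suc n \<in> F (m + n * m)" for n
    using mult_F[OF e] e by (induction n) (auto simp: add.assoc)
  have "a = (\<Sum>n\<le>k. (fps_ln 1 $ n) *\<^sub>R e ^ n)" unfolding e_def by (rule tlog_texp[OF a])
  also have "{..k} = insert 1 (insert 0 {2..k})" using False by auto
  also have "(\<Sum>n\<in>insert 1 (insert 0 {2..k}). (fps_ln 1 $ n) *\<^sub>R e ^ n) =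
      e + (\<Sum>n\<in>{2..k}. (fps_ln 1 $ n) *\<^sub>R e ^ n)"
    by (simp add: fps_ln_nth)
  finally have "a - c = (e - c) + (\<Sum>n\<in>{2..k}. (fps_ln 1 $ n) *\<^sub>R e ^ n)" by simp
  also have "\<dots> \<in> F (Suc m)"
  proof (intro F_add F_sum F_scale)
    show "e - c \<in> F (Suc m)" using c by (simp add: e_def)
    fix n assume "n \<in> {2..k}"
    then have "n = Suc (Suc (n - 2))" by auto
    then obtain n' where n': "n = Suc (Suc n')" by blast
    show "e ^ n \<in> F (Suc m)"
      unfolding n' by (rule F_antiD[OF pw]) (use m in auto)
  qed
  finally show ?thesis .
qed

text \<open>The binomial coefficients divided by n! factor into 1/(j+1)! and 1/(n-j-1)!, which
  separates the series (e^x - 1) / x in \<open>ad (Z t)\<close> from the exponential of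
  \<open>Z t\<close>.\<close>

lemma texp_has_vector_derivative:
  assumes Z: "(Z has_vector_derivative Z') (at t)" and Zt: "Z t \<in> F 1" and Z': "Z' \<in> F 1"
  shows "((\<lambda>t. texp (Z t)) has_vector_derivative fps_op k (ad (Z t)) fps_phi Z' * texp (Z t)) (at t)"
proof -
  define c where "c i j = ((ad (Z t) ^^ i) Z' * Z t ^ j) /\<^sub>R (fact (Suc i) * fact j)" for i j
  \<comment> \<open>Terms vanish already for i + j = k, since Z' contributes one degree. This
    restores the row lost in the index shift below.\<close>
  have c0: "c i j = 0" if "i + j \<ge> k" for i j
    using F_nil[OF mult_F[OF funpow_ad_F[OF Zt Z', of i] power_F[OF Zt, of j]]] that by (simp add: c_def)
  have "((\<lambda>t. texp (Z t)) has_vector_derivative (\<Sum>n\<le>k. 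
     (\<Sum>j<n. real (n choose Suc j) *\<^sub>R ((ad (Z t) ^^ j) Z' * Z t ^ (n - Suc j))) /\<^sub>R fact n)) (at t)"
    unfolding texp_def
    by (intro has_vector_derivative_sum bounded_linear.has_vector_derivative[OF bounded_linear_scaleR_right]
        has_vector_derivative_power_ad Z)
  also have "(\<Sum>n\<le>k. (\<Sum>j<n. real (n choose Suc j) *\<^sub>R ((ad (Z t) ^^ j) Z' * Z t ^ (n - Suc j))) /\<^sub>R fact n)
     = (\<Sum>n\<le>k. \<Sum>j<n. c j (n - Suc j))"
    by (simp add: scaleR_sum_right c_def binomial_fact field_simps)
  also have "\<dots> = (\<Sum>n<k. \<Sum>j\<le>n. c j (n - j))"
    by (simp add: lessThan_Suc_atMost[symmetric] sum.lessThan_Suc_shift del: sum.lessThan_Suc)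
  also have "\<dots> = (\<Sum>n\<le>k. \<Sum>j\<le>n. c j (n - j))"
    by (simp add: lessThan_Suc_atMost[symmetric] c0)
  also have "\<dots> = (\<Sum>i\<le>k. \<Sum>j\<le>k. c i j)"
    by (rule sum_triangle_eq_square) (simp add: c0)
  also have "\<dots> = fps_op k (ad (Z t)) fps_phi Z' * texp (Z t)"
    by (simp add: c_def texp_def fps_op_def fps_phi_def sum_product mult.commute divide_inverse_commute
        del: fact_Suc)
  finally show ?thesis .
qed

end

section \<open>Dynkin's sum as a power series in one operator\<close>

definition bch_indices :: "nat \<Rightarrow> nat \<Rightarrow> (nat \<times> nat) list set" where
  "bch_indices k n = {ps. length ps = n \<and> (\<forall>(r, s)\<in>set ps. 1 \<le> r + s \<and> r + s \<le> k)}"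

definition bch_weight :: "(nat \<times> nat) list \<Rightarrow> real" where
  "bch_weight ps = prod_list (map (\<lambda>(r, s). fact r * fact s) ps)"

definition bch_coeff :: "nat \<Rightarrow> (nat \<times> nat) list \<Rightarrow> real" where
  "bch_coeff n ps = ((-1) ^ (n - 1) / real n) / (real (sum_list (map (\<lambda>(r, s). r + s) ps)) * bch_weight ps)"

lemma bch_altdef:
  "bch br k X Y = (\<Sum>n\<in>{1..k}. \<Sum>ps\<in>bch_indices k n. bch_coeff n ps *\<^sub>R nbr br (dyn_word X Y ps))"
  unfolding bch_def bch_indices_def bch_weight_def bch_coeff_def ..

lemma sum_bch_indices_Suc:
  "(\<Sum>ps\<in>bch_indices k (Suc n). f ps) =
   (\<Sum>(r, s)\<in>{(r, s). 1 \<le> r + s \<and> r + s \<le> k}. \<Sum>ps\<in>bch_indices k n. f ((r, s) # ps))"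
proof -
  have "bch_indices k (Suc n) = (\<lambda>(p, ps). p # ps) ` ({(r, s). 1 \<le> r + s \<and> r + s \<le> k} \<times> bch_indices k n)"
    by (auto simp: bch_indices_def length_Suc_conv image_iff)
  moreover have "inj_on (\<lambda>(p, ps). p # ps) ({(r, s). 1 \<le> r + s \<and> r + s \<le> k} \<times> bch_indices k n)"
    by (auto simp: inj_on_def)
  ultimately have "(\<Sum>ps\<in>bch_indices k (Suc n). f ps) =
      (\<Sum>(p, ps)\<in>{(r, s). 1 \<le> r + s \<and> r + s \<le> k} \<times> bch_indices k n. f (p # ps))"
    by (simp add: sum.reindex case_prod_beta')
  also have "\<dots> = (\<Sum>p\<in>{(r, s). 1 \<le> r + s \<and> r + s \<le> k}. \<Sum>ps\<in>bch_indices k n. f (p # ps))"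
    by (rule sum.cartesian_product[symmetric])
  finally show ?thesis by (simp add: case_prod_beta')
qed

lemma dyn_word_nonempty:
  "ps \<in> bch_indices k (Suc n) \<Longrightarrow> dyn_word X Y ps \<noteq> []"
  by (auto simp: bch_indices_def length_Suc_conv dyn_word_Cons)

lemma bch_weight_Cons: "bch_weight ((r, s) # ps) = fact r * fact s * bch_weight ps"
  by (simp add: bch_weight_def)

lemma nbr_replicate_Suc: "nbr br (replicate (Suc r) X) = (br X ^^ r) X"
  using nbr_replicate_append[of "[X]" br r X] by (simp add: replicate_append_same[symmetric])

lemma funpow_ad_self: "(ad X ^^ r) X = (if r = 0 then X else 0)" for X :: "'a::real_algebra"
proof (induction r)
  case (Suc r)
  have "ad X X = 0" "ad X 0 = 0" by (simp_all add: ad_def)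
  with Suc show ?case by simp
qed simp

text \<open>A right-nested bracket whose last two letters coincide is zero, so the innermost block
  survives only as a lone X or with exactly one Y at its end.\<close>

lemma nbr_ad_replicate2:
  fixes X Y :: "'a::real_algebra"
  assumes "1 \<le> r + s"
  shows "nbr ad (replicate r X @ replicate s Y) =
    (if s = 0 then if r = 1 then X else 0 else if s = 1 then (ad X ^^ r) Y else 0)"
proof (cases s)
  case 0
  then obtain r' where "r = Suc r'" using assms by (cases r) auto
  with 0 show ?thesis
    using nbr_replicate_Suc[of ad r' X] by (auto simp: funpow_ad_self)
next
  case (Suc s')
  have "nbr ad (replicate r X @ replicate s Y) = (ad X ^^ r) ((ad Y ^^ s') Y)"
    using nbr_replicate_append[of "replicate s Y" ad r X] nbr_replicate_Suc[of ad s' Y] Suc by simp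
  then show ?thesis
    using Suc by (auto simp: funpow_ad_self linear_0[OF linear_funpow[OF linear_ad]])
qed

context nilpotent_algebra
begin

text \<open>The operator e^(ad X) e^(ad Y) - 1; expanded, it is the sum over one block of letters in
  Dynkin's formula.\<close>

definition bch_op :: "'a \<Rightarrow> 'a \<Rightarrow> 'a \<Rightarrow> 'a" where
  "bch_op X Y B = tead X (tead Y B) - B"

text \<open>The logarithmic derivative of \<open>e\<^bsup>tX\<^esup> e\<^bsup>tY\<^esup>\<close> at \<open>t = 1\<close>.\<close>

definition bch_vel :: "'a \<Rightarrow> 'a \<Rightarrow> 'a" where
  "bch_vel X Y = X + tead X Y"

lemma bch_vel_F: "X \<in> F 1 \<Longrightarrow> Y \<in> F 1 \<Longrightarrow> bch_vel X Y \<in> F 1"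
  unfolding bch_vel_def by (intro F_add tead_F)

lemma bch_op_F:
  assumes "X \<in> F 1" "Y \<in> F 1" "B \<in> F j"
  shows "bch_op X Y B \<in> F (Suc j)"
proof -
  have "bch_op X Y B = (tead X (tead Y B) - tead Y B) + (tead Y B - B)"
    by (simp add: bch_op_def)
  also have "\<dots> \<in> F (Suc j)"
    by (intro F_add tead_minus_F tead_F assms)
  finally show ?thesis .
qed

lemma funpow_bch_op_F:
  "X \<in> F 1 \<Longrightarrow> Y \<in> F 1 \<Longrightarrow> B \<in> F j \<Longrightarrow> (bch_op X Y ^^ n) B \<in> F (n + j)"
  by (induction n) (auto intro: bch_op_F)

lemma bch_op_altdef:
  assumes X: "X \<in> F 1" and Y: "Y \<in> F 1" and B: "B \<in> F 1"
  shows "bch_op X Y B = (\<Sum>(r, s)\<in>{(r, s). 1 \<le> r + s \<and> r + s \<le> k}.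
     (ad X ^^ r) ((ad Y ^^ s) B) /\<^sub>R (fact r * fact s))"
proof -
  define g where "g = (\<lambda>(r, s). (ad X ^^ r) ((ad Y ^^ s) B) /\<^sub>R (fact r * fact s))"
  have z: "g (r, s) = 0" if "r + s > k" for r s
    using F_nil[OF funpow_ad_F[OF X funpow_ad_F[OF Y B, of s], of r]] that by (simp add: g_def)
  have "tead X (tead Y B) = (\<Sum>r\<le>k. \<Sum>s\<le>k. g (r, s))"
    by (simp add: tead_altdef linear_sum[OF linear_funpow[OF linear_ad]]
        linear_cmul[OF linear_funpow[OF linear_ad]] scaleR_sum_right g_def)
  also have "\<dots> = (\<Sum>p\<in>{..k} \<times> {..k}. g p)" by (simp add: sum.cartesian_product)
  also have "\<dots> = (\<Sum>p\<in>insert (0, 0) {(r, s). 1 \<le> r + s \<and> r + s \<le> k}. g p)"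
  proof (rule sum.mono_neutral_right)
    show "\<forall>p\<in>{..k} \<times> {..k} - insert (0, 0) {(r, s). 1 \<le> r + s \<and> r + s \<le> k}. g p = 0"
    proof
      fix p assume p: "p \<in> {..k} \<times> {..k} - insert (0, 0) {(r, s). 1 \<le> r + s \<and> r + s \<le> k}"
      obtain r s where rs: "p = (r, s)" by fastforce
      with p have "r + s > k" by auto
      then show "g p = 0" using z rs by simp
    qed
  qed auto
  also have "\<dots> = B + (\<Sum>p\<in>{(r, s). 1 \<le> r + s \<and> r + s \<le> k}. g p)"
  proof (subst sum.insert)
    show "finite {(r, s). 1 \<le> r + s \<and> r + s \<le> k}"
      by (rule finite_subset[of _ "{..k} \<times> {..k}"]) auto
  qed (auto simp: g_def)
  finally show ?thesis by (simp add: bch_op_def g_def)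
qed

text \<open>The innermost block sums to \<open>bch_vel\<close>, and each block in front of it
  applies \<open>bch_op\<close> once more.\<close>

lemma bch_indices_sum:
  assumes X: "X \<in> F 1" and Y: "Y \<in> F 1" and k: "k \<ge> 1"
  shows "(\<Sum>ps\<in>bch_indices k (Suc n). nbr ad (dyn_word X Y ps) /\<^sub>R bch_weight ps) =
    (bch_op X Y ^^ n) (bch_vel X Y)"
proof (induction n)
  case 0
  have i0: "bch_indices k 0 = {[]}" by (auto simp: bch_indices_def)
  define g where "g = (\<lambda>(r, s). nbr ad (replicate r X @ replicate s Y) /\<^sub>R (fact r * fact s))"
  have "(\<Sum>ps\<in>bch_indices k (Suc 0). nbr ad (dyn_word X Y ps) /\<^sub>R bch_weight ps)
     = (\<Sum>p\<in>{(r, s). 1 \<le> r + s \<and> r + s \<le> k}. g p)"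
    unfolding sum_bch_indices_Suc
    by (simp add: i0 dyn_word_Cons dyn_word_Nil bch_weight_Cons g_def case_prod_beta') (simp add: bch_weight_def)
  \<comment> \<open>The surviving blocks are X alone and r letters X followed by one Y. The
    constraint r + 1 \<le> k omits the term r = k of \<open>tead X Y\<close>, which is zero by
    nilpotency.\<close>
  also have "\<dots> = (\<Sum>p\<in>insert (1, 0) ((\<lambda>r. (r, 1)) ` {..<k}). g p)"
  proof (rule sum.mono_neutral_right)
    show "finite {(r, s). 1 \<le> r + s \<and> r + s \<le> k}"
      by (rule finite_subset[of _ "{..k} \<times> {..k}"]) auto
    show "insert (1, 0) ((\<lambda>r. (r, 1)) ` {..<k}) \<subseteq> {(r, s). 1 \<le> r + s \<and> r + s \<le> k}"
      using k by auto
    show "\<forall>p\<in>{(r, s). 1 \<le> r + s \<and> r + s \<le> k} - insert (1, 0) ((\<lambda>r. (r, 1)) ` {..<k}). g p = 0"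
    proof
      fix p assume p: "p \<in> {(r, s). 1 \<le> r + s \<and> r + s \<le> k} - insert (1, 0) ((\<lambda>r. (r, 1)) ` {..<k})"
      obtain r s where rs: "p = (r, s)" by fastforce
      with p have h: "1 \<le> r + s" "r + s \<le> k" "\<not> (r = 1 \<and> s = 0)" "s = 1 \<longrightarrow> \<not> r < k"
        by (auto simp: image_iff)
      then have "s = 1 \<longrightarrow> False" by auto
      then show "g p = 0" using h by (auto simp: g_def rs nbr_ad_replicate2)
    qed
  qed
  also have "\<dots> = g (1, 0) + (\<Sum>r<k. g (r, 1))"
    by (subst sum.insert) (auto simp: sum.reindex inj_on_def)
  also have "g (1, 0) = X" by (simp add: g_def)
  also have "(\<Sum>r<k. g (r, 1)) = (\<Sum>r<k. (ad X ^^ r) Y /\<^sub>R fact r)"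
    by (intro sum.cong refl) (subst g_def, simp add: nbr_ad_replicate2 del: replicate_Suc replicate.simps)
  also have "\<dots> = tead X Y"
    using funpow_ad_nil[OF X Y, of k] by (simp add: tead_altdef lessThan_Suc_atMost[symmetric])
  finally show ?case by (simp add: bch_vel_def)
next
  case (Suc n)
  have "(\<Sum>ps\<in>bch_indices k (Suc (Suc n)). nbr ad (dyn_word X Y ps) /\<^sub>R bch_weight ps)
    = (\<Sum>(r, s)\<in>{(r, s). 1 \<le> r + s \<and> r + s \<le> k}. \<Sum>ps\<in>bch_indices k (Suc n).
        (ad X ^^ r) ((ad Y ^^ s) (nbr ad (dyn_word X Y ps))) /\<^sub>R (fact r * fact s * bch_weight ps))"
    unfolding sum_bch_indices_Suc[where n="Suc n"]
  proof (rule sum.cong[OF refl], clarify, rule sum.cong[OF refl])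
    fix r s ps assume "ps \<in> bch_indices k (Suc n)"
    then have ne: "dyn_word X Y ps \<noteq> []" by (rule dyn_word_nonempty)
    then show "nbr ad (dyn_word X Y ((r, s) # ps)) /\<^sub>R bch_weight ((r, s) # ps) =
       (ad X ^^ r) ((ad Y ^^ s) (nbr ad (dyn_word X Y ps))) /\<^sub>R (fact r * fact s * bch_weight ps)"
      by (simp add: dyn_word_Cons bch_weight_Cons nbr_replicate_append)
  qed
  also have "\<dots> = (\<Sum>(r, s)\<in>{(r, s). 1 \<le> r + s \<and> r + s \<le> k}.
     (ad X ^^ r) ((ad Y ^^ s) (\<Sum>ps\<in>bch_indices k (Suc n). nbr ad (dyn_word X Y ps) /\<^sub>R bch_weight ps))
       /\<^sub>R (fact r * fact s))"
    by (simp add: linear_sum[OF linear_funpow[OF linear_ad]]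
        linear_cmul[OF linear_funpow[OF linear_ad]] scaleR_sum_right mult.commute)
  also have "\<dots> = bch_op X Y ((bch_op X Y ^^ n) (bch_vel X Y))"
    unfolding Suc
    by (rule bch_op_altdef[OF X Y F_antiD[OF funpow_bch_op_F[OF X Y bch_vel_F[OF X Y]]], symmetric]) simp
  finally show ?case by simp
qed

lemma nbr_ad_F: "set w \<subseteq> F 1 \<Longrightarrow> nbr ad w \<in> F 1"
  by (induction w rule: induct_list012) (auto intro: F_zero F_antiD[OF ad_F])

lemma bch_ad_F:
  assumes "X \<in> F 1" "Y \<in> F 1" shows "bch ad k X Y \<in> F 1"
proof -
  have "set (dyn_word X Y ps) \<subseteq> F 1" for ps
    using assms by (auto simp: dyn_word_def)
  then show ?thesis unfolding bch_altdef by (intro F_sum F_scale nbr_ad_F)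
qed

text \<open>Words are homogeneous in their letters, so along a ray the Dynkin series is a polynomial
  in t and can be differentiated term by term.\<close>

lemma bch_ad_scaled:
  fixes X Y :: 'a
  shows "bch ad k (t *\<^sub>R X) (t *\<^sub>R Y) = (\<Sum>n\<in>{1..k}. \<Sum>ps\<in>bch_indices k n.
     t ^ length (dyn_word X Y ps) *\<^sub>R (bch_coeff n ps *\<^sub>R nbr ad (dyn_word X Y ps)))"
proof -
  have "nbr ad (dyn_word (t *\<^sub>R X) (t *\<^sub>R Y) ps) = t ^ length (dyn_word X Y ps) *\<^sub>R nbr ad (dyn_word X Y ps)"
    for ps
    unfolding dyn_word_map[of "\<lambda>x. t *\<^sub>R x", symmetric]
    by (rule nbr_map_scaleR) (simp add: ad_def scaleR_diff_right mult.commute)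
  then show ?thesis by (simp add: bch_altdef length_dyn_word mult.commute)
qed

text \<open>Differentiation multiplies each word by its length and so cancels the length in the
  denominator of Dynkin's formula. What remains is a series in \<open>bch_op\<close>. The formula is
  for t times the derivative, since t is what restores the letters tX and tY.\<close>

lemma bch_ad_has_vector_derivative:
  assumes X: "X \<in> F 1" and Y: "Y \<in> F 1" and k: "k \<ge> 1"
  obtains D where "D \<in> F 1" "((\<lambda>t. bch ad k (t *\<^sub>R X) (t *\<^sub>R Y)) has_vector_derivative D) (at t)"
    "t *\<^sub>R D = (\<Sum>n\<le>k. (fps_q $ n) *\<^sub>R (bch_op (t *\<^sub>R X) (t *\<^sub>R Y) ^^ n) (bch_vel (t *\<^sub>R X) (t *\<^sub>R Y)))"
proof -
  define D where "D = (\<Sum>n\<in>{1..k}. \<Sum>ps\<in>bch_indices k n.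
     (real (length (dyn_word X Y ps)) * t ^ (length (dyn_word X Y ps) - 1)) *\<^sub>R (bch_coeff n ps *\<^sub>R nbr ad (dyn_word X Y ps)))"
  have "set (dyn_word X Y ps) \<subseteq> F 1" for ps
    using X Y by (auto simp: dyn_word_def)
  then have 1: "D \<in> F 1" unfolding D_def by (intro F_sum F_scale nbr_ad_F)
  have 2: "((\<lambda>t. bch ad k (t *\<^sub>R X) (t *\<^sub>R Y)) has_vector_derivative D) (at t)"
    unfolding bch_ad_scaled D_def
  proof (intro has_vector_derivative_sum)
    fix n ps
    let ?m = "length (dyn_word X Y ps)" and ?v = "bch_coeff n ps *\<^sub>R nbr ad (dyn_word X Y ps)"
    have "((\<lambda>t. t ^ ?m) has_real_derivative (real ?m * t ^ (?m - 1))) (at t)"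
      by (auto intro!: derivative_eq_intros)
    from has_vector_derivative_scaleR[OF this has_vector_derivative_const[of ?v]]
    show "((\<lambda>t. t ^ ?m *\<^sub>R ?v) has_vector_derivative (real ?m * t ^ (?m - 1)) *\<^sub>R ?v) (at t)"
      by simp
  qed
  have "t *\<^sub>R D = (\<Sum>n\<in>{1..k}. ((-1) ^ (n - 1) / real n) *\<^sub>R
       (\<Sum>ps\<in>bch_indices k n. nbr ad (dyn_word (t *\<^sub>R X) (t *\<^sub>R Y) ps) /\<^sub>R bch_weight ps))"
    unfolding D_def scaleR_sum_right
  proof (intro sum.cong refl)
    fix n ps assume "n \<in> {1..k}" "ps \<in> bch_indices k n"
    then have ne: "length (dyn_word X Y ps) \<noteq> 0"
      using dyn_word_nonempty[of ps k "n - 1" X Y] by auto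
    have "nbr ad (dyn_word (t *\<^sub>R X) (t *\<^sub>R Y) ps) = t ^ length (dyn_word X Y ps) *\<^sub>R nbr ad (dyn_word X Y ps)"
      unfolding dyn_word_map[of "\<lambda>x. t *\<^sub>R x", symmetric]
      by (rule nbr_map_scaleR) (simp add: ad_def scaleR_diff_right mult.commute)
    moreover have "t * t ^ (length (dyn_word X Y ps) - 1) = t ^ length (dyn_word X Y ps)"
      using ne by (metis power_minus_mult mult.commute neq0_conv)
    ultimately show "t *\<^sub>R (real (length (dyn_word X Y ps)) * t ^ (length (dyn_word X Y ps) - 1)) *\<^sub>R (bch_coeff n ps *\<^sub>R nbr ad (dyn_word X Y ps))
      = ((-1) ^ (n - 1) / real n) *\<^sub>R (nbr ad (dyn_word (t *\<^sub>R X) (t *\<^sub>R Y) ps) /\<^sub>R bch_weight ps)"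
      using ne by (simp add: bch_coeff_def length_dyn_word[symmetric, of _ X Y] field_simps)
  qed
  also have "\<dots> = (\<Sum>n<k. ((-1) ^ n / real (Suc n)) *\<^sub>R
       (\<Sum>ps\<in>bch_indices k (Suc n). nbr ad (dyn_word (t *\<^sub>R X) (t *\<^sub>R Y) ps) /\<^sub>R bch_weight ps))"
    by (rule sum.reindex_bij_witness[of _ Suc "\<lambda>n. n - 1"]) auto
  also have "\<dots> = (\<Sum>n<k. (fps_q $ n) *\<^sub>R (bch_op (t *\<^sub>R X) (t *\<^sub>R Y) ^^ n) (bch_vel (t *\<^sub>R X) (t *\<^sub>R Y)))"
    using bch_indices_sum[OF F_scale[OF X] F_scale[OF Y] k] by (simp add: fps_q_def)
  also have "\<dots> = (\<Sum>n\<le>k. (fps_q $ n) *\<^sub>R (bch_op (t *\<^sub>R X) (t *\<^sub>R Y) ^^ n) (bch_vel (t *\<^sub>R X) (t *\<^sub>R Y)))"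
    using F_nil[OF funpow_bch_op_F[OF F_scale[OF X] F_scale[OF Y] bch_vel_F[OF F_scale[OF X] F_scale[OF Y]]], of k]
    by (simp add: lessThan_Suc_atMost[symmetric])
  finally show thesis using that[OF 1 2] by blast
qed

text \<open>Both operators are conjugations, by \<open>e\<^bsup>Z\<^esup>\<close> and by \<open>e\<^bsup>X\<^esup> e\<^bsup>Y\<^esup>\<close> respectively.\<close>

lemma conj_close:
  assumes Z: "Z \<in> F 1" and X: "X \<in> F 1" and Y: "Y \<in> F 1"
    and VU: "texp Z - texp X * texp Y \<in> F m" and B: "B \<in> F j"
  shows "tead Z B - tead X (tead Y B) \<in> F (m + j)"
proof -
  define Q where "Q = tead X (tead Y B)"
  have Q: "Q \<in> F j" unfolding Q_def by (intro tead_F X Y B)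
  have QU: "Q * (texp X * texp Y) = (texp X * texp Y) * B"
  proof -
    have "Q * texp X * texp Y = texp X * (tead Y B * texp Y)"
      unfolding Q_def tead_mult_texp[OF X tead_F[OF Y B]] by (simp add: mult.assoc)
    then show ?thesis by (simp add: tead_mult_texp[OF Y B] mult.assoc)
  qed
  \<comment> \<open>Multiplication by \<open>texp Z\<close> reduces the difference of two
    conjugations to the difference of the conjugating elements; \<open>texp (- Z)\<close> undoes it
    at the end.\<close>
  have "(tead Z B - Q) * texp Z =
      (texp Z - texp X * texp Y) * B - Q * (texp Z - texp X * texp Y)"
    using QU by (simp add: tead_mult_texp[OF Z B] algebra_simps)
  also have "\<dots> \<in> F (m + j)"
    using mult_F[OF VU B] mult_F[OF Q VU] by (intro F_diff) (auto simp: add.commute)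
  finally have "(tead Z B - Q) * texp Z * texp (- Z) \<in> F (m + j)"
    by (rule F_mult_right[OF _ texp_F0[OF F_neg[OF Z]]])
  then show ?thesis by (simp add: mult.assoc texp_minus[OF Z] Q_def)
qed

text \<open>If Dynkin's velocity were formed with conjugation by e^Z in place of e^X e^Y, the
  derivative of the exponential would return exactly \<xi>. It remains to compare the two
  conjugations.\<close>

lemma fps_op_ad_phi_q:
  assumes Z: "Z \<in> F 1" and \<xi>: "\<xi> \<in> F 1"
  shows "fps_op k (ad Z) fps_phi (\<Sum>n\<le>k. (fps_q $ n) *\<^sub>R ((\<lambda>B. tead Z B - B) ^^ n) \<xi>) = \<xi>"
proof -
  have nil: "(ad Z ^^ i) \<xi> = 0" if "i > k" for i
    using funpow_ad_nil[OF Z \<xi>, of i] that by simp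
  have e: "fps_op k (ad Z) (fps_exp 1 - 1) = (\<lambda>B. tead Z B - B)"
  proof
    fix B
    have "fps_op k (ad Z) (fps_exp 1 - 1) B = fps_op k (ad Z) (fps_exp 1) B - fps_op k (ad Z) 1 B"
      unfolding fps_op_def by (simp add: sum_subtractf[symmetric] scaleR_left_diff_distrib)
    then show "fps_op k (ad Z) (fps_exp 1 - 1) B = tead Z B - B"
      by (simp add: fps_op_1 tead_def)
  qed
  have "\<xi> = fps_op k (ad Z) (fps_phi * (fps_q oo (fps_exp 1 - 1))) \<xi>"
    by (simp add: fps_phi_q fps_op_1)
  also have "\<dots> = fps_op k (ad Z) fps_phi (fps_op k (ad Z) (fps_q oo (fps_exp 1 - 1)) \<xi>)"
    by (rule fps_op_mult[OF linear_ad nil])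
  also have "fps_op k (ad Z) (fps_q oo (fps_exp 1 - 1)) \<xi> =
     (\<Sum>n\<le>k. (fps_q $ n) *\<^sub>R (fps_op k (ad Z) (fps_exp 1 - 1) ^^ n) \<xi>)"
    by (rule fps_op_compose[OF linear_ad nil]) auto
  finally show ?thesis by (simp add: e)
qed

text \<open>The apparent circularity, that the velocity of e^Z is right once e^Z is known, is
  resolved degree by degree: agreement modulo \<open>F m\<close> of the conjugating elements gives
  agreement modulo \<open>F (Suc m)\<close> of the velocities.\<close>

theorem texp_bch:
  assumes X: "X \<in> F 1" and Y: "Y \<in> F 1" and k: "k \<ge> 1"
  shows "texp (bch ad k X Y) = texp X * texp Y"
proof -
  define Z where "Z t = bch ad k (t *\<^sub>R X) (t *\<^sub>R Y)" for t
  define U where "U t = texp (t *\<^sub>R X) * texp (t *\<^sub>R Y)" for t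
  have tX: "t *\<^sub>R X \<in> F 1" and tY: "t *\<^sub>R Y \<in> F 1" for t using X Y by (auto intro: F_scale)
  have Zt: "Z t \<in> F 1" for t unfolding Z_def by (intro bch_ad_F tX tY)
  have dexp: "((\<lambda>t. texp (t *\<^sub>R A)) has_vector_derivative A * texp (t *\<^sub>R A)) (at t)" if A: "A \<in> F 1" for A t
  proof -
    have tA: "t *\<^sub>R A \<in> F 1" by (rule F_scale[OF A])
    have "ad (t *\<^sub>R A) A = 0" by (simp add: ad_def)
    then have "(ad (t *\<^sub>R A) ^^ i) A = (if i = 0 then A else 0)" for i
      by (induction i) (auto simp: linear_0[OF linear_ad])
    then have "fps_op k (ad (t *\<^sub>R A)) fps_phi A = (\<Sum>i\<le>k. if i = 0 then A else 0)"
      unfolding fps_op_def by (intro sum.cong) (auto simp: fps_phi_def)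
    then have "fps_op k (ad (t *\<^sub>R A)) fps_phi A = A" by simp
    moreover have "((\<lambda>t. t *\<^sub>R A) has_vector_derivative A) (at t)"
      using has_vector_derivative_scaleR[OF DERIV_ident has_vector_derivative_const[of A]] by simp
    ultimately show ?thesis
      using texp_has_vector_derivative[of "\<lambda>t. t *\<^sub>R A" A t, OF _ tA A] by simp
  qed
  have dU: "(U has_vector_derivative texp (t *\<^sub>R X) * (Y * texp (t *\<^sub>R Y)) + X * texp (t *\<^sub>R X) * texp (t *\<^sub>R Y)) (at t)" for t
    unfolding U_def by (rule has_vector_derivative_mult[OF dexp[OF X] dexp[OF Y]])
  have U': "t *\<^sub>R (texp (t *\<^sub>R X) * (Y * texp (t *\<^sub>R Y)) + X * texp (t *\<^sub>R X) * texp (t *\<^sub>R Y))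
      = bch_vel (t *\<^sub>R X) (t *\<^sub>R Y) * U t" for t
  proof -
    have "bch_vel (t *\<^sub>R X) (t *\<^sub>R Y) * U t = (t *\<^sub>R X) * U t + tead (t *\<^sub>R X) (t *\<^sub>R Y) * texp (t *\<^sub>R X) * texp (t *\<^sub>R Y)"
      by (simp add: bch_vel_def U_def distrib_right mult.assoc)
    also have "tead (t *\<^sub>R X) (t *\<^sub>R Y) * texp (t *\<^sub>R X) = texp (t *\<^sub>R X) * (t *\<^sub>R Y)"
      by (rule tead_mult_texp[OF tX tY])
    finally show ?thesis by (simp add: U_def scaleR_add_right mult.assoc)
  qed
  have Z0: "Z 0 = 0"
  proof -
    have "Z 0 = (\<Sum>n\<in>{1..k}. \<Sum>ps\<in>bch_indices k n. 0)"
      unfolding Z_def bch_ad_scaled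
    proof (intro sum.cong refl)
      fix n ps assume "n \<in> {1..k}" "ps \<in> bch_indices k n"
      then have "length (dyn_word X Y ps) > 0"
        using dyn_word_nonempty[of ps k "n - 1" X Y] by auto
      then show "0 ^ length (dyn_word X Y ps) *\<^sub>R (bch_coeff n ps *\<^sub>R nbr ad (dyn_word X Y ps)) = 0"
        by (simp add: zero_power)
    qed
    then show ?thesis by simp
  qed
  have "\<forall>t. texp (Z t) - U t \<in> F m" for m
  proof (induction m)
    case 0 then show ?case by (auto simp: U_def intro!: F_diff F_mult_right texp_F0 Zt tX tY)
  next
    case (Suc m)
    note outer = Suc
    \<comment> \<open>Only t times the derivative is known, so nothing is claimed about its degree
      at t = 0.\<close>
    have step: "\<exists>D. ((\<lambda>t. texp (Z t) - U t) has_vector_derivative D) (at t) \<and> (t \<noteq> 0 \<longrightarrow> D \<in> F (Suc m))" for t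
    proof -
      define M where "M = bch_op (t *\<^sub>R X) (t *\<^sub>R Y)"
      define N where "N = (\<lambda>B. tead (Z t) B - B)"
      define \<xi> where "\<xi> = bch_vel (t *\<^sub>R X) (t *\<^sub>R Y)"
      have \<xi>: "\<xi> \<in> F 1" unfolding \<xi>_def by (intro bch_vel_F tX tY)
      obtain D where D: "D \<in> F 1" "(Z has_vector_derivative D) (at t)"
        "t *\<^sub>R D = (\<Sum>n\<le>k. (fps_q $ n) *\<^sub>R (M ^^ n) \<xi>)"
        using bch_ad_has_vector_derivative[OF X Y k, of t] unfolding Z_def[symmetric] M_def \<xi>_def by metis
      \<comment> \<open>The conjugations differ by m degrees and act on elements of
        \<open>F 1\<close>, which is where the gain of one degree comes from.\<close>
      have NM: "(N ^^ n) \<xi> - (M ^^ n) \<xi> \<in> F (Suc m)" for n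
      proof (induction n)
        case 0 then show ?case by (simp add: F_zero)
      next
        case (Suc n)
        have "linear N" unfolding N_def using linear_tead linear_ident by (intro linear_compose_sub)
        then have "(N ^^ Suc n) \<xi> - (M ^^ Suc n) \<xi> =
           N ((N ^^ n) \<xi> - (M ^^ n) \<xi>) + (N ((M ^^ n) \<xi>) - M ((M ^^ n) \<xi>))"
          by (simp add: linear_diff)
        moreover have "N ((N ^^ n) \<xi> - (M ^^ n) \<xi>) \<in> F (Suc m)"
          unfolding N_def by (rule F_diff[OF tead_F[OF Zt Suc.IH] Suc.IH, unfolded N_def])
        moreover have "N ((M ^^ n) \<xi>) - M ((M ^^ n) \<xi>) \<in> F (Suc m)"
        proof -
          have "(M ^^ n) \<xi> \<in> F 1" unfolding M_def
            by (rule F_antiD[OF funpow_bch_op_F[OF tX tY \<xi>]]) simp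
          from conj_close[of "Z t" "t *\<^sub>R X" "t *\<^sub>R Y" m "(M ^^ n) \<xi>" 1] Zt tX tY this outer
          show ?thesis by (simp add: N_def M_def bch_op_def U_def)
        qed
        ultimately show ?case by (simp only: F_add)
      qed
      define W where "W = fps_op k (ad (Z t)) fps_phi D"
      have lin: "linear (fps_op k (ad (Z t)) fps_phi)" by (intro linear_fps_op linear_ad)
      have "t *\<^sub>R W - \<xi> = fps_op k (ad (Z t)) fps_phi (t *\<^sub>R D - (\<Sum>n\<le>k. (fps_q $ n) *\<^sub>R (N ^^ n) \<xi>))"
        using fps_op_ad_phi_q[OF Zt \<xi>, of t] by (simp add: linear_diff[OF lin] W_def linear_cmul[OF lin] N_def)
      also have "\<dots> = fps_op k (ad (Z t)) fps_phi (- (\<Sum>n\<le>k. (fps_q $ n) *\<^sub>R ((N ^^ n) \<xi> - (M ^^ n) \<xi>)))"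
        by (simp add: D(3) sum_subtractf scaleR_diff_right)
      also have "\<dots> \<in> F (Suc m)"
        by (intro fps_op_ad_F Zt F_neg F_sum F_scale NM)
      finally have W: "t *\<^sub>R W - \<xi> \<in> F (Suc m)" .
      define E where "E = W * texp (Z t) - (texp (t *\<^sub>R X) * (Y * texp (t *\<^sub>R Y)) + X * texp (t *\<^sub>R X) * texp (t *\<^sub>R Y))"
      have "((\<lambda>t. texp (Z t) - U t) has_vector_derivative E) (at t)"
        unfolding E_def W_def
        by (intro has_vector_derivative_diff dU texp_has_vector_derivative D Zt)
      moreover have "E \<in> F (Suc m)" if "t \<noteq> 0"
      proof -
        have "t *\<^sub>R E = t *\<^sub>R W * texp (Z t) - \<xi> * U t"
          unfolding E_def \<xi>_def U'[symmetric] by (simp add: scaleR_diff_right)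
        also have "\<dots> = (t *\<^sub>R W - \<xi>) * texp (Z t) + \<xi> * (texp (Z t) - U t)"
          by (simp add: algebra_simps)
        also have "\<dots> \<in> F (Suc m)"
          using mult_F[OF \<xi>, of "texp (Z t) - U t" m] outer
          by (intro F_add F_mult_right[OF W] texp_F0 Zt) auto
        finally have "(1 / t) *\<^sub>R t *\<^sub>R E \<in> F (Suc m)" by (rule F_scale)
        then show ?thesis using that by simp
      qed
      ultimately show ?thesis by blast
    qed
    show ?case
    proof
      fix t :: real
      \<comment> \<open>After rescaling to the unit interval the derivative is examined only at
        interior times, which excludes the uncontrolled time 0.\<close>
      define c where "c s = texp (Z (s * t)) - U (s * t)" for s
      have "c 1 \<in> F (Suc m)"
      proof (cases "t = 0")
        case True then show ?thesis by (simp add: c_def Z0 U_def F_zero)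
      next
        case False
        have dc: "\<exists>D. (c has_vector_derivative D) (at s) \<and> (s \<noteq> 0 \<longrightarrow> D \<in> F (Suc m))" for s
        proof -
          obtain D where D: "((\<lambda>t. texp (Z t) - U t) has_vector_derivative D) (at (s * t))"
             "s * t \<noteq> 0 \<longrightarrow> D \<in> F (Suc m)" using step by blast
          have "((\<lambda>s. s * t) has_vector_derivative t) (at s)"
            by (auto intro!: derivative_eq_intros simp flip: has_real_derivative_iff_has_vector_derivative)
          from vector_diff_chain_at[OF this D(1)]
          have "(c has_vector_derivative t *\<^sub>R D) (at s)" by (simp add: c_def[abs_def] o_def)
          with D(2) False show ?thesis by (auto intro: F_scale)
        qed
        show ?thesis
        proof (rule vector_derivative_in_closed_subspace[OF subspace_F closed_F])
          show "\<exists>D\<in>F (Suc m). (c has_vector_derivative D) (at t)" if "0 < t" for t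
            using dc[of t] that by auto
          show "continuous_on {0..1} c"
            using dc by (meson continuous_at_imp_continuous_on has_vector_derivative_continuous)
          show "c 0 \<in> F (Suc m)" by (simp add: c_def Z0 U_def F_zero)
        qed
      qed
      then show "texp (Z t) - U t \<in> F (Suc m)" by (simp add: c_def)
    qed
  qed
  then have "texp (Z 1) - U 1 \<in> F (Suc k)" by blast
  then show ?thesis by (simp add: F_top Z_def U_def)
qed

end

subsection \<open>Finite-dimensional normed spaces\<close>

text \<open>The spaces are arbitrary normed spaces with a finite spanning set. Their compact sets
  are obtained from these boxes, which need no independence of \<open>B\<close>.\<close>

lemma compact_coefficient_box:
  fixes B :: "'a::real_normed_vector set"
  assumes "finite B"
  shows "compact {\<Sum>b\<in>B. c b *\<^sub>R b | c. \<forall>b\<in>B. \<bar>c b\<bar> \<le> R}"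
  using assms
proof (induction B rule: finite_induct)
  case empty then show ?case by simp
next
  case (insert b B)
  let ?K = "{\<Sum>b\<in>B. c b *\<^sub>R b | c. \<forall>b\<in>B. \<bar>c b\<bar> \<le> R}"
  have "{\<Sum>b\<in>insert b B. c b *\<^sub>R b | c. \<forall>b\<in>insert b B. \<bar>c b\<bar> \<le> R}
      = (\<lambda>(t, y). t *\<^sub>R b + y) ` ({-R..R} \<times> ?K)" (is "?L = ?R")
  proof (rule set_eqI iffI)+
    fix x assume "x \<in> ?L"
    then show "x \<in> ?R" using insert by (force simp: abs_le_iff)
  next
    fix x assume "x \<in> ?R"
    then obtain t c where x: "x = t *\<^sub>R b + (\<Sum>b\<in>B. c b *\<^sub>R b)" "\<bar>t\<bar> \<le> R" "\<forall>b\<in>B. \<bar>c b\<bar> \<le> R" by force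
    have "(\<Sum>b\<in>B. c b *\<^sub>R b) = (\<Sum>b'\<in>B. (c(b := t)) b' *\<^sub>R b')"
      using insert by (intro sum.cong) auto
    then have "x = (\<Sum>b'\<in>insert b B. (c(b := t)) b' *\<^sub>R b')" using x insert by simp
    moreover have "\<forall>b'\<in>insert b B. \<bar>(c(b := t)) b'\<bar> \<le> R" using x by auto
    ultimately show "x \<in> ?L" by blast
  qed
  also have "compact \<dots>"
    by (intro compact_continuous_image compact_Times insert.IH compact_Icc)
       (auto simp: case_prod_beta' intro!: continuous_intros)
  finally show ?case .
qed

text \<open>Combinations whose largest coefficient has modulus one form the compact set
  \<open>S\<close>. By independence it misses 0, and \<delta> is a lower bound for the norm on
  it.\<close>

lemma independent_coordinates_bounded:
  fixes B :: "'a::real_normed_vector set"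
  assumes fin: "finite B" and ind: "independent B"
  obtains \<delta> where "\<delta> > 0" "\<forall>c. \<forall>b\<in>B. \<delta> * \<bar>c b\<bar> \<le> norm (\<Sum>b\<in>B. c b *\<^sub>R b)"
proof -
  define S where "S = (\<Union>b\<in>B. \<Union>\<sigma>\<in>{1, -1}. (\<lambda>y. \<sigma> *\<^sub>R b + y) ` {\<Sum>b\<in>B - {b}. c b *\<^sub>R b | c. \<forall>b\<in>B - {b}. \<bar>c b\<bar> \<le> (1::real)})"
  have Scompact: "compact S"
    unfolding S_def
    by (intro compact_UN compact_continuous_image compact_coefficient_box fin continuous_intros finite_Diff) auto
  have in_S: "(\<Sum>b\<in>B. c b *\<^sub>R b) \<in> S" if b: "b \<in> B" "\<bar>c b\<bar> = 1" and c: "\<forall>b\<in>B. \<bar>c b\<bar> \<le> 1" for c b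
  proof -
    have "(\<Sum>b\<in>B. c b *\<^sub>R b) = c b *\<^sub>R b + (\<Sum>b\<in>B - {b}. c b *\<^sub>R b)"
      by (rule sum.remove[OF fin b(1)])
    moreover have "c b \<in> {1, -1}" using b(2) by auto
    moreover have "c b *\<^sub>R b + (\<Sum>b\<in>B - {b}. c b *\<^sub>R b) \<in>
      (\<lambda>y. c b *\<^sub>R b + y) ` {\<Sum>b\<in>B - {b}. c b *\<^sub>R b | c. \<forall>b\<in>B - {b}. \<bar>c b\<bar> \<le> (1::real)}"
      using c by (intro imageI) auto
    ultimately show ?thesis unfolding S_def using b(1) by (intro UN_I[of b] UN_I[of "c b"]) auto
  qed
  have "0 \<notin> S"
  proof
    assume "0 \<in> S"
    then obtain b \<sigma> where h: "b \<in> B" "\<sigma> \<in> {1, -1::real}" and "0 \<in> (\<lambda>y. \<sigma> *\<^sub>R b + y) `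
        {\<Sum>b\<in>B - {b}. c b *\<^sub>R b | c. \<forall>b\<in>B - {b}. \<bar>c b\<bar> \<le> (1::real)}"
      unfolding S_def by (elim UN_E)
    then obtain c where c: "0 = \<sigma> *\<^sub>R b + (\<Sum>b\<in>B - {b}. c b *\<^sub>R b)" by blast
    have "(\<Sum>b'\<in>B. (c(b := \<sigma>)) b' *\<^sub>R b') = \<sigma> *\<^sub>R b + (\<Sum>b'\<in>B - {b}. (c(b := \<sigma>)) b' *\<^sub>R b')"
      by (subst sum.remove[OF fin h(1)]) simp
    also have "(\<Sum>b'\<in>B - {b}. (c(b := \<sigma>)) b' *\<^sub>R b') = (\<Sum>b\<in>B - {b}. c b *\<^sub>R b)"
      by (intro sum.cong) auto
    finally have "(\<Sum>b'\<in>B. (c(b := \<sigma>)) b' *\<^sub>R b') = 0" using c by simp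
    then have "(c(b := \<sigma>)) b = 0" by (rule independentD[OF ind fin subset_refl _ h(1)])
    then show False using h(2) by auto
  qed
  obtain \<delta> where \<delta>: "\<delta> > 0" "\<And>x. x \<in> S \<Longrightarrow> \<delta> \<le> norm x"
  proof (cases "S = {}")
    case True then show ?thesis using that[of 1] by auto
  next
    case False
    then obtain x0 where "x0 \<in> S" "\<forall>x\<in>S. norm x0 \<le> norm x"
      using continuous_attains_inf[OF Scompact False, of norm] by (auto intro: continuous_intros)
    moreover have "norm x0 > 0" using \<open>0 \<notin> S\<close> \<open>x0 \<in> S\<close> by (metis zero_less_norm_iff)
    ultimately show ?thesis using that by blast
  qed
  show thesis
  proof (rule that[OF \<delta>(1)])
    show "\<forall>c. \<forall>b\<in>B. \<delta> * \<bar>c b\<bar> \<le> norm (\<Sum>b\<in>B. c b *\<^sub>R b)"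
    proof (intro allI ballI)
      fix c :: "'a \<Rightarrow> real" and b assume b: "b \<in> B"
      define M where "M = Max ((\<lambda>b. \<bar>c b\<bar>) ` B)"
      have M: "\<bar>c b\<bar> \<le> M" if "b \<in> B" for b unfolding M_def using fin that by auto
      have "M \<in> (\<lambda>b. \<bar>c b\<bar>) ` B" unfolding M_def using fin b by (intro Max_in) auto
      then obtain b0 where b0: "b0 \<in> B" "\<bar>c b0\<bar> = M" by auto
      show "\<delta> * \<bar>c b\<bar> \<le> norm (\<Sum>b\<in>B. c b *\<^sub>R b)"
      proof (cases "M = 0")
        case True then show ?thesis using M[OF b] by simp
      next
        case False
        then have Mp: "M > 0" using M[OF b] by linarith
        have "(\<Sum>b\<in>B. (c b / M) *\<^sub>R b) \<in> S"
          using b0 M Mp by (intro in_S[of b0]) (auto simp: abs_divide)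
        from \<delta>(2)[OF this] have "\<delta> \<le> norm ((1 / M) *\<^sub>R (\<Sum>b\<in>B. c b *\<^sub>R b))"
          by (simp add: scaleR_sum_right)
        then have "\<delta> * M \<le> norm (\<Sum>b\<in>B. c b *\<^sub>R b)" using Mp by (simp add: field_simps)
        moreover have "\<delta> * \<bar>c b\<bar> \<le> \<delta> * M" using M[OF b] \<delta>(1) by simp
        ultimately show ?thesis by linarith
      qed
    qed
  qed
qed

text \<open>The coefficients come from a basis contained in \<open>S\<close> and are zero elsewhere.
  The redundant form is convenient for the iterated brackets below, which are not independent in
  general.\<close>

lemma span_coefficients_bounded:
  fixes S :: "'a::real_normed_vector set"
  assumes S: "finite S"
  obtains K where "K > 0"
    "\<And>x. x \<in> span S \<Longrightarrow> \<exists>c. x = (\<Sum>b\<in>S. c b *\<^sub>R b) \<and> (\<forall>b\<in>S. \<bar>c b\<bar> \<le> K * norm x)"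
proof -
  obtain B where B: "B \<subseteq> S" "independent B" "span B = span S"
    using maximal_independent_subset[of S] by (metis span_eq subset_trans span_superset)
  have fB: "finite B" using B(1) S finite_subset by blast
  obtain \<delta> where \<delta>: "\<delta> > 0" "\<forall>c. \<forall>b\<in>B. \<delta> * \<bar>c b\<bar> \<le> norm (\<Sum>b\<in>B. c b *\<^sub>R b)"
    by (rule independent_coordinates_bounded[OF fB B(2)])
  show thesis
  proof (rule that[of "1 / \<delta>"])
    fix x assume "x \<in> span S"
    then have "x \<in> range (\<lambda>c. \<Sum>b\<in>B. c b *\<^sub>R b)" using B(3) span_finite[OF fB] by blast
    then obtain c where c: "x = (\<Sum>b\<in>B. c b *\<^sub>R b)" by blast
    let ?c = "\<lambda>b. if b \<in> B then c b else 0"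
    have "(\<Sum>b\<in>S. ?c b *\<^sub>R b) = (\<Sum>b\<in>B. ?c b *\<^sub>R b)"
      by (rule sum.mono_neutral_right[OF S B(1)]) simp
    then have "x = (\<Sum>b\<in>S. ?c b *\<^sub>R b)" using c by simp
    moreover have "\<bar>?c b\<bar> \<le> 1 / \<delta> * norm x" for b
      using \<delta>(1) \<delta>(2)[rule_format, of b c] by (simp add: c field_simps)
    ultimately show "\<exists>c. x = (\<Sum>b\<in>S. c b *\<^sub>R b) \<and> (\<forall>b\<in>S. \<bar>c b\<bar> \<le> 1 / \<delta> * norm x)"
      by (intro exI[of _ ?c] conjI ballI)
  qed (use \<delta> in simp)
qed

lemma fin_dim_linear_bounded:
  fixes f :: "'a::real_normed_vector \<Rightarrow> 'b::real_normed_vector"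
  assumes fd: "fin_dim_space TYPE('a)" and f: "linear f"
  shows "bounded_linear f"
proof -
  obtain B :: "'a set" where B: "finite B" "span B = UNIV" using fd by (auto simp: fin_dim_space_def)
  obtain K where K: "K > 0" "\<And>x. x \<in> span B \<Longrightarrow> \<exists>c. x = (\<Sum>b\<in>B. c b *\<^sub>R b) \<and> (\<forall>b\<in>B. \<bar>c b\<bar> \<le> K * norm x)"
    using B(1) by (rule span_coefficients_bounded) blast
  have "norm (f x) \<le> norm x * (K * (\<Sum>b\<in>B. norm (f b)))" for x
  proof -
    obtain c where c: "x = (\<Sum>b\<in>B. c b *\<^sub>R b)" "\<And>b. b \<in> B \<Longrightarrow> \<bar>c b\<bar> \<le> K * norm x"
      using K(2)[of x] B(2) by auto
    have "norm (f x) \<le> (\<Sum>b\<in>B. norm (c b *\<^sub>R f b))"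
      by (subst c(1)) (simp add: linear_sum[OF f] linear_cmul[OF f] norm_sum del: norm_scaleR)
    also have "\<dots> \<le> (\<Sum>b\<in>B. (K * norm x) * norm (f b))"
      unfolding norm_scaleR using c(2) by (intro sum_mono mult_right_mono) auto
    finally show ?thesis by (simp add: sum_distrib_left mult_ac)
  qed
  then show ?thesis
    by (intro bounded_linear_intro[where K="K * (\<Sum>b\<in>B. norm (f b))"])
       (simp_all add: linear_add[OF f] linear_cmul[OF f])
qed

lemma fin_dim_compact:
  fixes S :: "'a::real_normed_vector set"
  assumes fd: "fin_dim_space TYPE('a)" and S: "closed S" "bounded S"
  shows "compact S"
proof -
  obtain B :: "'a set" where B: "finite B" "span B = UNIV" using fd by (auto simp: fin_dim_space_def)
  obtain K where K: "K > 0" "\<And>x. x \<in> span B \<Longrightarrow> \<exists>c. x = (\<Sum>b\<in>B. c b *\<^sub>R b) \<and> (\<forall>b\<in>B. \<bar>c b\<bar> \<le> K * norm x)"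
    using B(1) by (rule span_coefficients_bounded) blast
  obtain R where R: "\<And>x. x \<in> S \<Longrightarrow> norm x \<le> R" using S(2) by (auto simp: bounded_iff)
  have "S \<subseteq> {\<Sum>b\<in>B. c b *\<^sub>R b | c. \<forall>b\<in>B. \<bar>c b\<bar> \<le> K * R}"
  proof
    fix x assume "x \<in> S"
    then have *: "K * norm x \<le> K * R" using R K(1) by simp
    obtain c where "x = (\<Sum>b\<in>B. c b *\<^sub>R b)" "\<forall>b\<in>B. \<bar>c b\<bar> \<le> K * norm x"
      using K(2)[of x] B(2) by auto
    with * show "x \<in> {\<Sum>b\<in>B. c b *\<^sub>R b | c. \<forall>b\<in>B. \<bar>c b\<bar> \<le> K * R}"
      by (intro CollectI exI[of _ c]) (auto intro: order_trans)
  qed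
  then show ?thesis
    using compact_Int_closed[OF compact_coefficient_box[OF B(1), of "K * R"] S(1)]
    by (simp add: Int_absorb1)
qed

text \<open>The curried map is linear into the normed space of bounded linear maps, so the linear
  case applies twice.\<close>

lemma fin_dim_bilinear_bounded:
  fixes h :: "'a::real_normed_vector \<Rightarrow> 'a \<Rightarrow> 'b::real_normed_vector"
  assumes fd: "fin_dim_space TYPE('a)" and h: "bilinear h"
  shows "bounded_bilinear h"
proof -
  have lin: "linear (h x)" "linear (\<lambda>x. h x y)" for x y using h by (auto simp: bilinear_def)
  have app: "blinfun_apply (Blinfun (h x)) = h x" for x
    by (intro bounded_linear_Blinfun_apply fin_dim_linear_bounded[OF fd] lin)
  have "linear (\<lambda>x. Blinfun (h x))"
    by (rule linearI; rule blinfun_eqI)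
       (simp_all add: app blinfun.bilinear_simps linear_add[OF lin(2)] linear_cmul[OF lin(2)])
  then have "bounded_linear (\<lambda>x. Blinfun (h x))" by (rule fin_dim_linear_bounded[OF fd])
  from bounded_bilinear.comp1[OF bounded_bilinear_blinfun_apply this] show ?thesis by (simp add: app)
qed

subsection \<open>Bounded endomorphisms\<close>

text \<open>A type of its own makes the endomorphisms an instance of \<open>real_normed_algebra\<close>; the factor
  \<open>real\<close> ensures \<open>0 \<noteq> 1\<close> even if \<open>'a\<close> is trivial.\<close>

typedef (overloaded) ('a::real_normed_vector) endo = "UNIV :: (('a \<times> real) \<Rightarrow>\<^sub>L ('a \<times> real)) set"
  by simp

setup_lifting type_definition_endo

instantiation endo :: (real_normed_vector) "{real_normed_algebra,real_algebra_1}"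
begin

lift_definition zero_endo :: "'a endo" is 0 .
lift_definition one_endo :: "'a endo" is "id_blinfun :: ('a \<times> real) \<Rightarrow>\<^sub>L ('a \<times> real)" .
lift_definition plus_endo :: "'a endo \<Rightarrow> 'a endo \<Rightarrow> 'a endo" is "(+)" .
lift_definition minus_endo :: "'a endo \<Rightarrow> 'a endo \<Rightarrow> 'a endo" is "(-)" .
lift_definition uminus_endo :: "'a endo \<Rightarrow> 'a endo" is uminus .
lift_definition times_endo :: "'a endo \<Rightarrow> 'a endo \<Rightarrow> 'a endo" is "(o\<^sub>L) :: (('a \<times> real) \<Rightarrow>\<^sub>L ('a \<times> real)) \<Rightarrow> _ \<Rightarrow> (('a \<times> real) \<Rightarrow>\<^sub>L ('a \<times> real))" .
lift_definition scaleR_endo :: "real \<Rightarrow> 'a endo \<Rightarrow> 'a endo" is scaleR .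
lift_definition norm_endo :: "'a endo \<Rightarrow> real" is norm .
lift_definition dist_endo :: "'a endo \<Rightarrow> 'a endo \<Rightarrow> real" is dist .
lift_definition sgn_endo :: "'a endo \<Rightarrow> 'a endo" is sgn .

definition uniformity_endo :: "('a endo \<times> 'a endo) filter" where
  "uniformity_endo = (INF e\<in>{0<..}. principal {(x, y). dist x y < e})"
definition open_endo :: "'a endo set \<Rightarrow> bool" where
  "open_endo U \<longleftrightarrow> (\<forall>x\<in>U. eventually (\<lambda>(x', y). x' = x \<longrightarrow> y \<in> U) uniformity)"

instance
proof
  fix a b c :: "'a endo" and r s :: real and U :: "'a endo set"
  show "a + b + c = a + (b + c)" by transfer (rule add.assoc)
  show "a + b = b + a" by transfer (rule add.commute)
  show "0 + a = a" by transfer simp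
  show "- a + a = 0" by transfer simp
  show "a - b = a + - b" by transfer simp
  show "r *\<^sub>R (a + b) = r *\<^sub>R a + r *\<^sub>R b" by transfer (rule scaleR_add_right)
  show "(r + s) *\<^sub>R a = r *\<^sub>R a + s *\<^sub>R a" by transfer (rule scaleR_add_left)
  show "r *\<^sub>R s *\<^sub>R a = (r * s) *\<^sub>R a" by transfer simp
  show "1 *\<^sub>R a = a" by transfer simp
  show "a * b * c = a * (b * c)" by transfer (auto intro!: blinfun_eqI)
  show "(a + b) * c = a * c + b * c" by transfer (auto intro!: blinfun_eqI simp: blinfun.bilinear_simps)
  show "a * (b + c) = a * b + a * c" by transfer (auto intro!: blinfun_eqI simp: blinfun.bilinear_simps)
  show "r *\<^sub>R a * b = r *\<^sub>R (a * b)" by transfer (auto intro!: blinfun_eqI simp: blinfun.bilinear_simps)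
  show "a * r *\<^sub>R b = r *\<^sub>R (a * b)" by transfer (auto intro!: blinfun_eqI simp: blinfun.bilinear_simps)
  show "1 * a = a" by transfer (auto intro!: blinfun_eqI)
  show "a * 1 = a" by transfer (auto intro!: blinfun_eqI)
  show "(0::'a endo) \<noteq> 1"
  proof transfer
    have "blinfun_apply 0 (0, 1) \<noteq> blinfun_apply id_blinfun ((0, 1) :: 'a \<times> real)" by (simp add: zero_prod_def)
    then show "(0 :: ('a \<times> real) \<Rightarrow>\<^sub>L ('a \<times> real)) \<noteq> id_blinfun" by metis
  qed
  show "dist a b = norm (a - b)" by transfer (rule dist_norm)
  show "sgn a = inverse (norm a) *\<^sub>R a" by transfer (rule sgn_div_norm)
  show "norm a = 0 \<longleftrightarrow> a = 0" by transfer simp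
  show "norm (a + b) \<le> norm a + norm b" by transfer (rule norm_triangle_ineq)
  show "norm (r *\<^sub>R a) = \<bar>r\<bar> * norm a" by transfer simp
  show "norm (a * b) \<le> norm a * norm b" by transfer (rule norm_blinfun_compose)
  show "(uniformity :: ('a endo \<times> 'a endo) filter) = (INF e\<in>{0<..}. principal {(x, y). dist x y < e})"
    by (rule uniformity_endo_def)
  show "open U \<longleftrightarrow> (\<forall>x\<in>U. eventually (\<lambda>(x', y). x' = x \<longrightarrow> y \<in> U) uniformity)"
    by (rule open_endo_def)
qed

end

lift_definition endo_apply :: "'a::real_normed_vector endo \<Rightarrow> 'a \<times> real \<Rightarrow> 'a \<times> real" is blinfun_apply .
lift_definition Endo :: "('a::real_normed_vector \<times> real \<Rightarrow> 'a \<times> real) \<Rightarrow> 'a endo" is Blinfun .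

lemma endo_apply_simps [simp]:
  "endo_apply 0 w = 0" "endo_apply 1 w = w" "endo_apply (a + b) w = endo_apply a w + endo_apply b w"
  "endo_apply (a - b) w = endo_apply a w - endo_apply b w" "endo_apply (- a) w = - endo_apply a w"
  "endo_apply (a * b) w = endo_apply a (endo_apply b w)" "endo_apply (r *\<^sub>R a) w = r *\<^sub>R endo_apply a w"
  by (transfer; simp add: blinfun.bilinear_simps)+

lemma endo_apply_Endo: "bounded_linear f \<Longrightarrow> endo_apply (Endo f) = f"
  by transfer (rule bounded_linear_Blinfun_apply)

lemma endo_eqI: "(\<And>w. endo_apply a w = endo_apply b w) \<Longrightarrow> a = b"
  by transfer (rule blinfun_eqI)

lemma norm_endo_apply: "norm (endo_apply a w) \<le> norm a * norm w"
  by transfer (rule norm_blinfun)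

lemma bounded_linear_endo_apply_left: "bounded_linear (\<lambda>a. endo_apply a w)"
  by (rule bounded_linear_intro[where K="norm w"]) (auto simp: norm_endo_apply)

subsection \<open>Graded Lie algebras and the group law\<close>

locale graded_algebra =
  fixes br :: "'a::real_normed_vector \<Rightarrow> 'a \<Rightarrow> 'a" and V :: "nat \<Rightarrow> 'a set" and k :: nat
  assumes graded: "graded_alg br V k"
begin

abbreviation "cmp \<equiv> comp V k"
abbreviation "dl \<equiv> dil V k"
abbreviation gmul (infixl "\<odot>" 70) where "x \<odot> y \<equiv> bch br k x y"

lemma fd: "fin_dim_space TYPE('a)" and k1: "1 \<le> k"
  and subspace_V: "i \<in> {1..k} \<Longrightarrow> subspace (V i)"
  and br_layer: "i \<in> {1..k} \<Longrightarrow> j \<in> {1..k} \<Longrightarrow> x \<in> V i \<Longrightarrow> y \<in> V j \<Longrightarrow> br x y \<in> layer V k (i + j)"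
  and bilinear_br: "bilinear br" and br_self: "br x x = 0"
  and jacobi: "br x (br y z) + br y (br z x) + br z (br x y) = 0"
  using graded by (auto simp: graded_alg_def lie_algebra_def)

lemmas bounded_linear_fd = fin_dim_linear_bounded[OF fd]

lemma bounded_bilinear_br: "bounded_bilinear br"
  by (rule fin_dim_bilinear_bounded[OF fd bilinear_br])

lemmas br_simps = bounded_bilinear.add_left[OF bounded_bilinear_br] bounded_bilinear.add_right[OF bounded_bilinear_br]
  bounded_bilinear.diff_left[OF bounded_bilinear_br] bounded_bilinear.diff_right[OF bounded_bilinear_br]
  bounded_bilinear.minus_left[OF bounded_bilinear_br] bounded_bilinear.minus_right[OF bounded_bilinear_br]
  bounded_bilinear.scaleR_left[OF bounded_bilinear_br] bounded_bilinear.scaleR_right[OF bounded_bilinear_br]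
  bounded_bilinear.zero_left[OF bounded_bilinear_br] bounded_bilinear.zero_right[OF bounded_bilinear_br]

lemmas br_sums = bounded_bilinear.sum_left[OF bounded_bilinear_br] bounded_bilinear.sum_right[OF bounded_bilinear_br]

lemma br_anti: "br y x = - br x y"
proof -
  have "br x x + br x y + (br y x + br y y) = 0"
    using br_self[of "x + y"] by (simp add: br_simps add_ac)
  then have "br x y + br y x = 0" by (simp add: br_self)
  then show ?thesis by (simp add: eq_neg_iff_add_eq_0 add.commute)
qed

lemma br_br: "br (br x y) v = br x (br y v) - br y (br x v)"
  using jacobi[of x y v] br_anti[of v "br x y"] br_anti[of v x]
  by (simp add: br_simps algebra_simps)

definition decomp :: "'a \<Rightarrow> (nat \<Rightarrow> 'a) \<Rightarrow> bool" where
  "decomp x c \<longleftrightarrow> (\<forall>i\<in>{1..k}. c i \<in> V i) \<and> (\<forall>i. i \<notin> {1..k} \<longrightarrow> c i = 0) \<and> x = (\<Sum>i\<in>{1..k}. c i)"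

lemma decomp_comp: "decomp x (\<lambda>i. cmp i x)" and decomp_unique: "decomp x c \<Longrightarrow> cmp i x = c i"
proof -
  have "\<forall>x. \<exists>!c. decomp x c" using graded unfolding graded_alg_def decomp_def by blast
  then have ex: "\<exists>!c. decomp x c" ..
  have 1: "cmp i x = (THE c. decomp x c) i" for i by (simp add: comp_def decomp_def)
  show "decomp x (\<lambda>i. cmp i x)" unfolding 1 using theI'[OF ex] by simp
  show "decomp x c \<Longrightarrow> cmp i x = c i" unfolding 1 using the1_equality[OF ex, of c] by simp
qed

lemma comp_in: "i \<in> {1..k} \<Longrightarrow> cmp i x \<in> V i" and comp_out: "i \<notin> {1..k} \<Longrightarrow> cmp i x = 0"
  and sum_comp: "(\<Sum>i\<in>{1..k}. cmp i x) = x"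
  using decomp_comp[of x] unfolding decomp_def by (blast, blast, metis)

lemma sum_comp' [simp]: "(\<Sum>i=Suc 0..k. cmp i x) = x"
  using sum_comp by simp

lemma linear_comp: "linear (cmp i)"
proof (rule linearI)
  fix x y and c :: real
  have "x + y = (\<Sum>i\<in>{1..k}. cmp i x + cmp i y)"
    by (simp add: sum.distrib sum_comp)
  then have "decomp (x + y) (\<lambda>i. cmp i x + cmp i y)"
    unfolding decomp_def by (intro conjI ballI allI impI subspace_add[OF subspace_V] comp_in) (auto simp: comp_out)
  then show "cmp i (x + y) = cmp i x + cmp i y" by (rule decomp_unique)
  have "c *\<^sub>R x = (\<Sum>i\<in>{1..k}. c *\<^sub>R cmp i x)"
    by (simp add: sum_comp flip: scaleR_sum_right)
  then have "decomp (c *\<^sub>R x) (\<lambda>i. c *\<^sub>R cmp i x)"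
    unfolding decomp_def by (intro conjI ballI allI impI subspace_scale[OF subspace_V] comp_in) (auto simp: comp_out)
  then show "cmp i (c *\<^sub>R x) = c *\<^sub>R cmp i x" by (rule decomp_unique)
qed

lemmas bounded_linear_comp = bounded_linear_fd[OF linear_comp]
lemmas comp_simps = linear_add[OF linear_comp] linear_diff[OF linear_comp] linear_cmul[OF linear_comp]
  linear_neg[OF linear_comp] linear_0[OF linear_comp]

lemma continuous_on_comp [continuous_intros]:
  "continuous_on S f \<Longrightarrow> continuous_on S (\<lambda>x. cmp i (f x))"
  by (rule bounded_linear.continuous_on[OF bounded_linear_comp])

lemma comp_layer:
  assumes "v \<in> layer V k m" shows "cmp i v = (if i = m then v else 0)"
proof (cases "m \<in> {1..k}")
  case True
  have "(\<Sum>i\<in>{1..k}. if i = m then v else 0) = v" using True by simp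
  then have "decomp v (\<lambda>i. if i = m then v else 0)"
    unfolding decomp_def using True assms by (auto simp: layer_def subspace_0[OF subspace_V])
  then show ?thesis by (rule decomp_unique)
next
  case False
  then show ?thesis using assms by (simp add: layer_def comp_simps split: if_splits)
qed

lemma comp_in_layer: "cmp i x \<in> layer V k i"
  by (auto simp: layer_def intro: comp_in comp_out)

lemma comp_eqI: "(\<And>i. i \<in> {1..k} \<Longrightarrow> cmp i x = cmp i y) \<Longrightarrow> x = y"
  by (metis (mono_tags, lifting) sum.cong sum_comp)

lemma layer_iff: "v \<in> layer V k m \<longleftrightarrow> cmp m v = v"
proof
  show "cmp m v = v" if "v \<in> layer V k m" using comp_layer[OF that, of m] by simp
  show "v \<in> layer V k m" if "cmp m v = v" using comp_in_layer[of m v] that by simp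
qed

text \<open>Dilations, the degree derivation and the identity are all of this form, so their
  compatibility with brackets is one computation.\<close>

definition multiplier :: "(nat \<Rightarrow> real) \<Rightarrow> 'a \<Rightarrow> 'a" where
  "multiplier w x = (\<Sum>i\<in>{1..k}. w i *\<^sub>R cmp i x)"

lemma linear_multiplier: "linear (multiplier w)"
  unfolding multiplier_def by (intro linear_compose_sum ballI linear_compose_scale_right linear_comp)

lemma dil_multiplier: "dl r = multiplier (\<lambda>i. r ^ i)"
  by (rule ext) (simp add: dil_def multiplier_def)

lemma comp_multiplier: "cmp i (multiplier w x) = w i *\<^sub>R cmp i x"
proof -
  have "cmp i (multiplier w x) = (\<Sum>j\<in>{1..k}. w j *\<^sub>R (if i = j then cmp j x else 0))"
    unfolding multiplier_def linear_sum[OF linear_comp] comp_simps comp_layer[OF comp_in_layer] ..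
  also have "\<dots> = (\<Sum>j\<in>{1..k}. if j = i then w i *\<^sub>R cmp i x else 0)" by (rule sum.cong) auto
  also have "\<dots> = w i *\<^sub>R cmp i x" by (simp add: comp_out)
  finally show ?thesis .
qed

lemma multiplier_layer: "v \<in> layer V k m \<Longrightarrow> multiplier w v = w m *\<^sub>R v"
  by (rule comp_eqI) (auto simp: comp_multiplier comp_layer comp_simps)

lemma br_comps: "br x y = (\<Sum>i\<in>{1..k}. \<Sum>j\<in>{1..k}. br (cmp i x) (cmp j y))"
proof -
  have "br x y = br (\<Sum>i\<in>{1..k}. cmp i x) (\<Sum>j\<in>{1..k}. cmp j y)" by (simp add: sum_comp)
  also have "\<dots> = (\<Sum>i\<in>{1..k}. \<Sum>j\<in>{1..k}. br (cmp i x) (cmp j y))" by (simp only: br_sums) (rule sum.swap)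
  finally show ?thesis .
qed

lemma br_comp_layer: "br (cmp i x) (cmp j y) \<in> layer V k (i + j)"
proof (cases "i \<in> {1..k} \<and> j \<in> {1..k}")
  case True then show ?thesis using br_layer[of i j "cmp i x" "cmp j y"] comp_in[of i x] comp_in[of j y] by blast
next
  case False
  then have "br (cmp i x) (cmp j y) = 0" by (auto simp: comp_out br_simps)
  then show ?thesis by (simp add: layer_iff comp_simps)
qed

lemma multiplier_br:
  "multiplier w (br x y) = (\<Sum>i\<in>{1..k}. \<Sum>j\<in>{1..k}. w (i + j) *\<^sub>R br (cmp i x) (cmp j y))"
  by (subst br_comps) (simp add: linear_sum[OF linear_multiplier] multiplier_layer[OF br_comp_layer])

lemma br_multiplier:
  "br (multiplier w x) (multiplier u y) = (\<Sum>i\<in>{1..k}. \<Sum>j\<in>{1..k}. (w i * u j) *\<^sub>R br (cmp i x) (cmp j y))"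
  by (subst br_comps) (simp add: comp_multiplier br_simps mult.commute)

lemma dil_br: "dl r (br x y) = br (dl r x) (dl r y)"
  by (simp add: dil_multiplier multiplier_br br_multiplier power_add)

text \<open>The derivation with eigenvalue i on the layer \<open>V i\<close>. It is injective
  because degrees start at one.\<close>

definition deg :: "'a \<Rightarrow> 'a" where "deg = multiplier real"

lemma multiplier_1: "multiplier (\<lambda>_. 1) x = x"
  by (simp add: multiplier_def sum_comp)

lemma deg_br: "deg (br x y) = br (deg x) y + br x (deg y)"
proof -
  have "br (deg x) y + br x (deg y) = br (multiplier real x) (multiplier (\<lambda>_. 1) y) + br (multiplier (\<lambda>_. 1) x) (multiplier real y)"
    by (simp add: multiplier_1 deg_def)
  then show ?thesis
    by (simp add: br_multiplier multiplier_br sum.distrib[symmetric] scaleR_add_left[symmetric] deg_def)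
qed

text \<open>The sum of the layers of degree at least m.\<close>

definition Vge :: "nat \<Rightarrow> 'a set" where "Vge m = {x. \<forall>i<m. cmp i x = 0}"

lemma Vge_alt: "Vge m = (\<Inter>i\<in>{..<m}. cmp i -` {0})"
  by (auto simp: Vge_def)

lemma subspace_Vge: "subspace (Vge m)"
  by (auto simp: subspace_def Vge_def comp_simps)

lemma closed_Vge: "closed (Vge m)"
  unfolding Vge_alt by (intro closed_INT ballI continuous_closed_vimage) (auto intro!: linear_continuous_at bounded_linear_comp)

lemma Vge_0: "Vge 0 = UNIV" and Vge_1: "Vge (Suc 0) = UNIV"
  by (auto simp: Vge_def comp_out)

lemma Vge_top: "Vge (Suc k) = {0}"
proof -
  have "x = 0" if "x \<in> Vge (Suc k)" for x
    by (rule comp_eqI) (use that in \<open>auto simp: Vge_def comp_simps\<close>)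
  then show ?thesis using subspace_0[OF subspace_Vge] by blast
qed

lemma Vge_anti: "x \<in> Vge n \<Longrightarrow> m \<le> n \<Longrightarrow> x \<in> Vge m"
  by (auto simp: Vge_def)

lemma br_Vge:
  assumes "x \<in> Vge a" "y \<in> Vge b" shows "br x y \<in> Vge (a + b)"
  unfolding Vge_def
proof (intro CollectI allI impI)
  fix m assume m: "m < a + b"
  have "cmp m (br (cmp i x) (cmp j y)) = 0" for i j
  proof (cases "i < a \<or> j < b")
    case True then show ?thesis using assms by (auto simp: Vge_def br_simps comp_simps)
  next
    case False then show ?thesis using m by (simp add: comp_layer[OF br_comp_layer])
  qed
  then show "cmp m (br x y) = 0" by (subst br_comps) (simp add: linear_sum[OF linear_comp])
qed

lemma deg_Vge: "deg x \<in> Vge m \<longleftrightarrow> x \<in> Vge m"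
proof -
  have "cmp i (deg x) = 0 \<longleftrightarrow> cmp i x = 0" for i
    by (cases "i = 0") (auto simp: deg_def comp_multiplier comp_out)
  then show ?thesis by (simp add: Vge_def)
qed

text \<open>The semidirect product of the algebra with its degree derivation has trivial centre,
  so its adjoint representation is faithful; \<open>rep\<close> is its restriction to the algebra.\<close>

definition rep :: "'a \<Rightarrow> 'a endo" where
  "rep x = Endo (\<lambda>(v, c). (br x v - c *\<^sub>R deg x, 0))"

lemma rep_apply: "endo_apply (rep x) (v, c) = (br x v - c *\<^sub>R deg x, 0)"
proof -
  have "bounded_linear (\<lambda>w. (br x (fst w) - snd w *\<^sub>R deg x, 0::real))"
    by (intro bounded_linear_Pair bounded_linear_sub bounded_linear_zero
        bounded_linear_compose[OF bounded_bilinear.bounded_linear_right[OF bounded_bilinear_br]]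
        bounded_linear_fst bounded_linear_compose[OF bounded_linear_scaleR_left] bounded_linear_snd)
  then have "bounded_linear (\<lambda>(v, c). (br x v - c *\<^sub>R deg x, 0::real))"
    by (simp add: case_prod_beta')
  from endo_apply_Endo[OF this] show ?thesis by (simp add: rep_def)
qed

lemma deg_simps: "deg (x + y) = deg x + deg y" "deg (c *\<^sub>R x) = c *\<^sub>R deg x"
  unfolding deg_def by (auto simp: linear_add[OF linear_multiplier] linear_cmul[OF linear_multiplier])

lemma linear_rep: "linear rep"
  by (rule linearI; rule endo_eqI) (auto simp: rep_apply br_simps deg_simps algebra_simps)

lemma rep_br: "rep (br x y) = ad (rep x) (rep y)"
  by (rule endo_eqI) (auto simp: rep_apply ad_def br_simps br_br deg_br br_anti[of y "deg x"] algebra_simps)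

text \<open>The degree filtration of the semidirect product, with the derivation itself in degree 0.
  \<open>F m\<close> then consists of the operators that raise this filtration by m.\<close>

definition W :: "nat \<Rightarrow> ('a \<times> real) set" where
  "W j = {(v, c). (1 \<le> j \<longrightarrow> c = 0) \<and> v \<in> Vge j}"

definition F :: "nat \<Rightarrow> 'a endo set" where
  "F m = {T. \<forall>j. \<forall>w\<in>W j. endo_apply T w \<in> W (j + m)}"

lemma subspace_W: "subspace (W j)"
  by (auto simp: W_def subspace_def zero_prod_def Vge_def comp_simps)

lemma closed_W: "closed (W j)"
proof -
  have "W j = Vge j \<times> (if 1 \<le> j then {0} else UNIV)" by (auto simp: W_def)
  then show ?thesis by (simp add: closed_Times closed_Vge)
qed

lemma W_anti: "w \<in> W n \<Longrightarrow> m \<le> n \<Longrightarrow> w \<in> W m"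
  by (auto simp: W_def intro: Vge_anti)

lemma F_altdef: "F m = (\<Inter>j. \<Inter>w\<in>W j. (\<lambda>T. endo_apply T w) -` W (j + m))"
  by (auto simp: F_def)

sublocale nilpotent_algebra F k
proof
  fix m i j and a b :: "'a endo"
  show "subspace (F m)"
    by (auto simp: F_def subspace_def intro: subspace_0[OF subspace_W] subspace_add[OF subspace_W] subspace_scale[OF subspace_W])
  show "closed (F m)"
    unfolding F_altdef
    by (intro closed_INT ballI continuous_closed_vimage closed_W)
       (auto intro!: linear_continuous_at bounded_linear_endo_apply_left)
  show "a * b \<in> F (i + j)" if "a \<in> F i" "b \<in> F j"
    unfolding F_def
  proof (intro CollectI allI ballI)
    fix l w assume "w \<in> W l"
    then have "endo_apply b w \<in> W (l + j)" using that(2) unfolding F_def by blast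
    then have "endo_apply a (endo_apply b w) \<in> W (l + j + i)" using that(1) unfolding F_def by blast
    then show "endo_apply (a * b) w \<in> W (l + (i + j))" by (simp add: add_ac)
  qed
  show "F (Suc m) \<subseteq> F m" 
  proof
    fix T assume T: "T \<in> F (Suc m)"
    show "T \<in> F m" unfolding F_def
    proof (intro CollectI allI ballI)
      fix j w assume "w \<in> W j"
      with T have "endo_apply T w \<in> W (j + Suc m)" unfolding F_def by blast
      then show "endo_apply T w \<in> W (j + m)" by (rule W_anti) simp
    qed
  qed
  show "1 \<in> F 0" by (simp add: F_def)
  have "W 0 = UNIV" by (auto simp: W_def Vge_0)
  moreover have "W (Suc k) = {0}" by (auto simp: W_def Vge_top zero_prod_def)
  ultimately have "T = 0" if "T \<in> F (Suc k)" for T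
    using that by (intro endo_eqI) (force simp: F_def)
  then show "F (Suc k) = {0}" by (auto simp: F_def intro: subspace_0[OF subspace_W])
qed

text \<open>The converse evaluates \<open>rep x\<close> at the derivation (0, 1), which returns -
  \<open>deg x\<close> and hence the degree of \<open>x\<close>. The adjoint action on the algebra
  alone would not see the centre.\<close>

lemma rep_F: "m \<ge> 1 \<Longrightarrow> rep x \<in> F m \<longleftrightarrow> x \<in> Vge m"
proof
  assume m: "m \<ge> 1" and x: "x \<in> Vge m"
  have "(br x v - c *\<^sub>R deg x) \<in> Vge (j + m)" if "1 \<le> j \<longrightarrow> c = 0" "v \<in> Vge j" for j v c
  proof (cases "j = 0")
    case True
    have "br x v \<in> Vge m" using br_Vge[OF x that(2)] by (rule Vge_anti) simp
    then show ?thesis using True x deg_Vge[of x m]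
      by (auto intro!: subspace_diff[OF subspace_Vge] subspace_scale[OF subspace_Vge])
  next
    case False
    then show ?thesis using that br_Vge[OF x that(2)] by (simp add: add.commute)
  qed
  then show "rep x \<in> F m" using m by (auto simp: F_def W_def rep_apply)
next
  assume m: "m \<ge> 1" and "rep x \<in> F m"
  moreover have "(0, 1) \<in> W 0" by (simp add: W_def Vge_0)
  ultimately have "endo_apply (rep x) (0, 1) \<in> W (0 + m)" unfolding F_def by blast
  then have "- deg x \<in> Vge m" by (simp add: rep_apply br_simps W_def)
  then show "x \<in> Vge m" using subspace_neg[OF subspace_Vge, of "- deg x" m] by (simp add: deg_Vge)
qed

lemma rep_F1: "rep x \<in> F 1"
  by (simp add: rep_F Vge_1)

lemma rep_inj: "rep x = rep y \<Longrightarrow> x = y"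
proof -
  assume "rep x = rep y"
  then have "rep (x - y) = 0" by (simp add: linear_diff[OF linear_rep])
  then have "rep (x - y) \<in> F (Suc k)" by (simp add: F_top)
  then have "x - y \<in> Vge (Suc k)" by (subst (asm) rep_F) auto
  then show ?thesis by (simp add: Vge_top)
qed

lemma nbr_hom:
  assumes "\<And>x y. f (br x y) = br' (f x) (f y)" "f 0 = 0"
  shows "f (nbr br w) = nbr br' (map f w)"
  by (induction w rule: induct_list012) (auto simp: assms)

text \<open>Dynkin's series consists of brackets, so linear maps preserving brackets preserve it.
  Applied to \<open>rep\<close> it brings the product into the operator algebra; applied to
  dilations it makes them group automorphisms.\<close>

lemma bch_hom:
  assumes "\<And>x y. f (br x y) = br' (f x) (f y)" "linear f"
  shows "f (x \<odot> y) = bch br' k (f x) (f y)"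
  unfolding bch_altdef
  by (simp add: linear_sum[OF assms(2)] linear_cmul[OF assms(2)] nbr_hom[of f br', OF assms(1) linear_0[OF assms(2)]]
      dyn_word_map length_dyn_word)

text \<open>An injective map into the units of an associative algebra; by \<open>gexp_mul\<close>
  the group axioms are pulled back along it.\<close>

definition gexp :: "'a \<Rightarrow> 'a endo" where "gexp x = texp (rep x)"

lemma gexp_mul: "gexp (x \<odot> y) = gexp x * gexp y"
  unfolding gexp_def bch_hom[OF rep_br linear_rep] by (rule texp_bch[OF rep_F1 rep_F1 k1])

lemma gexp_inj: "gexp x = gexp y \<Longrightarrow> x = y"
  unfolding gexp_def using texp_inj[OF rep_F1 rep_F1] rep_inj by blast

lemma gexp_0 [simp]: "gexp 0 = 1"
  by (simp add: gexp_def linear_0[OF linear_rep])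

lemma gexp_minus: "gexp x * gexp (- x) = 1" "gexp (- x) * gexp x = 1"
  using texp_minus[OF rep_F1[of x]] texp_minus[OF rep_F1[of "- x"]]
  by (auto simp: gexp_def linear_neg[OF linear_rep])

sublocale grp: group "(\<odot>)" 0 uminus
proof
  show "a \<odot> b \<odot> c = a \<odot> (b \<odot> c)" for a b c
    by (rule gexp_inj) (simp add: gexp_mul mult.assoc)
  show "0 \<odot> a = a" for a by (rule gexp_inj) (simp add: gexp_mul)
  show "(- a) \<odot> a = 0" for a by (rule gexp_inj) (simp add: gexp_mul gexp_minus)
qed

lemmas mul_assoc = grp.assoc

lemma mul_0_right [simp]: "x \<odot> 0 = x"
  by (rule gexp_inj) (simp add: gexp_mul)

lemma mul_minus [simp]: "x \<odot> (- x) = 0" "(- x) \<odot> x = 0"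
  "(- x) \<odot> (x \<odot> y) = y" "x \<odot> ((- x) \<odot> y) = y"
  by (rule gexp_inj; simp add: gexp_mul gexp_minus mult.assoc[symmetric])+

lemma minus_mul: "- (x \<odot> y) = (- y) \<odot> (- x)"
  by (rule grp.inverse_distrib_swap)

lemma mul_scale: "(s *\<^sub>R x) \<odot> (t *\<^sub>R x) = (s + t) *\<^sub>R x"
proof (rule gexp_inj)
  have "texp ((s + t) *\<^sub>R rep x) = texp (s *\<^sub>R rep x) * texp (t *\<^sub>R rep x)"
    by (rule texp_scaleR_add[OF rep_F1])
  moreover have "gexp ((s *\<^sub>R x) \<odot> (t *\<^sub>R x)) = gexp (s *\<^sub>R x) * gexp (t *\<^sub>R x)" by (rule gexp_mul)
  ultimately show "gexp ((s *\<^sub>R x) \<odot> (t *\<^sub>R x)) = gexp ((s + t) *\<^sub>R x)"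
    by (simp only: gexp_def linear_cmul[OF linear_rep])
qed

lemma linear_dil: "linear (dl r)"
  unfolding dil_multiplier by (rule linear_multiplier)

lemmas dil_simps [simp] = linear_neg[OF linear_dil] linear_0[OF linear_dil]

lemma dil_mul: "dl r (x \<odot> y) = dl r x \<odot> dl r y"
  by (rule bch_hom[OF dil_br linear_dil])

lemma comp_dil: "cmp i (dl r x) = r ^ i *\<^sub>R cmp i x"
  by (simp add: dil_multiplier comp_multiplier)

lemma dil_dil [simp]: "dl r (dl s x) = dl (r * s) x"
  by (rule comp_eqI) (simp add: comp_dil power_mult_distrib)

lemma dil_1 [simp]: "dl 1 x = x"
  by (rule comp_eqI) (simp add: comp_dil)

section \<open>Leading terms of products and commutators\<close>

lemma Vge_of_gexp: "m \<ge> 1 \<Longrightarrow> gexp z - 1 - rep c \<in> F (Suc m) \<Longrightarrow> c \<in> Vge m \<Longrightarrow> z - c \<in> Vge (Suc m)"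
  using texp_leading[OF rep_F1[of z], of "rep c" m]
  by (simp add: gexp_def rep_F linear_diff[OF linear_rep, symmetric])

lemma gexp_leading:
  assumes "m \<ge> 1" "x \<in> Vge m" shows "gexp x - 1 - rep x \<in> F (2 * m)" "gexp x - 1 \<in> F m"
proof -
  have rx: "rep x \<in> F m" using assms by (simp add: rep_F)
  then show "gexp x - 1 \<in> F m" unfolding gexp_def by (rule texp_F[OF rep_F1])
  have "gexp x = (\<Sum>i\<in>insert 0 (insert 1 {2..k}). rep x ^ i /\<^sub>R fact i)"
    unfolding gexp_def texp_def using k1 by (intro sum.cong) auto
  then have "gexp x - 1 - rep x = (\<Sum>i\<in>{2..k}. rep x ^ i /\<^sub>R fact i)" by simp
  also have "\<dots> \<in> F (2 * m)"
  proof (intro F_sum F_scale)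
    fix i assume "i \<in> {2..k}"
    then have "i = Suc (Suc (i - 2))" by auto
    then obtain j where "i = Suc (Suc j)" by blast
    then have "rep x ^ i = (rep x * rep x) * rep x ^ j" by (simp add: mult.assoc)
    also have "\<dots> \<in> F (2 * m)"
      by (rule F_mult_right[OF mult_F[OF rx rx, folded mult_2] F_antiD[OF power_F[OF rep_F1]]]) simp
    finally show "rep x ^ i \<in> F (2 * m)" .
  qed
  finally show "gexp x - 1 - rep x \<in> F (2 * m)" .
qed

text \<open>In e^x e^y - 1 = (e^x - 1) + (e^y - 1) + (e^x - 1)(e^y - 1) the last summand and all
  nonlinear terms have degree at least 2m, and the logarithm keeps the leading term.\<close>

lemma mul_leading:
  assumes m: "m \<ge> 1" and x: "x \<in> Vge m" and y: "y \<in> Vge m"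
  shows "x \<odot> y - (x + y) \<in> Vge (Suc m)"
proof (rule Vge_of_gexp[OF m])
  have "gexp (x \<odot> y) - 1 - rep (x + y) = (gexp x - 1 - rep x) + (gexp y - 1 - rep y) + (gexp x - 1) * (gexp y - 1)"
    by (simp add: gexp_mul linear_add[OF linear_rep] algebra_simps)
  also have "\<dots> \<in> F (Suc m)"
    using m by (intro F_add F_antiD[OF gexp_leading(1)[OF m x]] F_antiD[OF gexp_leading(1)[OF m y]]
        F_antiD[OF mult_F[OF gexp_leading(2)[OF m x] gexp_leading(2)[OF m y]]]) auto
  finally show "gexp (x \<odot> y) - 1 - rep (x + y) \<in> F (Suc m)" .
  show "x + y \<in> Vge m" by (intro subspace_add[OF subspace_Vge] x y)
qed

definition commutator :: "'a \<Rightarrow> 'a \<Rightarrow> 'a" where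
  "commutator x y = (x \<odot> y) \<odot> (- (y \<odot> x))"

text \<open>With a = e^x - 1 and b = e^y - 1 the commutator differs from 1 by (a b - b a) g, where g
  is 1 modulo \<open>F 1\<close>. Replacing a and b by their linear parts costs at least one further
  degree, which leaves the Lie bracket.\<close>

lemma commutator_leading:
  assumes m: "m \<ge> 1" and n: "n \<ge> 1" and x: "x \<in> Vge m" and y: "y \<in> Vge n"
  shows "commutator x y - br x y \<in> Vge (Suc (m + n))"
proof (rule Vge_of_gexp)
  show "1 \<le> m + n" using m by simp
  show br: "br x y \<in> Vge (m + n)" by (rule br_Vge[OF x y])
  define a where "a = gexp x - 1"
  define b where "b = gexp y - 1"
  define g where "g = gexp (- (y \<odot> x))"
  have a: "a \<in> F m" "a - rep x \<in> F (2 * m)" and b: "b \<in> F n" "b - rep y \<in> F (2 * n)"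
    using gexp_leading[OF m x] gexp_leading[OF n y] by (auto simp: a_def b_def)
  have rx: "rep x \<in> F m" and ry: "rep y \<in> F n" using x y m n by (auto simp: rep_F)
  have "(gexp y * gexp x) * g = 1"
    using gexp_minus(1)[of "y \<odot> x"] by (simp add: gexp_mul g_def)
  then have "gexp (commutator x y) - 1 = (gexp x * gexp y - gexp y * gexp x) * g"
    by (simp add: commutator_def gexp_mul left_diff_distrib g_def)
  also have "gexp x * gexp y - gexp y * gexp x = a * b - b * a"
    by (simp add: a_def b_def algebra_simps)
  finally have 1: "gexp (commutator x y) - 1 = (a * b - b * a) * g" .
  have ab: "a * b - b * a - rep (br x y) \<in> F (Suc (m + n))"
  proof -
    have "a * b - b * a - rep (br x y) = (a - rep x) * b + rep x * (b - rep y) - b * (a - rep x) - (b - rep y) * rep x"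
      by (simp add: rep_br ad_def algebra_simps)
    also have "\<dots> \<in> F (Suc (m + n))"
      using m n by (intro F_diff F_add F_antiD[OF mult_F[OF a(2) b(1)]] F_antiD[OF mult_F[OF rx b(2)]]
          F_antiD[OF mult_F[OF b(1) a(2)]] F_antiD[OF mult_F[OF b(2) rx]]) auto
    finally show ?thesis .
  qed
  have g: "g - 1 \<in> F 1" "g \<in> F 0"
    unfolding g_def using gexp_leading(2)[of 1] texp_F0[OF rep_F1] by (auto simp: Vge_1 gexp_def)
  have c: "a * b - b * a \<in> F (m + n)"
    using mult_F[OF a(1) b(1)] mult_F[OF b(1) a(1)] by (intro F_diff) (auto simp: add.commute)
  have "gexp (commutator x y) - 1 - rep (br x y) = (a * b - b * a - rep (br x y)) + (a * b - b * a) * (g - 1)"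
    unfolding 1 by (simp add: algebra_simps)
  also have "\<dots> \<in> F (Suc (m + n))"
    using mult_F[OF c g(1)] by (intro F_add ab) auto
  finally show "gexp (commutator x y) - 1 - rep (br x y) \<in> F (Suc (m + n))" .
qed

end

section \<open>Local Lipschitz bounds and continuity of the group law\<close>

context graded_algebra
begin

text \<open>The last clause, on the mixed second difference, makes the error in the Gronwall argument of
  \<open>curve_estimate\<close> proportional to the time step.\<close>

definition lip_const :: "('a \<Rightarrow> 'a \<Rightarrow> 'a) \<Rightarrow> real \<Rightarrow> real \<Rightarrow> bool" where
  "lip_const P B C \<longleftrightarrow> 0 \<le> C \<and>
     (\<forall>x x' y y'. norm x \<le> B \<longrightarrow> norm x' \<le> B \<longrightarrow> norm y \<le> B \<longrightarrow> norm y' \<le> B \<longrightarrow>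
       norm (P x y) \<le> C \<and> norm (P x y - P x' y') \<le> C * (norm (x - x') + norm (y - y')) \<and>
       norm ((P x y - P x 0) - (P x' y - P x' 0)) \<le> C * norm (x - x') * norm y)"

definition loc_lip :: "('a \<Rightarrow> 'a \<Rightarrow> 'a) \<Rightarrow> bool" where
  "loc_lip P \<longleftrightarrow> (\<forall>B. \<exists>C. lip_const P B C)"

lemma lip_constD:
  assumes "lip_const P B C"
  shows "0 \<le> C" "norm x \<le> B \<Longrightarrow> norm y \<le> B \<Longrightarrow> norm (P x y) \<le> C"
    "norm x \<le> B \<Longrightarrow> norm x' \<le> B \<Longrightarrow> norm y \<le> B \<Longrightarrow> norm y' \<le> B \<Longrightarrow>
       norm (P x y - P x' y') \<le> C * (norm (x - x') + norm (y - y'))"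
    "norm x \<le> B \<Longrightarrow> norm x' \<le> B \<Longrightarrow> norm y \<le> B \<Longrightarrow>
       norm ((P x y - P x 0) - (P x' y - P x' 0)) \<le> C * norm (x - x') * norm y"
  using assms unfolding lip_const_def by blast+

lemma lip_constI:
  assumes "0 \<le> C"
    "\<And>x y. norm x \<le> B \<Longrightarrow> norm y \<le> B \<Longrightarrow> norm (P x y) \<le> C"
    "\<And>x x' y y'. norm x \<le> B \<Longrightarrow> norm x' \<le> B \<Longrightarrow> norm y \<le> B \<Longrightarrow> norm y' \<le> B \<Longrightarrow>
       norm (P x y - P x' y') \<le> C * (norm (x - x') + norm (y - y'))"
    "\<And>x x' y. norm x \<le> B \<Longrightarrow> norm x' \<le> B \<Longrightarrow> norm y \<le> B \<Longrightarrow>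
       norm ((P x y - P x 0) - (P x' y - P x' 0)) \<le> C * norm (x - x') * norm y"
  shows "lip_const P B C"
  using assms unfolding lip_const_def by blast

lemma lip_const_add:
  assumes P: "lip_const P B C" and Q: "lip_const Q B D"
  shows "lip_const (\<lambda>x y. P x y + Q x y) B (C + D)"
proof (rule lip_constI)
  show "0 \<le> C + D" using lip_constD(1)[OF P] lip_constD(1)[OF Q] by simp
  fix x x' y y' :: 'a assume b: "norm x \<le> B" "norm x' \<le> B" "norm y \<le> B"
  show "norm (P x y + Q x y) \<le> C + D"
    by (intro norm_triangle_mono lip_constD(2)[OF P] lip_constD(2)[OF Q] b)
  have "norm ((P x y - P x' y') + (Q x y - Q x' y')) \<le> (C + D) * (norm (x - x') + norm (y - y'))" if "norm y' \<le> B"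
    unfolding distrib_right[of C] by (intro norm_triangle_mono lip_constD(3)[OF P] lip_constD(3)[OF Q] b that)
  then show "norm (P x y + Q x y - (P x' y' + Q x' y')) \<le> (C + D) * (norm (x - x') + norm (y - y'))" if "norm y' \<le> B"
    using that by (simp add: algebra_simps)
  have "norm (((P x y - P x 0) - (P x' y - P x' 0)) + ((Q x y - Q x 0) - (Q x' y - Q x' 0))) \<le> (C + D) * norm (x - x') * norm y"
    unfolding distrib_right by (intro norm_triangle_mono lip_constD(4)[OF P] lip_constD(4)[OF Q] b)
  then show "norm ((P x y + Q x y - (P x 0 + Q x 0)) - (P x' y + Q x' y - (P x' 0 + Q x' 0))) \<le> (C + D) * norm (x - x') * norm y"
    by (simp add: algebra_simps)
qed

text \<open>The factor 4 counts the terms into which the mixed second difference of a bilinear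
  expression splits; the first difference splits into only two.\<close>

lemma lip_const_br:
  assumes P: "lip_const P B C" and Q: "lip_const Q B D" and K: "K \<ge> 0" "\<And>a b. norm (br a b) \<le> norm a * norm b * K"
  shows "lip_const (\<lambda>x y. br (P x y) (Q x y)) B (4 * (K * C * D))"
proof -
  note C = lip_constD[OF P] and D = lip_constD[OF Q]
  have brb: "norm (br a b) \<le> K * s * t" if "norm a \<le> s" "norm b \<le> t" for a b s t
  proof -
    have "norm a * norm b \<le> s * t"
      using that by (intro mult_mono) (auto intro: order_trans[OF norm_ge_zero])
    then have "norm a * norm b * K \<le> s * t * K" using K(1) by (rule mult_right_mono)
    with K(2)[of a b] show ?thesis by (simp add: mult_ac)
  qed
  define E where "E = 4 * (K * C * D)"
  have E: "K * C * D \<le> E" "2 * (K * C * D) \<le> E" "0 \<le> E"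
    using C(1) D(1) K(1) by (auto simp: E_def)
  show ?thesis
    unfolding E_def[symmetric]
  proof (rule lip_constI)
    show "0 \<le> E" by (rule E)
    fix x x' y y' :: 'a assume b: "norm x \<le> B" "norm x' \<le> B" "norm y \<le> B"
    have b0: "norm (0::'a) \<le> B" using order_trans[OF norm_ge_zero b(1)] by simp
    show "norm (br (P x y) (Q x y)) \<le> E" using order_trans[OF brb[OF C(2) D(2)] E(1)] b by blast
    let ?n = "norm (x - x') + norm (y - y')"
    show "norm (br (P x y) (Q x y) - br (P x' y') (Q x' y')) \<le> E * ?n" if b': "norm y' \<le> B"
    proof -
      have "norm (br (P x y - P x' y') (Q x y) + br (P x' y') (Q x y - Q x' y')) \<le> K * (C * ?n) * D + K * C * (D * ?n)"
        by (intro norm_triangle_mono brb C D b b')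
      also have "\<dots> = (2 * (K * C * D)) * ?n" by (simp add: algebra_simps)
      also have "\<dots> \<le> E * ?n" by (rule mult_right_mono[OF E(2)]) simp
      finally show ?thesis by (simp add: br_simps algebra_simps)
    qed
    have dP: "norm (P x' y - P x' 0) \<le> C * norm y" using C(3)[OF b(2) b(2) b(3) b0] by simp
    have dQ: "norm (Q x y - Q x 0) \<le> D * norm y" using D(3)[OF b(1) b(1) b(3) b0] by simp
    have eQ: "norm (Q x y - Q x' y) \<le> D * norm (x - x')" using D(3)[OF b(1) b(2) b(3) b(3)] by simp
    have eP: "norm (P x 0 - P x' 0) \<le> C * norm (x - x')" using C(3)[OF b(1) b(2) b0 b0] by simp
    have "norm (br ((P x y - P x 0) - (P x' y - P x' 0)) (Q x y) + br (P x' y - P x' 0) (Q x y - Q x' y)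
        + (br (P x 0 - P x' 0) (Q x y - Q x 0) + br (P x' 0) ((Q x y - Q x 0) - (Q x' y - Q x' 0))))
      \<le> (K * (C * norm (x - x') * norm y) * D + K * (C * norm y) * (D * norm (x - x')))
       + (K * (C * norm (x - x')) * (D * norm y) + K * C * (D * norm (x - x') * norm y))"
      by (intro norm_triangle_mono brb C D b b0 dP dQ eP eQ)
    also have "\<dots> = E * norm (x - x') * norm y" by (simp add: E_def algebra_simps)
    finally show "norm ((br (P x y) (Q x y) - br (P x 0) (Q x 0)) - (br (P x' y) (Q x' y) - br (P x' 0) (Q x' 0))) \<le> E * norm (x - x') * norm y"
      by (simp add: br_simps algebra_simps)
  qed
qed

lemma lip_const_scaleR:
  assumes "lip_const P B C" shows "lip_const (\<lambda>x y. c *\<^sub>R P x y) B (\<bar>c\<bar> * C)"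
  using lip_constD[OF assms] unfolding lip_const_def scaleR_diff_right[symmetric] norm_scaleR
  by (auto simp: mult.assoc intro!: mult_left_mono)

lemma loc_lip_fst: "loc_lip (\<lambda>x y. x)" and loc_lip_snd: "loc_lip (\<lambda>x y. y)"
proof -
  have "lip_const (\<lambda>x y. x) B (\<bar>B\<bar> + 1)" "lip_const (\<lambda>x y. y) B (\<bar>B\<bar> + 1)" for B
    unfolding lip_const_def
    by (auto simp: distrib_right distrib_left intro!: add_increasing2 mult_nonneg_nonneg)
  then show "loc_lip (\<lambda>x y. x)" "loc_lip (\<lambda>x y. y)" unfolding loc_lip_def by blast+
qed

lemma loc_lip_0: "loc_lip (\<lambda>x y. 0)"
  unfolding loc_lip_def lip_const_def by (intro allI exI[of _ 0]) auto

lemma loc_lip_add: "loc_lip P \<Longrightarrow> loc_lip Q \<Longrightarrow> loc_lip (\<lambda>x y. P x y + Q x y)"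
  unfolding loc_lip_def using lip_const_add by blast

lemma loc_lip_scaleR: "loc_lip P \<Longrightarrow> loc_lip (\<lambda>x y. c *\<^sub>R P x y)"
  unfolding loc_lip_def using lip_const_scaleR by blast

lemma loc_lip_br: "loc_lip P \<Longrightarrow> loc_lip Q \<Longrightarrow> loc_lip (\<lambda>x y. br (P x y) (Q x y))"
proof -
  assume P: "loc_lip P" and Q: "loc_lip Q"
  obtain K where K: "K \<ge> 0" "\<And>a b. norm (br a b) \<le> norm a * norm b * K"
    using bounded_bilinear.nonneg_bounded[OF bounded_bilinear_br] by blast
  show ?thesis
    unfolding loc_lip_def
  proof
    fix B
    obtain C D where "lip_const P B C" "lip_const Q B D" using P Q unfolding loc_lip_def by blast
    from lip_const_br[OF this K] show "\<exists>E. lip_const (\<lambda>x y. br (P x y) (Q x y)) B E" ..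
  qed
qed

lemma loc_lip_sum: "(\<And>i. i \<in> I \<Longrightarrow> loc_lip (P i)) \<Longrightarrow> loc_lip (\<lambda>x y. \<Sum>i\<in>I. P i x y)"
  by (induction I rule: infinite_finite_induct) (auto intro: loc_lip_0 loc_lip_add)

lemma loc_lip_word: "loc_lip (\<lambda>x y. nbr br (map (\<lambda>b. if b then x else y) w))"
proof (induction w rule: induct_list012)
  case 1 then show ?case by (simp add: loc_lip_0)
next
  case (2 b) then show ?case by (cases b) (simp_all add: loc_lip_fst loc_lip_snd)
next
  case (3 b c w)
  have "loc_lip (\<lambda>x y. if b then x else y)" by (cases b) (simp_all add: loc_lip_fst loc_lip_snd)
  from loc_lip_br[OF this 3(2)] show ?case by simp
qed

text \<open>A Boolean word separates the shape of a bracket from its letters, so that estimates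
  uniform in the letters can be proved by induction on the shape.\<close>

lemma dyn_word_bool: "dyn_word x y ps = map (\<lambda>b. if b then x else y) (dyn_word True False ps)"
  by (simp add: dyn_word_map)

lemma loc_lip_mul: "loc_lip (\<odot>)"
  unfolding bch_def by (subst dyn_word_bool) (intro loc_lip_sum loc_lip_scaleR loc_lip_word)

lemma mul_lipschitz:
  obtains C where "C \<ge> 0"
    "\<And>x x' y y'. norm x \<le> B \<Longrightarrow> norm x' \<le> B \<Longrightarrow> norm y \<le> B \<Longrightarrow> norm y' \<le> B \<Longrightarrow>
       norm (x \<odot> y - x' \<odot> y') \<le> C * (norm (x - x') + norm (y - y'))"
    "\<And>x x' y. norm x \<le> B \<Longrightarrow> norm x' \<le> B \<Longrightarrow> norm y \<le> B \<Longrightarrow>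
       norm ((x \<odot> y - x) - (x' \<odot> y - x')) \<le> C * norm (x - x') * norm y"
proof -
  obtain C where "lip_const (\<odot>) B C" using loc_lip_mul by (auto simp: loc_lip_def)
  from lip_constD[OF this] show thesis using that[of C] by simp
qed

lemma continuous_on_mul [continuous_intros]:
  assumes f: "continuous_on S f" and g: "continuous_on S g"
  shows "continuous_on S (\<lambda>x. f x \<odot> g x)"
proof -
  have "continuous_on S (\<lambda>x. nbr br (map (\<lambda>b. if b then f x else g x) w))" for w
  proof (induction w rule: induct_list012)
    case (3 b c w)
    have "continuous_on S (\<lambda>x. if b then f x else g x)" using f g by (cases b) auto
    from bounded_bilinear.continuous_on[OF bounded_bilinear_br this 3(2)] show ?case by simp
  next
    case (2 b) show ?case using f g by (cases b) auto
  qed simp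
  then have "continuous_on S (\<lambda>x. nbr br (dyn_word (f x) (g x) ps))" for ps
    by (subst dyn_word_bool)
  then show ?thesis unfolding bch_def by (intro continuous_intros)
qed

lemma continuous_on_dil [continuous_intros]:
  "continuous_on S r \<Longrightarrow> continuous_on S f \<Longrightarrow> continuous_on S (\<lambda>x. dl (r x) (f x))"
  unfolding dil_def by (intro continuous_intros)

lemma dil_0_left: "dl 0 x = 0"
  by (rule comp_eqI) (auto simp: comp_dil comp_simps)

text \<open>Contractions are controlled by the lowest degree, expansions by the highest; hence the
  two exponents 1 and k.\<close>

lemma norm_dil_le: obtains K where "K > 0" "\<And>r x. 0 \<le> r \<Longrightarrow> r \<le> 1 \<Longrightarrow> norm (dl r x) \<le> r * (K * norm x)"
    "\<And>r x. 1 \<le> r \<Longrightarrow> norm (dl r x) \<le> r ^ k * (K * norm x)"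
proof -
  have "\<exists>K. \<forall>x. norm (cmp i x) \<le> norm x * K" for i
    using bounded_linear.bounded[OF bounded_linear_comp] by blast
  then obtain K where K: "\<And>i x. norm (cmp i x) \<le> norm x * K i" by metis
  define L where "L = (\<Sum>i\<in>{1..k}. \<bar>K i\<bar>) + 1"
  have L: "L > 0" unfolding L_def by (intro add_nonneg_pos sum_nonneg) auto
  have main: "norm (dl r x) \<le> s * (L * norm x)" if r: "0 \<le> r" "0 \<le> s" "\<And>i. i \<in> {1..k} \<Longrightarrow> r ^ i \<le> s" for r s x
  proof -
    have "norm (dl r x) \<le> (\<Sum>i\<in>{1..k}. norm (r ^ i *\<^sub>R cmp i x))" unfolding dil_def by (rule norm_sum)
    also have "\<dots> \<le> (\<Sum>i\<in>{1..k}. s * (\<bar>K i\<bar> * norm x))"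
    proof (rule sum_mono)
      fix i assume i: "i \<in> {1..k}"
      have "norm (cmp i x) \<le> \<bar>K i\<bar> * norm x"
        using K[of i x] by (metis abs_ge_self mult.commute mult_left_mono norm_ge_zero order_trans)
      then show "norm (r ^ i *\<^sub>R cmp i x) \<le> s * (\<bar>K i\<bar> * norm x)"
        unfolding norm_scaleR using r(1,2) r(3)[OF i] by (intro mult_mono) auto
    qed
    also have "\<dots> = s * ((\<Sum>i\<in>{1..k}. \<bar>K i\<bar>) * norm x)" by (simp add: sum_distrib_left sum_distrib_right mult_ac)
    also have "\<dots> \<le> s * (L * norm x)" unfolding L_def using r(2) by (intro mult_left_mono mult_right_mono) auto
    finally show ?thesis .
  qed
  show thesis
  proof (rule that[OF L])
    show "norm (dl r x) \<le> r * (L * norm x)" if "0 \<le> r" "r \<le> 1" for r x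
    proof (rule main[OF that(1) that(1)])
      fix i assume "i \<in> {1..k}"
      then show "r ^ i \<le> r" using power_decreasing[of 1 i r] that by simp
    qed
    show "norm (dl r x) \<le> r ^ k * (L * norm x)" if "1 \<le> r" for r x
      by (rule main) (use that in \<open>auto intro: power_increasing\<close>)
  qed
qed

end

section \<open>Homogeneous distances compared with the norm\<close>

locale homogeneous_group = graded_algebra br V k
  for br :: "'a::real_normed_vector \<Rightarrow> 'a \<Rightarrow> 'a" and V k +
  fixes d :: "'a \<Rightarrow> 'a \<Rightarrow> real"
  assumes homog: "homog_dist br V k d"
begin

lemma d_eq_0: "d x y = 0 \<longleftrightarrow> x = y" and d_sym: "d x y = d y x" and d_tri: "d x z \<le> d x y + d y z"
  and cont_d: "continuous_on UNIV (\<lambda>p. d (fst p) (snd p))"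
  and d_left: "d (z \<odot> x) (z \<odot> y) = d x y" and d_dil: "r > 0 \<Longrightarrow> d (dl r x) (dl r y) = r * d x y"
  using homog unfolding homog_dist_def by (blast, blast, blast, blast, blast, blast)

lemma d_self [simp]: "d x x = 0"
  by (simp add: d_eq_0)

definition hn :: "'a \<Rightarrow> real" where "hn x = d x 0"

lemma d_nonneg: "0 \<le> d x y"
  using d_tri[of x x y] d_sym[of x y] d_eq_0[of x x] by simp

lemma continuous_on_d [continuous_intros]:
  assumes "continuous_on S f" "continuous_on S g" shows "continuous_on S (\<lambda>x. d (f x) (g x))"
  using continuous_on_compose2[OF cont_d continuous_on_Pair[OF assms]] by simp

lemma continuous_on_hn [continuous_intros]: "continuous_on S f \<Longrightarrow> continuous_on S (\<lambda>x. hn (f x))"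
  unfolding hn_def by (intro continuous_intros)

lemma d_hn: "d x y = hn ((- x) \<odot> y)"
  using d_left[of "- x" x y] by (simp add: hn_def d_sym)

lemma hn_nonneg [simp]: "0 \<le> hn x" and hn_0 [simp]: "hn 0 = 0" and hn_eq_0: "hn x = 0 \<longleftrightarrow> x = 0"
  by (auto simp: hn_def d_nonneg d_eq_0)

lemma hn_pos: "x \<noteq> 0 \<Longrightarrow> 0 < hn x"
  using hn_nonneg[of x] hn_eq_0[of x] by linarith

lemma hn_minus [simp]: "hn (- x) = hn x"
  using d_left[of x "- x" 0] by (simp add: hn_def d_sym)

lemma hn_mul: "hn (x \<odot> y) \<le> hn x + hn y"
  using d_tri[of "x \<odot> y" 0 x] d_left[of x y 0] by (simp add: hn_def)

lemma hn_dil: "r > 0 \<Longrightarrow> hn (dl r x) = r * hn x"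
  using d_dil[of r x 0] by (simp add: hn_def)

text \<open>On the unit sphere of the norm \<open>hn\<close> has a positive minimum c. A point
  outside the unit ball is contracted onto the sphere by some r, and \<open>hn x\<close> \<le> 1
  forces r \<ge> c, so it is the image of a point of the sphere under a dilation of bounded
  ratio.\<close>

lemma hn_bound_norm: obtains C where "C > 0" "\<And>x. hn x \<le> 1 \<Longrightarrow> norm x \<le> C"
proof -
  define S where "S = {x::'a. norm x = 1}"
  have S: "compact S"
    unfolding S_def by (rule fin_dim_compact[OF fd]) (auto simp: bounded_iff closed_Collect_eq continuous_intros)
  show thesis
  proof (cases "S = {}")
    case True
    have "x = 0" for x :: 'a
    proof (rule ccontr)
      assume "x \<noteq> 0" then have "(1 / norm x) *\<^sub>R x \<in> S" by (simp add: S_def)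
      with True show False by simp
    qed
    then have "norm x \<le> 1" for x :: 'a by (metis norm_zero zero_le_one)
    then show thesis using that[of 1] by simp
  next
    case False
    obtain x0 where x0: "x0 \<in> S" "\<And>x. x \<in> S \<Longrightarrow> hn x0 \<le> hn x"
      using continuous_attains_inf[OF S False continuous_on_hn[OF continuous_on_id]] by auto
    define c where "c = hn x0"
    have c: "c > 0" unfolding c_def using x0(1) by (intro hn_pos) (auto simp: S_def)
    define T where "T = (\<lambda>p. dl (fst p) (snd p)) ` ({0..1/c} \<times> S)"
    have "compact T" unfolding T_def
      by (intro compact_continuous_image compact_Times S compact_Icc continuous_intros)
    then obtain R where R: "\<And>x. x \<in> T \<Longrightarrow> norm x \<le> R"
      using compact_imp_bounded[of T] by (auto simp: bounded_iff)
    have "norm x \<le> max 1 R" if x: "hn x \<le> 1" for x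
    proof (cases "norm x \<le> 1")
      case False
      have "continuous_on {0..1} (\<lambda>r. norm (dl r x))" by (intro continuous_intros)
      then obtain r where r: "0 \<le> r" "r \<le> 1" "norm (dl r x) = 1"
        using IVT'[of "\<lambda>r. norm (dl r x)" 0 1 1] False by (auto simp: dil_0_left)
      have r0: "r > 0" using r by (cases "r = 0") (auto simp: dil_0_left)
      have "c \<le> r * hn x" using x0(2)[of "dl r x"] r hn_dil[OF r0] by (simp add: c_def S_def)
      also have "\<dots> \<le> r" using x r0 by (simp add: mult_left_le)
      finally have "1 / r \<le> 1 / c" using c r0 by (simp add: frac_le)
      then have "dl (1 / r) (dl r x) \<in> T"
        unfolding T_def using r r0 by (intro image_eqI[of _ _ "(1 / r, dl r x)"]) (auto simp: S_def)
      then show ?thesis using R r0 by fastforce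
    qed simp
    then show thesis using that[of "max 1 R"] by simp
  qed
qed

text \<open>After dilation to \<open>hn\<close> equal to 1 the norm is bounded; dilating back by
  \<open>hn x\<close> \<le> 1 shrinks the norm at least linearly.\<close>

lemma norm_le_hn: obtains C where "C > 0" "\<And>x. hn x \<le> 1 \<Longrightarrow> norm x \<le> C * hn x"
proof -
  obtain C where C: "C > 0" "\<And>x. hn x \<le> 1 \<Longrightarrow> norm x \<le> C" by (rule hn_bound_norm) blast
  obtain K where K: "K > 0" "\<And>r x. 0 \<le> r \<Longrightarrow> r \<le> 1 \<Longrightarrow> norm (dl r x) \<le> r * (K * norm x)" by (rule norm_dil_le) blast
  have "norm x \<le> (K * C) * hn x" if x: "hn x \<le> 1" for x
  proof (cases "x = 0")
    case False
    then have r: "hn x > 0" by (rule hn_pos)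
    define y where "y = dl (1 / hn x) x"
    have y: "norm y \<le> C" using r by (intro C(2)) (simp add: y_def hn_dil)
    have "norm x = norm (dl (hn x) y)" using r by (simp add: y_def)
    also have "\<dots> \<le> hn x * (K * norm y)" using r x by (intro K) auto
    also have "\<dots> \<le> hn x * (K * C)" using y r K(1) by (intro mult_left_mono) auto
    finally show ?thesis by (simp add: mult_ac)
  qed simp
  then show thesis using that[of "K * C"] K C by simp
qed

lemma hn_bounded: obtains C where "C > 0" "\<And>x. hn x \<le> R \<Longrightarrow> norm x \<le> C"
proof -
  obtain C where C: "C > 0" "\<And>x. hn x \<le> 1 \<Longrightarrow> norm x \<le> C" by (rule hn_bound_norm) blast
  obtain K where K: "K > 0" "\<And>r x. 1 \<le> r \<Longrightarrow> norm (dl r x) \<le> r ^ k * (K * norm x)" by (rule norm_dil_le) blast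
  define S where "S = max 1 R"
  have S: "S \<ge> 1" "S \<ge> R" by (auto simp: S_def)
  have "norm x \<le> S ^ k * (K * C)" if "hn x \<le> R" for x
  proof -
    have "norm (dl (1 / S) x) \<le> C" using S that by (intro C(2)) (simp add: hn_dil)
    moreover have "norm x \<le> S ^ k * (K * norm (dl (1 / S) x))" using K(2)[OF S(1), of "dl (1 / S) x"] S by simp
    moreover have "S ^ k * (K * norm (dl (1 / S) x)) \<le> S ^ k * (K * C)"
      using S K(1) \<open>norm (dl (1 / S) x) \<le> C\<close> by (intro mult_left_mono) auto
    ultimately show ?thesis by linarith
  qed
  then show thesis using that[of "S ^ k * (K * C)"] S K C by simp
qed

lemma compact_gball: "compact (gball d x R)"
proof (rule fin_dim_compact[OF fd])
  show "closed (gball d x R)" unfolding gball_def by (intro closed_Collect_le continuous_intros)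
  obtain C where "C > 0" "\<And>y. hn y \<le> hn x + R \<Longrightarrow> norm y \<le> C" by (rule hn_bounded) blast
  moreover have "hn y \<le> hn x + R" if "d x y \<le> R" for y
    using d_tri[of y 0 x] that by (simp add: hn_def d_sym[of y x])
  ultimately show "bounded (gball d x R)" by (auto simp: bounded_iff gball_def)
qed

lemma compact_hn_ball: "compact {x. hn x \<le> R}"
  using compact_gball[of 0 R] by (simp add: gball_def hn_def d_sym)

text \<open>Dilation by 1/r enlarges the norm by at most a constant times r^(-k). With r the k-th
  root of norm x / b the dilated point stays in a fixed ball, on which \<open>hn\<close> is bounded;
  b \<ge> B ensures r \<le> 1.\<close>

lemma hn_le_norm_powr: obtains C where "C > 0" "\<And>x. norm x \<le> B \<Longrightarrow> hn x \<le> C * norm x powr (1 / real k)"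
proof -
  obtain K where K: "K > 0" "\<And>r x. 1 \<le> r \<Longrightarrow> norm (dl r x) \<le> r ^ k * (K * norm x)" by (rule norm_dil_le) blast
  define b where "b = max B 1"
  have b: "b > 0" "b \<ge> B" by (auto simp: b_def)
  have "compact (cball (0::'a) (b * K))" by (rule fin_dim_compact[OF fd]) auto
  then have "compact (hn ` cball 0 (b * K))" by (intro compact_continuous_image continuous_intros)
  then obtain C where C: "\<And>y. norm y \<le> b * K \<Longrightarrow> hn y \<le> C"
    using compact_imp_bounded[of "hn ` cball 0 (b * K)"] by (fastforce simp: bounded_iff)
  have C0: "C \<ge> 0" using C[of 0] b K(1) by simp
  have "hn x \<le> ((C + 1) / b powr (1 / real k)) * norm x powr (1 / real k)" if x: "norm x \<le> B" for x
  proof (cases "x = 0")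
    case False
    define r where "r = (norm x / b) powr (1 / real k)"
    have q: "0 < norm x / b" "norm x / b \<le> 1" using False x b by auto
    have r: "0 < r" "r \<le> 1" unfolding r_def using q by (auto intro!: powr_le1)
    have rk: "r ^ k = norm x / b"
    proof -
      have "r ^ k = ((norm x / b) powr (1 / real k)) powr real k"
        using powr_realpow[OF r(1), of k] by (simp add: r_def)
      also have "\<dots> = (norm x / b) powr 1" using k1 by (simp only: powr_powr) simp
      finally show ?thesis using q b by simp
    qed
    have "norm (dl (1 / r) x) \<le> (1 / r) ^ k * (K * norm x)" using r by (intro K) auto
    also have "\<dots> = b * K" using rk q False by (simp add: power_divide)
    finally have "hn (dl (1 / r) x) \<le> C" by (rule C)
    then have "hn x \<le> C * r" using r by (simp add: hn_dil field_simps)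
    also have "\<dots> \<le> (C + 1) * r" using r by simp
    also have "\<dots> = ((C + 1) / b powr (1 / real k)) * norm x powr (1 / real k)"
      using b by (simp add: r_def powr_divide)
    finally show ?thesis .
  qed simp
  then show thesis using that[of "(C + 1) / b powr (1 / real k)"] b C0 by simp
qed

text \<open>Conjugation is not Lipschitz for \<open>hn\<close>; only this scale-invariant uniform continuity survives.\<close>

lemma hn_conj_small:
  assumes "\<epsilon> > 0"
  obtains \<eta> where "\<eta> > 0" "\<eta> \<le> 1"
    "\<And>\<tau> b q. \<tau> > 0 \<Longrightarrow> hn b \<le> K * \<tau> \<Longrightarrow> hn q \<le> \<eta> * \<tau> \<Longrightarrow> hn ((- b) \<odot> (q \<odot> b)) \<le> \<epsilon> * \<tau>"
proof -
  let ?f = "\<lambda>p. hn ((- fst p) \<odot> (snd p \<odot> fst p))"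
  let ?S = "{x. hn x \<le> K} \<times> {x. hn x \<le> 1}"
  have "uniformly_continuous_on ?S ?f"
    by (intro compact_uniformly_continuous compact_Times compact_hn_ball continuous_intros)
  then obtain \<delta> where \<delta>: "\<delta> > 0" "\<And>p p'. p \<in> ?S \<Longrightarrow> p' \<in> ?S \<Longrightarrow> dist p' p < \<delta> \<Longrightarrow> dist (?f p') (?f p) < \<epsilon>"
    using assms unfolding uniformly_continuous_on_def by meson
  obtain C where C: "C > 0" "\<And>x. hn x \<le> 1 \<Longrightarrow> norm x \<le> C * hn x" by (rule norm_le_hn) blast
  define \<eta> where "\<eta> = min 1 (\<delta> / (2 * C))"
  have \<eta>: "\<eta> > 0" "\<eta> \<le> 1" "C * \<eta> < \<delta>"
  proof -
    have "C * \<eta> \<le> C * (\<delta> / (2 * C))" unfolding \<eta>_def using C(1) by (intro mult_left_mono) auto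
    then show "C * \<eta> < \<delta>" using C \<delta> by simp
  qed (use C \<delta> in \<open>auto simp: \<eta>_def\<close>)
  have 1: "hn ((- b) \<odot> (q \<odot> b)) \<le> \<epsilon>" if b: "hn b \<le> K" and q: "hn q \<le> \<eta>" for b q
  proof -
    have "norm q \<le> C * hn q" using q \<eta> by (intro C) simp
    also have "\<dots> \<le> C * \<eta>" using q C by simp
    finally have "dist (b, q) (b, 0) < \<delta>" using \<eta> by (simp add: dist_Pair_Pair)
    then have "dist (?f (b, q)) (?f (b, 0)) < \<epsilon>" using b q \<eta> by (intro \<delta>) auto
    then show ?thesis by simp
  qed
  show thesis
  proof (rule that[OF \<eta>(1,2)])
    fix \<tau> b q assume h: "\<tau> > 0" "hn b \<le> K * \<tau>" "hn q \<le> \<eta> * \<tau>"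
    have "hn ((- dl (1 / \<tau>) b) \<odot> (dl (1 / \<tau>) q \<odot> dl (1 / \<tau>) b)) \<le> \<epsilon>"
      using h by (intro 1) (auto simp: hn_dil field_simps)
    then have "hn (dl (1 / \<tau>) ((- b) \<odot> (q \<odot> b))) \<le> \<epsilon>" by (simp add: dil_mul)
    then show "hn ((- b) \<odot> (q \<odot> b)) \<le> \<epsilon> * \<tau>" using h(1) by (simp add: hn_dil field_simps)
  qed
qed

lemma d_small_dist_small:
  assumes "e > 0"
  obtains \<delta> where "\<delta> > 0" "\<And>y. d x y < \<delta> \<Longrightarrow> dist y x < e"
proof -
  have "continuous_on UNIV (\<lambda>z. x \<odot> z)" by (intro continuous_intros)
  then obtain \<eta> where \<eta>: "\<eta> > 0" "\<And>z. dist z 0 < \<eta> \<Longrightarrow> dist (x \<odot> z) (x \<odot> 0) < e"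
    using assms unfolding continuous_on_iff by (metis UNIV_I)
  obtain C where C: "C > 0" "\<And>x. hn x \<le> 1 \<Longrightarrow> norm x \<le> C * hn x" by (rule norm_le_hn) blast
  show thesis
  proof (rule that[of "min 1 (\<eta> / C)"])
    show "min 1 (\<eta> / C) > 0" using \<eta> C by simp
    fix y assume y: "d x y < min 1 (\<eta> / C)"
    then have h: "hn ((- x) \<odot> y) < 1" "hn ((- x) \<odot> y) < \<eta> / C" by (auto simp: d_hn)
    then have "norm ((- x) \<odot> y) \<le> C * hn ((- x) \<odot> y)" by (intro C) simp
    also have "\<dots> < \<eta>" using h(2) C(1) by (simp add: field_simps)
    finally show "dist y x < e" using \<eta>(2)[of "(- x) \<odot> y"] by simp
  qed
qed

lemma dist_small_d_small:
  assumes "e > 0"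
  obtains \<delta> where "\<delta> > 0" "\<And>y. dist y x < \<delta> \<Longrightarrow> d x y < e"
proof -
  have "continuous_on UNIV (\<lambda>y. d x y)" by (intro continuous_intros)
  then obtain \<delta> where \<delta>: "\<delta> > 0" "\<And>y. dist y x < \<delta> \<Longrightarrow> dist (d x y) (d x x) < e"
    using assms unfolding continuous_on_iff by (metis UNIV_I)
  have "d x x = 0" by (simp add: d_eq_0)
  then show thesis using that[OF \<delta>(1)] \<delta>(2) d_nonneg by (simp add: dist_real_def)
qed

end

subsection \<open>Generation by horizontal elements\<close>

context homogeneous_group
begin

lemma dil_layer: "v \<in> layer V k m \<Longrightarrow> dl r v = r ^ m *\<^sub>R v"
  unfolding dil_multiplier by (rule multiplier_layer)

lemma V_layer: "i \<in> {1..k} \<Longrightarrow> layer V k i = V i"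
  by (simp add: layer_def)

lemma dil_V1: "v \<in> V 1 \<Longrightarrow> dl r v = r *\<^sub>R v"
  using dil_layer[of v 1 r] V_layer[of 1] k1 by simp

lemma hn_scale_V1: "v \<in> V 1 \<Longrightarrow> t \<ge> 0 \<Longrightarrow> hn (t *\<^sub>R v) = t * hn v"
  using hn_dil[of t v] dil_V1[of v t] by (cases "t = 0") auto

text \<open>Products of exactly n horizontal segments with durations at most \<tau>. Durations are
  nonnegative because the estimates along segments run forward in time; backward motion comes from
  directions closed under negation.\<close>

inductive hprod :: "'a set \<Rightarrow> real \<Rightarrow> nat \<Rightarrow> 'a \<Rightarrow> bool" for S \<tau> where
  hprod_0: "hprod S \<tau> 0 0"
| hprod_Suc: "v \<in> S \<Longrightarrow> 0 \<le> t \<Longrightarrow> t \<le> \<tau> \<Longrightarrow> hprod S \<tau> n x \<Longrightarrow> hprod S \<tau> (Suc n) ((t *\<^sub>R v) \<odot> x)"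

inductive_cases hprod_SucE: "hprod S \<tau> (Suc n) h"

lemma hprod_single: "v \<in> S \<Longrightarrow> 0 \<le> t \<Longrightarrow> t \<le> \<tau> \<Longrightarrow> hprod S \<tau> 1 (t *\<^sub>R v)"
  using hprod_Suc[OF _ _ _ hprod_0, of v S t \<tau>] by simp

lemma hprod_mul: "hprod S \<tau> n x \<Longrightarrow> hprod S \<tau> m y \<Longrightarrow> hprod S \<tau> (n + m) (x \<odot> y)"
  by (induction rule: hprod.induct) (auto simp: mul_assoc intro: hprod_Suc)

lemma hprod_mono: "hprod S \<tau> n x \<Longrightarrow> \<tau> \<le> \<tau>' \<Longrightarrow> hprod S \<tau>' n x"
  by (induction rule: hprod.induct) (auto intro: hprod.intros)

lemma hprod_minus:
  assumes "\<And>v. v \<in> S \<Longrightarrow> - v \<in> S" "hprod S \<tau> n x" shows "hprod S \<tau> n (- x)"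
  using assms(2)
proof (induction rule: hprod.induct)
  case (hprod_Suc v t n x)
  have "hprod S \<tau> 1 (t *\<^sub>R (- v))" using hprod_Suc assms(1) by (intro hprod_single) auto
  from hprod_mul[OF hprod_Suc.IH this] show ?case by (simp add: minus_mul)
qed (simp add: hprod_0)

lemma hn_hprod:
  assumes "S \<subseteq> V 1" "\<And>v. v \<in> S \<Longrightarrow> hn v \<le> M" "0 \<le> \<tau>" "hprod S \<tau> n x"
  shows "hn x \<le> real n * (\<tau> * M)"
  using assms(4)
proof (induction rule: hprod.induct)
  case (hprod_Suc v t n x)
  have "hn ((t *\<^sub>R v) \<odot> x) \<le> t * hn v + hn x"
    using hn_mul[of "t *\<^sub>R v" x] hn_scale_V1[of v t] hprod_Suc assms(1) by auto
  also have "t * hn v \<le> \<tau> * M" using hprod_Suc assms(2,3) by (intro mult_mono) auto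
  finally show ?case using hprod_Suc by (simp add: algebra_simps)
qed simp

text \<open>Both sides are homogeneous of degree i under dilations, which reduces the claim to
  \<open>hn\<close> equal to 1.\<close>

lemma comp_le_hn: obtains K where "K > 0" "\<And>i x. i \<in> {1..k} \<Longrightarrow> norm (cmp i x) \<le> K * hn x ^ i"
proof -
  obtain C where C: "C > 0" "\<And>x. hn x \<le> 1 \<Longrightarrow> norm x \<le> C" by (rule hn_bound_norm) blast
  have "\<exists>L>0. \<forall>x. norm (cmp i x) \<le> norm x * L" for i
    using bounded_linear.pos_bounded[OF bounded_linear_comp] by blast
  then obtain L where L: "\<And>i. L i > 0" "\<And>i x. norm (cmp i x) \<le> norm x * L i" by metis
  define K where "K = C * (\<Sum>i\<in>{1..k}. L i) + 1"
  have sL: "0 \<le> (\<Sum>i\<in>{1..k}. L i)" by (intro sum_nonneg) (simp add: L(1) less_imp_le)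
  have "norm (cmp i x) \<le> K * hn x ^ i" if i: "i \<in> {1..k}" for i x
  proof (cases "x = 0")
    case True then show ?thesis using i by (cases i) (auto simp: comp_simps)
  next
    case False
    then have r: "hn x > 0" by (rule hn_pos)
    define y where "y = dl (1 / hn x) x"
    have y: "norm y \<le> C" using r by (intro C(2)) (simp add: y_def hn_dil)
    have "norm (cmp i y) \<le> C * L i" using L(2)[of i y] mult_right_mono[OF y, of "L i"] L(1)[of i] by linarith
    also have "\<dots> \<le> C * (\<Sum>i\<in>{1..k}. L i)"
      using C(1) i L(1) by (intro mult_left_mono member_le_sum) (auto intro: less_imp_le)
    also have "\<dots> \<le> K" by (simp add: K_def)
    finally have cy: "norm (cmp i y) \<le> K" .
    have "cmp i x = cmp i (dl (hn x) y)" using r by (simp add: y_def)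
    also have "\<dots> = hn x ^ i *\<^sub>R cmp i y" by (rule comp_dil)
    finally have "norm (cmp i x) = hn x ^ i * norm (cmp i y)" using r by simp
    also have "\<dots> \<le> hn x ^ i * K" using cy r by (intro mult_left_mono) auto
    finally show ?thesis by (simp add: mult.commute)
  qed
  moreover have "K > 0" unfolding K_def using C sL by (intro add_nonneg_pos mult_nonneg_nonneg) auto
  ultimately show thesis using that by blast
qed

end

locale stratified_group = homogeneous_group br V k d for br :: "'a::real_normed_vector \<Rightarrow> 'a \<Rightarrow> 'a" and V k d +
  assumes strat: "\<And>i j. 1 \<le> i \<Longrightarrow> 1 \<le> j \<Longrightarrow> i + j \<le> k \<Longrightarrow> span {br x y | x y. x \<in> V i \<and> y \<in> V j} = V (i + j)"
begin

text \<open>Closure under negation compensates for the nonnegative durations in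
  \<open>hprod\<close>. Norm at most one is imposed because continuity of the differential is
  uniform on the unit ball.\<close>

lemma horizontal_basis: obtains S where "finite S" "S \<subseteq> V 1" "span S = V 1"
  "\<And>v. v \<in> S \<Longrightarrow> - v \<in> S" "\<And>v. v \<in> S \<Longrightarrow> norm v \<le> 1"
proof -
  obtain B0 :: "'a set" where B0: "finite B0" "span B0 = UNIV" using fd by (auto simp: fin_dim_space_def)
  have sV: "subspace (V 1)" using subspace_V[of 1] k1 by simp
  obtain B where B: "B \<subseteq> V 1" "independent B" "V 1 \<subseteq> span B"
    using maximal_independent_subset[of "V 1"] by metis
  have fB: "finite B" using independent_span_bound[OF B0(1) B(2)] B0(2) by auto
  define N where "N = (\<lambda>b::'a. (1 / norm b) *\<^sub>R b)"
  define S where "S = N ` B \<union> (\<lambda>b. - N b) ` B"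
  have SV: "S \<subseteq> V 1" unfolding S_def N_def
    using B(1) by (auto intro!: subspace_scale[OF sV[unfolded One_nat_def]] subspace_neg[OF sV[unfolded One_nat_def]])
  have "B \<subseteq> span S"
  proof
    fix b assume b: "b \<in> B"
    then have "norm b *\<^sub>R N b \<in> span S" unfolding S_def by (intro span_scale span_base) auto
    then show "b \<in> span S" by (simp add: N_def split: if_splits)
  qed
  then have "V 1 \<subseteq> span S" using B(3) span_mono[of B "span S"] by (metis span_span subset_trans)
  moreover have "span S \<subseteq> V 1" using SV by (intro span_minimal sV)
  ultimately have "span S = V 1" by simp
  moreover have "finite S" using fB by (simp add: S_def)
  moreover have "norm v \<le> 1" if "v \<in> S" for v using that by (auto simp: S_def N_def)
  moreover have "- v \<in> S" if "v \<in> S" for v using that by (auto simp: S_def)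
  ultimately show thesis using that SV by blast
qed

text \<open>Index i stands for brackets of Suc i generators, so \<open>brackets S i\<close> belongs
  to the layer \<open>V (Suc i)\<close>.\<close>

primrec brackets :: "'a set \<Rightarrow> nat \<Rightarrow> 'a set" where
  "brackets S 0 = S"
| "brackets S (Suc i) = {br s z | s z. s \<in> S \<and> z \<in> brackets S i}"

lemma finite_brackets: "finite S \<Longrightarrow> finite (brackets S i)"
proof (induction i)
  case (Suc i)
  have "brackets S (Suc i) = (\<lambda>(s, z). br s z) ` (S \<times> brackets S i)" by auto
  then show ?case using Suc by simp
qed simp

lemma minus_brackets: "(\<And>v. v \<in> S \<Longrightarrow> - v \<in> S) \<Longrightarrow> z \<in> brackets S i \<Longrightarrow> - z \<in> brackets S i"
proof (induction i arbitrary: z)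
  case (Suc i)
  then obtain s z' where z: "z = br s z'" "s \<in> S" "z' \<in> brackets S i" by auto
  then have "- z = br s (- z')" by (simp add: br_simps)
  then show ?case using z Suc by auto
qed simp

lemma span_brackets:
  assumes S: "span S = V 1" shows "i < k \<Longrightarrow> span (brackets S i) = V (Suc i)"
proof (induction i)
  case 0 then show ?case using S by simp
next
  case (Suc i)
  have IH: "span (brackets S i) = V (Suc i)" using Suc by simp
  have st: "span {br x y | x y. x \<in> V 1 \<and> y \<in> V (Suc i)} = V (Suc (Suc i))"
    using strat[of 1 "Suc i"] Suc.prems by simp
  have "{br x y | x y. x \<in> V 1 \<and> y \<in> V (Suc i)} \<subseteq> span (brackets S (Suc i))"
  proof clarify
    fix x y assume x: "x \<in> V 1" and y: "y \<in> V (Suc i)"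
    have x': "x \<in> span S" and y': "y \<in> span (brackets S i)" using x y S IH by auto
    have "linear (br s)" "linear (\<lambda>x. br x y)" for s y using bilinear_br by (auto simp: bilinear_def)
    note lin = this
    have 1: "br s y \<in> span (brackets S (Suc i))" if s: "s \<in> S" for s
    proof -
      have "br s y \<in> br s ` span (brackets S i)" using y' by blast
      also have "\<dots> = span (br s ` brackets S i)" by (rule linear_span_image[OF lin(1), symmetric])
      also have "\<dots> \<subseteq> span (brackets S (Suc i))" using s by (intro span_mono) auto
      finally show ?thesis .
    qed
    have "br x y \<in> (\<lambda>x. br x y) ` span S" using x' by blast
    also have "\<dots> = span ((\<lambda>x. br x y) ` S)" by (rule linear_span_image[OF lin(2), symmetric])
    also have "\<dots> \<subseteq> span (brackets S (Suc i))" using 1 by (intro span_minimal) auto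
    finally show "br x y \<in> span (brackets S (Suc i))" .
  qed
  then have "V (Suc (Suc i)) \<subseteq> span (brackets S (Suc i))"
    unfolding st[symmetric] by (intro span_minimal) auto
  moreover have "brackets S (Suc i) \<subseteq> V (Suc (Suc i))"
  proof -
    have "brackets S i \<subseteq> V (Suc i)" "S \<subseteq> V 1" using IH S span_superset by blast+
    then have "brackets S (Suc i) \<subseteq> {br x y | x y. x \<in> V 1 \<and> y \<in> V (Suc i)}" by auto
    also have "\<dots> \<subseteq> V (Suc (Suc i))" unfolding st[symmetric] by (rule span_superset)
    finally show ?thesis .
  qed
  then have "span (brackets S (Suc i)) \<subseteq> V (Suc (Suc i))"
    using subspace_V[of "Suc (Suc i)"] Suc.prems by (intro span_minimal) auto
  ultimately show ?case by simp
qed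

text \<open>The vector \<open>z\<close> is the leading term of a horizontal product. By
  \<open>mul_leading\<close> such leading terms add when the products are multiplied.\<close>

definition realizes :: "'a set \<Rightarrow> real \<Rightarrow> nat \<Rightarrow> nat \<Rightarrow> 'a \<Rightarrow> bool" where
  "realizes S \<tau> n i z \<longleftrightarrow> (\<exists>w. hprod S \<tau> n w \<and> w \<in> Vge i \<and> w - z \<in> Vge (Suc i))"

lemma realizes_add:
  assumes i: "i \<ge> 1" and x: "realizes S \<tau> n i x" and y: "realizes S \<tau> m i y"
  shows "realizes S \<tau> (n + m) i (x + y)"
proof -
  obtain u where u: "hprod S \<tau> n u" "u \<in> Vge i" "u - x \<in> Vge (Suc i)" using x by (auto simp: realizes_def)
  obtain v where v: "hprod S \<tau> m v" "v \<in> Vge i" "v - y \<in> Vge (Suc i)" using y by (auto simp: realizes_def)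
  have uv: "u \<odot> v - (u + v) \<in> Vge (Suc i)" by (rule mul_leading[OF i u(2) v(2)])
  from subspace_add[OF subspace_Vge Vge_anti[OF uv] subspace_add[OF subspace_Vge u(2) v(2)]]
  have "u \<odot> v \<in> Vge i" by simp
  moreover have "(u \<odot> v - (u + v)) + ((u - x) + (v - y)) \<in> Vge (Suc i)"
    by (intro subspace_add[OF subspace_Vge] uv u v)
  then have "u \<odot> v - (x + y) \<in> Vge (Suc i)" by (simp add: algebra_simps)
  ultimately show ?thesis using hprod_mul[OF u(1) v(1)] by (auto simp: realizes_def)
qed

lemma realizes_sum:
  assumes "i \<ge> 1" "\<And>a. a \<in> A \<Longrightarrow> realizes S \<tau> (n a) i (x a)"
  shows "realizes S \<tau> (\<Sum>a\<in>A. n a) i (\<Sum>a\<in>A. x a)"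
  using assms(2)
proof (induction A rule: infinite_finite_induct)
  case (insert a A)
  then show ?case using realizes_add[OF assms(1)] by simp
qed (auto simp: realizes_def intro!: exI[of _ 0] hprod_0 subspace_0[OF subspace_Vge])

lemma realizes_mono: "realizes S \<tau> n i z \<Longrightarrow> \<tau> \<le> \<tau>' \<Longrightarrow> realizes S \<tau>' n i z"
  unfolding realizes_def using hprod_mono by blast

text \<open>The witness is the iterated group commutator corresponding to the iterated bracket \<open>z\<close>.\<close>

lemma realizes_brackets:
  assumes S: "span S = V 1" "\<And>v. v \<in> S \<Longrightarrow> - v \<in> S" and z: "z \<in> brackets S i"
  shows "\<exists>n. \<forall>t\<ge>0. realizes S t n (Suc i) (t ^ Suc i *\<^sub>R z)"
  using z
proof (induction i arbitrary: z)
  case 0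
  then have "realizes S t 1 1 (t *\<^sub>R z)" if "t \<ge> 0" for t
    unfolding realizes_def using that hprod_single[of z S t t]
    by (intro exI[of _ "t *\<^sub>R z"]) (auto simp: Vge_1 subspace_0[OF subspace_Vge])
  then show ?case by auto
next
  case (Suc i)
  then obtain s z' where z: "z = br s z'" "s \<in> S" "z' \<in> brackets S i" by auto
  obtain n where n: "\<And>t. t \<ge> 0 \<Longrightarrow> realizes S t n (Suc i) (t ^ Suc i *\<^sub>R z')"
    using Suc.IH[OF z(3)] by auto
  have "realizes S t ((1 + n) + (1 + n)) (Suc (Suc i)) (t ^ Suc (Suc i) *\<^sub>R z)" if t: "t \<ge> 0" for t
  proof -
    obtain w where w: "hprod S t n w" "w \<in> Vge (Suc i)" "w - t ^ Suc i *\<^sub>R z' \<in> Vge (Suc (Suc i))"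
      using n[OF t] by (auto simp: realizes_def)
    define c where "c = commutator (t *\<^sub>R s) w"
    have s: "hprod S t 1 (t *\<^sub>R s)" using z(2) t by (intro hprod_single) auto
    have c: "c = ((t *\<^sub>R s) \<odot> w) \<odot> ((- (t *\<^sub>R s)) \<odot> (- w))"
      by (simp add: c_def commutator_def minus_mul)
    have 1: "hprod S t ((1 + n) + (1 + n)) c"
      unfolding c by (intro hprod_mul hprod_minus[OF S(2)] s w)
    have "t *\<^sub>R s \<in> Vge 1" by (simp add: Vge_1)
    note tb = br_Vge[OF this] and commutator_leading[OF _ _ this w(2)]
    then have 2: "c - br (t *\<^sub>R s) w \<in> Vge (Suc (Suc (Suc i)))" by (simp add: c_def)
    have 3: "br (t *\<^sub>R s) (w - t ^ Suc i *\<^sub>R z') \<in> Vge (Suc (Suc (Suc i)))" using tb[OF w(3)] by simp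
    have "br (t *\<^sub>R s) w \<in> Vge (Suc (Suc i))" using tb[OF w(2)] by simp
    with subspace_add[OF subspace_Vge Vge_anti[OF 2] this] have "c \<in> Vge (Suc (Suc i))" by simp
    moreover have "c - t ^ Suc (Suc i) *\<^sub>R z \<in> Vge (Suc (Suc (Suc i)))"
      using subspace_add[OF subspace_Vge 2 3] by (simp add: z br_simps algebra_simps)
    ultimately show ?thesis using 1 by (auto simp: realizes_def)
  qed
  then show ?case by blast
qed

text \<open>A multiple c of a bracket of Suc i generators is realized with durations equal to the
  root of |c| of order Suc i. Since the coefficients are bounded by the norm, these durations are
  comparable to \<tau>.\<close>

lemma realizes_layer:
  assumes S: "finite S" "span S = V 1" "\<And>v. v \<in> S \<Longrightarrow> - v \<in> S" and i: "i < k"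
  obtains n C where "C > 0"
    "\<forall>x\<in>V (Suc i). \<forall>\<tau>\<ge>0. norm x \<le> \<tau> ^ Suc i \<longrightarrow> realizes S (C * \<tau>) n (Suc i) x"
proof -
  let ?B = "brackets S i"
  obtain K where K: "K > 0" "\<And>x. x \<in> span ?B \<Longrightarrow> \<exists>c. x = (\<Sum>b\<in>?B. c b *\<^sub>R b) \<and> (\<forall>b\<in>?B. \<bar>c b\<bar> \<le> K * norm x)"
    using finite_brackets[OF S(1)] by (rule span_coefficients_bounded) blast
  have "\<exists>n. \<forall>t\<ge>0. realizes S t n (Suc i) (t ^ Suc i *\<^sub>R z)" if "z \<in> ?B" for z
    by (rule realizes_brackets[OF S(2,3) that])
  then obtain n where n: "\<And>z t. z \<in> ?B \<Longrightarrow> t \<ge> 0 \<Longrightarrow> realizes S t (n z) (Suc i) (t ^ Suc i *\<^sub>R z)"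
    by metis
  define C where "C = max 1 K"
  have C: "C \<ge> 1" "C \<ge> K" by (auto simp: C_def)
  have step: "realizes S (C * \<tau>) (n b + n (- b)) (Suc i) (c *\<^sub>R b)"
    if b: "b \<in> ?B" and \<tau>: "\<tau> \<ge> 0" and c: "\<bar>c\<bar> \<le> K * \<tau> ^ Suc i" for b \<tau> c
  proof -
    have rt: "realizes S (C * \<tau>) (n z) (Suc i) (a *\<^sub>R z)" if a: "0 \<le> a" "a \<le> K * \<tau> ^ Suc i" and z: "z \<in> ?B" for a z
    proof -
      define p where "p = root (Suc i) a"
      have p: "p \<ge> 0" "p ^ Suc i = a" using a(1) by (auto simp: p_def simp del: power_Suc)
      have "K * \<tau> ^ Suc i \<le> C ^ Suc i * \<tau> ^ Suc i"
        using \<tau> by (intro mult_right_mono order_trans[OF C(2) self_le_power[OF C(1)]]) auto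
      then have "p ^ Suc i \<le> (C * \<tau>) ^ Suc i" using a(2) by (simp only: p power_mult_distrib)
      then have "p \<le> C * \<tau>" using C \<tau> by (auto intro: power_le_imp_le_base)
      then show ?thesis using realizes_mono[OF n[OF z p(1)]] by (simp only: p)
    qed
    \<comment> \<open>Both \<open>b\<close> and \<open>- b\<close> receive factors, one of them with
      coefficient 0, so that the number of factors does not depend on the sign of c.\<close>
    have "realizes S (C * \<tau>) (n b + n (- b)) (Suc i) (max c 0 *\<^sub>R b + max (- c) 0 *\<^sub>R (- b))"
      using b c minus_brackets[OF S(3)] K(1) \<tau> by (intro realizes_add rt) auto
    moreover have "max c 0 *\<^sub>R b + max (- c) 0 *\<^sub>R (- b) = c *\<^sub>R b" by (auto simp: max_def)
    ultimately show ?thesis by simp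
  qed
  show thesis
  proof (rule that[of C "\<Sum>b\<in>?B. n b + n (- b)"], goal_cases)
    case 2
    show ?case
    proof (intro ballI allI impI)
      fix x and \<tau> :: real assume x: "x \<in> V (Suc i)" and \<tau>: "\<tau> \<ge> 0" and nx: "norm x \<le> \<tau> ^ Suc i"
      obtain c where c: "x = (\<Sum>b\<in>?B. c b *\<^sub>R b)" "\<And>b. b \<in> ?B \<Longrightarrow> \<bar>c b\<bar> \<le> K * norm x"
        using K(2)[of x] x span_brackets[OF S(2) i] by auto
      have "K * norm x \<le> K * \<tau> ^ Suc i" using nx K(1) by simp
      then show "realizes S (C * \<tau>) (\<Sum>b\<in>?B. n b + n (- b)) (Suc i) x"
        using c \<tau> by (subst c(1)) (intro realizes_sum step; force)
    qed
  qed (use C in simp)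
qed

text \<open>Induction from the top layer downwards. A horizontal product y matches the lowest
  component of x; the remainder has higher degree and size comparable to x, so the induction
  hypothesis applies to it.\<close>

theorem horizontal_generation:
  obtains S n C where "finite S" "S \<subseteq> V 1" "\<And>v. v \<in> S \<Longrightarrow> norm v \<le> 1" "C > 0" "\<And>x. hprod S (C * hn x) n x"
proof -
  obtain S where S: "finite S" "S \<subseteq> V 1" "span S = V 1"
    "\<And>v. v \<in> S \<Longrightarrow> - v \<in> S" "\<And>v. v \<in> S \<Longrightarrow> norm v \<le> 1" by (rule horizontal_basis) blast
  define M where "M = (\<Sum>v\<in>S. hn v) + 1"
  have M: "hn v \<le> M" if "v \<in> S" for v
    using member_le_sum[OF that _ S(1), of hn] by (simp add: M_def)
  have M0: "M > 0" unfolding M_def by (intro add_nonneg_pos sum_nonneg) auto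
  obtain K where K: "K > 0" "\<And>i x. i \<in> {1..k} \<Longrightarrow> norm (cmp i x) \<le> K * hn x ^ i" by (rule comp_le_hn) blast
  define L where "L = max 1 K"
  have L: "L \<ge> 1" "L \<ge> K" by (auto simp: L_def)
  have "\<exists>n C. C > 0 \<and> (\<forall>x\<in>Vge (Suc (k - j)). hprod S (C * hn x) n x)" if "j \<le> k" for j
    using that
  proof (induction j)
    case 0
    then show ?case by (intro exI[of _ 0] exI[of _ 1]) (auto simp: Vge_top hprod_0)
  next
    case (Suc j)
    then obtain n C where C: "C > 0" "\<And>x. x \<in> Vge (Suc (k - j)) \<Longrightarrow> hprod S (C * hn x) n x" by auto
    define i where "i = k - Suc j"
    have i: "i < k" "k - j = Suc i" using Suc.prems by (auto simp: i_def)
    obtain m D where D: "D > 0" "\<forall>x\<in>V (Suc i). \<forall>\<tau>\<ge>0. norm x \<le> \<tau> ^ Suc i \<longrightarrow> realizes S (D * \<tau>) m (Suc i) x"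
      by (rule realizes_layer[OF S(1,3,4) i(1)])
    \<comment> \<open>The first summand is the duration needed for y, the second that for the
      remainder z, whose size is at most (m D L M + 1) \<open>hn x\<close>.\<close>
    define E where "E = D * L + C * (real m * (D * L * M) + 1)"
    have E: "E > 0" "D * L \<le> E" "C * (real m * (D * L * M) + 1) \<le> E"
      using D L C M0 by (auto simp: E_def intro!: add_pos_nonneg mult_nonneg_nonneg add_nonneg_nonneg)
    have "hprod S (E * hn x) (m + n) x" if x: "x \<in> Vge (Suc i)" for x
    proof -
      have si: "Suc i \<in> {1..k}" using i by simp
      have "norm (cmp (Suc i) x) \<le> K * hn x ^ Suc i" by (rule K(2)[OF si])
      also have "\<dots> \<le> L ^ Suc i * hn x ^ Suc i"
        by (intro mult_right_mono order_trans[OF L(2) self_le_power[OF L(1)]]) auto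
      finally have "norm (cmp (Suc i) x) \<le> (L * hn x) ^ Suc i" by (simp only: power_mult_distrib)
      then obtain y where y: "hprod S (D * (L * hn x)) m y" "y \<in> Vge (Suc i)" "y - cmp (Suc i) x \<in> Vge (Suc (Suc i))"
        using D(2)[rule_format, OF comp_in[OF si], of "L * hn x" x] L by (auto simp: realizes_def)
      have xc: "x - cmp (Suc i) x \<in> Vge (Suc (Suc i))"
        unfolding Vge_def
      proof (intro CollectI allI impI)
        fix j assume "j < Suc (Suc i)"
        then show "cmp j (x - cmp (Suc i) x) = 0"
          using x by (cases "j = Suc i") (auto simp: Vge_def comp_simps comp_layer[OF comp_in_layer])
      qed
      have my: "- y \<in> Vge (Suc i)" by (rule subspace_neg[OF subspace_Vge y(2)])
      define z where "z = (- y) \<odot> x"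
      have "z = (z - (- y + x)) + ((x - cmp (Suc i) x) - (y - cmp (Suc i) x))" by simp
      also have "\<dots> \<in> Vge (Suc (Suc i))" unfolding z_def
        by (intro subspace_add[OF subspace_Vge] subspace_diff[OF subspace_Vge] xc y mul_leading[OF _ my x]) simp
      finally have "z \<in> Vge (Suc (k - j))" using i by simp
      then have hz: "hprod S (C * hn z) n z" by (rule C(2))
      have "hn y \<le> real m * (D * (L * hn x) * M)"
        by (rule hn_hprod[OF S(2) M _ y(1)]) (use D L in auto)
      then have "hn z \<le> (real m * (D * L * M) + 1) * hn x"
        using hn_mul[of "- y" x] by (simp add: z_def algebra_simps)
      then have "C * hn z \<le> C * (real m * (D * L * M) + 1) * hn x" using C(1) by (simp add: mult.assoc)
      also have "\<dots> \<le> E * hn x" by (intro mult_right_mono E) simp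
      finally have "hprod S (E * hn x) n z" by (rule hprod_mono[OF hz])
      moreover have "hprod S (E * hn x) m y"
        using mult_right_mono[OF E(2), of "hn x"] by (intro hprod_mono[OF y(1)]) (simp add: mult.assoc)
      ultimately have "hprod S (E * hn x) (m + n) (y \<odot> z)" by (intro hprod_mul)
      then show ?thesis by (simp add: z_def)
    qed
    then show ?case using E(1) i by (auto simp: i_def[symmetric] intro!: exI[of _ "m + n"] exI[of _ E])
  qed
  from this[of k] obtain n C where "C > 0" "\<And>x. hprod S (C * hn x) n x" by (auto simp: Vge_1)
  then show thesis using that S by blast
qed

end

subsection \<open>Horizontal curves\<close>

text \<open>Gronwall's inequality from one-sided increments. The admissible step may depend on
  \<sigma>, so the proof takes the last time at which \<open>g\<close> lies below a supersolution
  and shows that it is T.\<close>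

lemma dini_gronwall:
  fixes g :: "real \<Rightarrow> real"
  assumes T: "0 \<le> T" and cont: "continuous_on {0..T} g" and g0: "g 0 \<le> 0" and A: "0 \<le> A" and B: "0 \<le> B"
    and step: "\<And>\<sigma> e. 0 \<le> \<sigma> \<Longrightarrow> \<sigma> < T \<Longrightarrow> e > 0 \<Longrightarrow>
      \<exists>\<delta>>0. \<forall>s. 0 < s \<longrightarrow> s < \<delta> \<longrightarrow> \<sigma> + s \<le> T \<longrightarrow> g (\<sigma> + s) \<le> g \<sigma> + s * (A * g \<sigma> + B) + e * s"
  shows "g T \<le> B * (T * exp (A * T))"
proof -
  have main: "g T \<le> (B + e) * (T * exp (A * T))" if e: "e > 0" for e
  proof -
    \<comment> \<open>The extra e in the slope absorbs the error e * s of the hypothesis; it tends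
      to 0 at the end.\<close>
    define u where "u \<sigma> = (B + e) * (\<sigma> * exp (A * \<sigma>))" for \<sigma>
    have u_step: "u \<sigma> + s * (A * u \<sigma> + B) + e * s \<le> u (\<sigma> + s)" if "\<sigma> \<ge> 0" "s > 0" for \<sigma> s
    proof -
      have 1: "1 + A * s \<le> exp (A * s)" by (rule exp_ge_add_one_self)
      have 2: "1 \<le> exp (A * \<sigma>)" using A that by simp
      have "u \<sigma> + s * (A * u \<sigma> + B) + e * s = (B + e) * (exp (A * \<sigma>) * \<sigma> * (1 + A * s) + s * 1 * 1)"
        by (simp add: u_def algebra_simps)
      also have "\<dots> \<le> (B + e) * (exp (A * \<sigma>) * \<sigma> * exp (A * s) + s * exp (A * \<sigma>) * exp (A * s))"
        using B e A that 1 2 by (intro mult_left_mono add_mono mult_mono) auto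
      also have "\<dots> = u (\<sigma> + s)" by (simp add: u_def distrib_left distrib_right exp_add algebra_simps)
      finally show ?thesis .
    qed
    define S where "S = {\<sigma>\<in>{0..T}. g \<sigma> \<le> u \<sigma>}"
    have "continuous_on {0..T} (\<lambda>\<sigma>. g \<sigma> - u \<sigma>)" unfolding u_def by (intro continuous_intros cont)
    then have "closed ({0..T} \<inter> (\<lambda>\<sigma>. g \<sigma> - u \<sigma>) -` {..0})"
      by (rule continuous_closed_preimage) auto
    moreover have "{0..T} \<inter> (\<lambda>\<sigma>. g \<sigma> - u \<sigma>) -` {..0} = S" by (auto simp: S_def)
    ultimately have "closed S" by (simp only:)
    then have "compact ({0..T} \<inter> S)" by (rule compact_Int_closed[OF compact_Icc])
    moreover have "{0..T} \<inter> S = S" by (auto simp: S_def)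
    ultimately have "compact S" by (simp only:)
    moreover have "0 \<in> S" using g0 T by (simp add: S_def u_def)
    ultimately obtain m where m: "m \<in> S" "\<And>\<sigma>. \<sigma> \<in> S \<Longrightarrow> \<sigma> \<le> m"
      using compact_attains_sup[of S] by auto
    have "m = T"
    proof (rule ccontr)
      assume "m \<noteq> T"
      then have mT: "0 \<le> m" "m < T" "g m \<le> u m" using m(1) by (auto simp: S_def)
      obtain \<delta> where \<delta>: "\<delta> > 0" "\<forall>s. 0 < s \<longrightarrow> s < \<delta> \<longrightarrow> m + s \<le> T \<longrightarrow> g (m + s) \<le> g m + s * (A * g m + B) + e * s"
        using step[OF mT(1,2) e] by blast
      define s where "s = min (\<delta> / 2) (T - m)"
      have s: "0 < s" "s < \<delta>" "m + s \<le> T" using \<delta>(1) mT by (auto simp: s_def)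
      have "g (m + s) \<le> g m + s * (A * g m + B) + e * s" using \<delta>(2) s by blast
      also have "\<dots> \<le> u m + s * (A * u m + B) + e * s"
        using mT s A e by (intro add_mono mult_left_mono) auto
      also have "\<dots> \<le> u (m + s)" by (rule u_step) (use mT s in auto)
      finally have "m + s \<in> S" using s mT by (auto simp: S_def)
      then show False using m(2) s(1) by fastforce
    qed
    then show ?thesis using m(1) by (simp add: S_def u_def)
  qed
  define X where "X = T * exp (A * T)"
  have X: "X \<ge> 0" using T by (simp add: X_def)
  have "g T \<le> B * X + e" if e: "e > 0" for e
  proof -
    have "g T \<le> (B + e / (X + 1)) * X" unfolding X_def by (rule main) (use e X in \<open>auto simp: X_def[symmetric]\<close>)
    also have "\<dots> = B * X + e * (X / (X + 1))" by (simp add: algebra_simps)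
    also have "\<dots> \<le> B * X + e * 1" using X e by (intro add_left_mono mult_left_mono) auto
    finally show ?thesis by simp
  qed
  then show ?thesis unfolding X_def[symmetric] by (rule field_le_epsilon)
qed

context homogeneous_group
begin

text \<open>Since \<open>hn\<close> is not compatible with Gronwall estimates, the deviation is measured in the norm of the
  algebra; this costs nothing on the unit time scale, to which a short segment is brought by a dilation.\<close>

lemma curve_estimate:
  assumes \<epsilon>: "\<epsilon> > 0"
  obtains \<eta> where "\<eta> > 0"
    "\<And>\<Gamma> w w0. \<Gamma> 0 = 0 \<Longrightarrow> continuous_on {0..1} \<Gamma> \<Longrightarrow> w0 \<in> V 1 \<Longrightarrow> norm w0 \<le> K \<Longrightarrow>
      (\<And>\<sigma>. 0 \<le> \<sigma> \<Longrightarrow> \<sigma> < 1 \<Longrightarrow> w \<sigma> \<in> V 1 \<and> norm (w \<sigma> - w0) \<le> \<eta>) \<Longrightarrow>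
      (\<And>\<sigma> e. 0 \<le> \<sigma> \<Longrightarrow> \<sigma> < 1 \<Longrightarrow> e > 0 \<Longrightarrow>
         \<exists>\<delta>>0. \<forall>s. 0 < s \<longrightarrow> s < \<delta> \<longrightarrow> \<sigma> + s \<le> 1 \<longrightarrow> d ((- \<Gamma> \<sigma>) \<odot> \<Gamma> (\<sigma> + s)) (s *\<^sub>R w \<sigma>) \<le> e * s) \<Longrightarrow>
      d w0 (\<Gamma> 1) \<le> \<epsilon>"
proof -
  have "compact (cball (0::'a) (K + 1))" by (rule fin_dim_compact[OF fd]) auto
  then have cball: "compact (cball (0::'a) (K + 1))" .
  then have "compact (hn ` cball 0 (K + 1))" by (intro compact_continuous_image continuous_intros)
  then obtain K0 where K0: "\<And>v. norm v \<le> K + 1 \<Longrightarrow> hn v \<le> K0"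
    using compact_imp_bounded[of "hn ` cball 0 (K + 1)"] by (fastforce simp: bounded_iff)
  define K1 where "K1 = max K0 0"
  have K1: "K1 \<ge> 0" "\<And>v. norm v \<le> K + 1 \<Longrightarrow> hn v \<le> K1" using K0 by (auto simp: K1_def intro: max.coboundedI1)
  obtain R where R: "R > 0" "\<And>x. hn x \<le> K1 + 1 \<Longrightarrow> norm x \<le> R" by (rule hn_bounded) blast
  obtain C3 where C3: "C3 > 0" "\<And>x. hn x \<le> 1 \<Longrightarrow> norm x \<le> C3 * hn x" by (rule norm_le_hn) blast
  define B where "B = max (max R C3) (\<bar>K\<bar> + 1)"
  have B: "R \<le> B" "C3 \<le> B" "K + 1 \<le> B" "0 \<le> B" using R(1) by (auto simp: B_def)
  obtain C0 where C0: "C0 \<ge> 0"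
    "\<And>x x' y y'. norm x \<le> B \<Longrightarrow> norm x' \<le> B \<Longrightarrow> norm y \<le> B \<Longrightarrow> norm y' \<le> B \<Longrightarrow>
       norm (x \<odot> y - x' \<odot> y') \<le> C0 * (norm (x - x') + norm (y - y'))"
    "\<And>x x' y. norm x \<le> B \<Longrightarrow> norm x' \<le> B \<Longrightarrow> norm y \<le> B \<Longrightarrow>
       norm ((x \<odot> y - x) - (x' \<odot> y - x')) \<le> C0 * norm (x - x') * norm y"
    by (rule mul_lipschitz[of B]) blast
  define C where "C = C0 + 1"
  have C: "C > 0" "C0 \<le> C" using C0(1) by (auto simp: C_def)
  have lip: "norm (x \<odot> y - x \<odot> y') \<le> C * norm (y - y')" if "norm x \<le> B" "norm y \<le> B" "norm y' \<le> B" for x y y'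
    using order_trans[OF C0(2)[OF that(1) that(1) that(2,3)]] C(2) by (simp add: mult_right_mono)
  have mix: "norm ((x \<odot> y - x) - (x' \<odot> y - x')) \<le> C * norm (x - x') * norm y" if "norm x \<le> B" "norm x' \<le> B" "norm y \<le> B" for x x' y
    using order_trans[OF C0(3)[OF that]] C(2) by (simp add: mult_right_mono)
  \<comment> \<open>This converts the final deviation from the norm into \<open>d\<close>, uniformly
    over all admissible \<open>w0\<close>.\<close>
  have "uniformly_continuous_on (cball 0 (K + 1) \<times> cball (0::'a) (K + 1)) (\<lambda>p. d (fst p) (snd p))"
    by (intro compact_uniformly_continuous compact_Times cball continuous_intros)
  then obtain \<delta>1 where \<delta>1: "\<delta>1 > 0" "\<And>p p'. p \<in> cball 0 (K + 1) \<times> cball (0::'a) (K + 1) \<Longrightarrow> p' \<in> cball 0 (K + 1) \<times> cball (0::'a) (K + 1) \<Longrightarrow>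
      dist p' p < \<delta>1 \<Longrightarrow> dist (d (fst p') (snd p')) (d (fst p) (snd p)) < \<epsilon>"
    using \<epsilon> unfolding uniformly_continuous_on_def by meson
  define A where "A = C * (\<bar>K\<bar> + 1)"
  have A: "A \<ge> 0" "C * (K + 1) \<le> A" using C by (auto simp: A_def)
  define \<mu> where "\<mu> = min 1 (\<delta>1 / 2)"
  have \<mu>: "\<mu> > 0" "\<mu> < \<delta>1" "\<mu> \<le> 1" using \<delta>1 by (auto simp: \<mu>_def)
  \<comment> \<open>Gronwall on the unit interval turns a velocity error \<eta> into a deviation of
    at most C * \<eta> * exp A, which is to stay below \<mu>.\<close>
  define \<eta> where "\<eta> = min 1 (\<mu> / (C * exp A))"
  have \<eta>: "\<eta> > 0" "\<eta> \<le> 1" using \<mu> C by (auto simp: \<eta>_def)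
  have \<eta>2: "C * \<eta> * exp A \<le> \<mu>"
  proof -
    have "C * \<eta> * exp A \<le> C * (\<mu> / (C * exp A)) * exp A" using C by (intro mult_right_mono mult_left_mono) (auto simp: \<eta>_def)
    then show ?thesis using C by simp
  qed
  show thesis
  proof (rule that[OF \<eta>(1)])
    fix \<Gamma> :: "real \<Rightarrow> 'a" and w w0
    assume \<Gamma>0: "\<Gamma> 0 = 0" and cont: "continuous_on {0..1} \<Gamma>" and w0: "w0 \<in> V 1" "norm w0 \<le> K"
      and w: "\<And>\<sigma>. 0 \<le> \<sigma> \<Longrightarrow> \<sigma> < 1 \<Longrightarrow> w \<sigma> \<in> V 1 \<and> norm (w \<sigma> - w0) \<le> \<eta>"
      and vel: "\<And>\<sigma> e. 0 \<le> \<sigma> \<Longrightarrow> \<sigma> < 1 \<Longrightarrow> e > 0 \<Longrightarrow>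
         \<exists>\<delta>>0. \<forall>s. 0 < s \<longrightarrow> s < \<delta> \<longrightarrow> \<sigma> + s \<le> 1 \<longrightarrow> d ((- \<Gamma> \<sigma>) \<odot> \<Gamma> (\<sigma> + s)) (s *\<^sub>R w \<sigma>) \<le> e * s"
    have K_nonneg: "0 \<le> K" using w0(2) norm_ge_zero[of w0] by linarith
    have wn: "norm (w \<sigma>) \<le> K + 1" if "0 \<le> \<sigma>" "\<sigma> < 1" for \<sigma>
      using w[OF that] w0(2) \<eta>(2) norm_triangle_ineq2[of "w \<sigma>" w0] by linarith
    have hw: "hn (s *\<^sub>R w \<sigma>) \<le> s * K1" if "0 \<le> \<sigma>" "\<sigma> < 1" "0 < s" for \<sigma> s
    proof -
      have "hn (s *\<^sub>R w \<sigma>) = s * hn (w \<sigma>)" using w[OF that(1,2)] that(3) by (intro hn_scale_V1) auto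
      then show ?thesis using K1(2)[OF wn[OF that(1,2)]] that(3) by simp
    qed
    have inc: "hn ((- \<Gamma> \<sigma>) \<odot> \<Gamma> (\<sigma> + s)) \<le> s * K1 + e * s"
      if "0 \<le> \<sigma>" "\<sigma> < 1" "0 < s" "d ((- \<Gamma> \<sigma>) \<odot> \<Gamma> (\<sigma> + s)) (s *\<^sub>R w \<sigma>) \<le> e * s" for \<sigma> s e
      using d_tri[of "(- \<Gamma> \<sigma>) \<odot> \<Gamma> (\<sigma> + s)" 0 "s *\<^sub>R w \<sigma>"] hw[OF that(1-3)] that(4) by (simp add: hn_def)
    \<comment> \<open>An a priori bound, needed because the Lipschitz constants of the product are
      local. Subadditivity of \<open>hn\<close> makes it the case A = 0 of Gronwall's
      inequality.\<close>
    have bound: "hn (\<Gamma> T) \<le> K1" if T: "0 \<le> T" "T \<le> 1" for T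
    proof -
      have "hn (\<Gamma> T) \<le> K1 * (T * exp (0 * T))"
      proof (rule dini_gronwall[of T "\<lambda>\<sigma>. hn (\<Gamma> \<sigma>)"])
        show "continuous_on {0..T} (\<lambda>\<sigma>. hn (\<Gamma> \<sigma>))"
          by (intro continuous_intros continuous_on_subset[OF cont]) (use T in auto)
        fix \<sigma> e :: real assume \<sigma>: "0 \<le> \<sigma>" "\<sigma> < T" and e: "e > 0"
        obtain \<delta> where \<delta>: "\<delta> > 0" "\<forall>s. 0 < s \<longrightarrow> s < \<delta> \<longrightarrow> \<sigma> + s \<le> 1 \<longrightarrow> d ((- \<Gamma> \<sigma>) \<odot> \<Gamma> (\<sigma> + s)) (s *\<^sub>R w \<sigma>) \<le> e * s"
          using vel[of \<sigma> e] \<sigma> T e by auto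
        show "\<exists>\<delta>>0. \<forall>s. 0 < s \<longrightarrow> s < \<delta> \<longrightarrow> \<sigma> + s \<le> T \<longrightarrow> hn (\<Gamma> (\<sigma> + s)) \<le> hn (\<Gamma> \<sigma>) + s * (0 * hn (\<Gamma> \<sigma>) + K1) + e * s"
        proof (intro exI[of _ \<delta>] conjI allI impI)
          fix s assume s: "0 < s" "s < \<delta>" "\<sigma> + s \<le> T"
          have "hn (\<Gamma> (\<sigma> + s)) \<le> hn (\<Gamma> \<sigma>) + hn ((- \<Gamma> \<sigma>) \<odot> \<Gamma> (\<sigma> + s))"
            using hn_mul[of "\<Gamma> \<sigma>" "(- \<Gamma> \<sigma>) \<odot> \<Gamma> (\<sigma> + s)"] by simp
          also have "hn ((- \<Gamma> \<sigma>) \<odot> \<Gamma> (\<sigma> + s)) \<le> s * K1 + e * s" using \<sigma> T s \<delta>(2) by (intro inc) auto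
          finally show "hn (\<Gamma> (\<sigma> + s)) \<le> hn (\<Gamma> \<sigma>) + s * (0 * hn (\<Gamma> \<sigma>) + K1) + e * s" by simp
        qed (rule \<delta>(1))
      qed (use T K1 \<Gamma>0 in auto)
      also have "\<dots> \<le> K1" using T K1 by (simp add: mult_left_le)
      finally show ?thesis .
    qed
    have \<Gamma>B: "norm (\<Gamma> \<sigma>) \<le> B" if "0 \<le> \<sigma>" "\<sigma> \<le> 1" for \<sigma>
      using R(2)[of "\<Gamma> \<sigma>"] bound[OF that] B(1) by linarith
    have w0B: "norm (\<sigma> *\<^sub>R w0) \<le> B" if "0 \<le> \<sigma>" "\<sigma> \<le> 1" for \<sigma>
    proof -
      have "\<bar>\<sigma>\<bar> * norm w0 \<le> 1 * norm w0" using that by (intro mult_right_mono) auto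
      then show ?thesis using w0(2) B(3) by simp
    qed
    define E where "E \<sigma> = norm (\<Gamma> \<sigma> - \<sigma> *\<^sub>R w0)" for \<sigma>
    have "E 1 \<le> (C * \<eta>) * (1 * exp (A * 1))"
    proof (rule dini_gronwall)
      show "continuous_on {0..1} E" unfolding E_def by (intro continuous_intros cont)
      show "E 0 \<le> 0" by (simp add: E_def \<Gamma>0)
      fix \<sigma> e0 :: real assume \<sigma>: "0 \<le> \<sigma>" "\<sigma> < 1" and e0: "e0 > 0"
      \<comment> \<open>A homogeneous error e * s costs a factor C3 in the norm and a factor C for
        each of two left multiplications.\<close>
      define e where "e = min 1 (e0 / (C * (C * C3)))"
      have e: "e > 0" "e \<le> 1" "C * (C * C3) * e \<le> e0"
      proof -
        have "C * (C * C3) * e \<le> C * (C * C3) * (e0 / (C * (C * C3)))"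
          unfolding e_def using C C3(1) by (intro mult_left_mono) auto
        then show "C * (C * C3) * e \<le> e0" using C C3(1) by simp
      qed (use C C3 e0 in \<open>auto simp: e_def\<close>)
      obtain \<delta> where \<delta>: "\<delta> > 0" "\<forall>s. 0 < s \<longrightarrow> s < \<delta> \<longrightarrow> \<sigma> + s \<le> 1 \<longrightarrow> d ((- \<Gamma> \<sigma>) \<odot> \<Gamma> (\<sigma> + s)) (s *\<^sub>R w \<sigma>) \<le> e * s"
        using vel[of \<sigma> e] \<sigma> e by auto
      show "\<exists>\<delta>>0. \<forall>s. 0 < s \<longrightarrow> s < \<delta> \<longrightarrow> \<sigma> + s \<le> 1 \<longrightarrow> E (\<sigma> + s) \<le> E \<sigma> + s * (A * E \<sigma> + C * \<eta>) + e0 * s"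
      proof (intro exI[of _ \<delta>] conjI allI impI)
        fix s assume s: "0 < s" "s < \<delta>" "\<sigma> + s \<le> 1"
        define y where "y = (- \<Gamma> \<sigma>) \<odot> \<Gamma> (\<sigma> + s)"
        define q where "q = (- (s *\<^sub>R w \<sigma>)) \<odot> y"
        have dy: "d y (s *\<^sub>R w \<sigma>) \<le> e * s" using \<delta>(2) s by (simp add: y_def)
        have es: "e * s \<le> 1" using e s \<sigma> by (intro mult_le_one) auto
        have "hn y \<le> s * K1 + e * s" unfolding y_def using \<sigma> s dy by (intro inc) (auto simp: y_def)
        also have "\<dots> \<le> K1 + 1" using es s \<sigma> K1 by (intro add_mono) (auto simp: mult_le_cancel_right2 intro: mult_left_le_one_le)
        finally have yB: "norm y \<le> B" using R(2)[of y] B(1) by linarith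
        have hq: "hn q \<le> e * s" using dy by (simp add: q_def d_hn[symmetric] d_sym)
        then have qn: "norm q \<le> C3 * (e * s)" using C3(2)[of q] es mult_left_mono[OF hq, of C3] C3(1) by linarith
        also have "\<dots> \<le> C3" using es C3(1) by simp
        finally have qB: "norm q \<le> B" using B(2) by linarith
        have swB: "norm (s *\<^sub>R w \<sigma>) \<le> s * (K + 1)" using wn[OF \<sigma>] s by simp
        also have "\<dots> \<le> K + 1" using s \<sigma> K_nonneg by (intro mult_left_le_one_le) auto
        finally have swB': "norm (s *\<^sub>R w \<sigma>) \<le> B" using B(3) by linarith
        have "norm (y - s *\<^sub>R w \<sigma>) = norm ((s *\<^sub>R w \<sigma>) \<odot> q - (s *\<^sub>R w \<sigma>) \<odot> 0)" by (simp add: q_def)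
        also have "\<dots> \<le> C * norm (q - 0)" using B(4) by (intro lip swB' qB) auto
        also have "\<dots> \<le> C * (C3 * (e * s))" using qn C(1) by (simp add: mult_left_mono)
        finally have ysw: "norm (y - s *\<^sub>R w \<sigma>) \<le> C * (C3 * (e * s))" .
        have sw0: "norm (s *\<^sub>R w0) \<le> B" using w0B[of s] s \<sigma> by simp
        have \<Gamma>\<sigma>: "norm (\<Gamma> \<sigma>) \<le> B" "norm (\<sigma> *\<^sub>R w0) \<le> B" using \<Gamma>B[of \<sigma>] w0B[of \<sigma>] \<sigma> by auto
        \<comment> \<open>Telescoping: the true increment y is replaced by the segment along w, then
          the base point by \<sigma> w0, then w by w0. The second replacement is the mixed
          difference, of size at most a constant times s E(\<sigma>).\<close>
        have eq: "\<Gamma> (\<sigma> + s) - (\<sigma> + s) *\<^sub>R w0 = (\<Gamma> \<sigma> \<odot> y - \<Gamma> \<sigma> \<odot> (s *\<^sub>R w \<sigma>))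
           + ((\<Gamma> \<sigma> - \<sigma> *\<^sub>R w0) + (((\<Gamma> \<sigma> \<odot> (s *\<^sub>R w \<sigma>) - \<Gamma> \<sigma>) - ((\<sigma> *\<^sub>R w0) \<odot> (s *\<^sub>R w \<sigma>) - \<sigma> *\<^sub>R w0))
           + ((\<sigma> *\<^sub>R w0) \<odot> (s *\<^sub>R w \<sigma>) - (\<sigma> *\<^sub>R w0) \<odot> (s *\<^sub>R w0))))"
          by (simp add: y_def mul_scale)
        have "E (\<sigma> + s) \<le> C * norm (y - s *\<^sub>R w \<sigma>) + (E \<sigma> + (C * norm (\<Gamma> \<sigma> - \<sigma> *\<^sub>R w0) * norm (s *\<^sub>R w \<sigma>) + C * norm (s *\<^sub>R w \<sigma> - s *\<^sub>R w0)))"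
          unfolding E_def eq
          by (intro norm_triangle_mono lip mix order_refl yB swB' sw0 \<Gamma>\<sigma>)
        also have "\<dots> \<le> C * (C * (C3 * (e * s))) + (E \<sigma> + (C * E \<sigma> * (s * (K + 1)) + C * (s * \<eta>)))"
        proof (intro add_mono mult_left_mono order_refl ysw swB)
          have "norm (s *\<^sub>R w \<sigma> - s *\<^sub>R w0) = s * norm (w \<sigma> - w0)" using s by (simp add: scaleR_diff_right[symmetric])
          then show "norm (s *\<^sub>R w \<sigma> - s *\<^sub>R w0) \<le> s * \<eta>" using w[OF \<sigma>] s by simp
          show "C * norm (\<Gamma> \<sigma> - \<sigma> *\<^sub>R w0) * norm (s *\<^sub>R w \<sigma>) \<le> C * E \<sigma> * (s * (K + 1))"
            unfolding E_def using swB C(1) by (intro mult_left_mono) auto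
        qed (use C in auto)
        also have "\<dots> = (C * (C * C3) * e) * s + (E \<sigma> + s * ((C * (K + 1)) * E \<sigma> + C * \<eta>))"
          by (simp add: algebra_simps)
        also have "\<dots> \<le> e0 * s + (E \<sigma> + s * (A * E \<sigma> + C * \<eta>))"
        proof -
          have "(C * (K + 1)) * E \<sigma> + C * \<eta> \<le> A * E \<sigma> + C * \<eta>"
            using mult_right_mono[OF A(2), of "E \<sigma>"] by (simp add: E_def)
          then have "s * ((C * (K + 1)) * E \<sigma> + C * \<eta>) \<le> s * (A * E \<sigma> + C * \<eta>)"
            by (rule mult_left_mono) (use s in simp)
          moreover have "(C * (C * C3) * e) * s \<le> e0 * s" by (rule mult_right_mono[OF e(3)]) (use s in simp)
          ultimately show ?thesis by linarith
        qed
        finally show "E (\<sigma> + s) \<le> E \<sigma> + s * (A * E \<sigma> + C * \<eta>) + e0 * s" by simp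
      qed (rule \<delta>(1))
    qed (use A C \<eta> in auto)
    then have E1: "norm (\<Gamma> 1 - w0) \<le> \<mu>" using \<eta>2 by (simp add: E_def)
    then have "norm (\<Gamma> 1) \<le> K + 1" using w0(2) \<mu>(3) norm_triangle_ineq2[of "\<Gamma> 1" w0] by linarith
    then have "dist (d w0 (\<Gamma> 1)) (d w0 w0) < \<epsilon>"
      using \<delta>1(2)[of "(w0, w0)" "(w0, \<Gamma> 1)"] w0(2) E1 \<mu>(2) by (simp add: dist_Pair_Pair dist_norm)
    moreover have "d w0 w0 = 0" by (simp add: d_eq_0)
    ultimately show "d w0 (\<Gamma> 1) \<le> \<epsilon>" using d_nonneg[of w0 "\<Gamma> 1"] by (simp add: dist_real_def)
  qed
qed

end

subsection \<open>Strict P-differentiability\<close>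

locale pdiff_setting =
  G: stratified_group brG VG kG dG + M: homogeneous_group brM VM kM \<rho>
  for brG :: "'g::real_normed_vector \<Rightarrow> 'g \<Rightarrow> 'g" and VG kG dG
    and brM :: "'m::real_normed_vector \<Rightarrow> 'm \<Rightarrow> 'm" and VM kM \<rho>
begin

abbreviation mulG (infixl "\<odot>\<^sub>G" 70) where "x \<odot>\<^sub>G y \<equiv> bch brG kG x y"
abbreviation mulM (infixl "\<odot>\<^sub>M" 70) where "x \<odot>\<^sub>M y \<equiv> bch brM kM x y"
abbreviation "hhom L \<equiv> h_hom brG VG kG brM VM kM L"

lemma hhom_mul: "hhom L \<Longrightarrow> L (x \<odot>\<^sub>G y) = L x \<odot>\<^sub>M L y"
  and hhom_dil: "hhom L \<Longrightarrow> r > 0 \<Longrightarrow> L (dil VG kG r x) = dil VM kM r (L x)"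
  by (auto simp: h_hom_def)

lemma hhom_0: assumes "hhom L" shows "L 0 = 0"
proof -
  have "(- L 0) \<odot>\<^sub>M (L 0 \<odot>\<^sub>M L 0) = (- L 0) \<odot>\<^sub>M L 0"
    using hhom_mul[OF assms, of 0 0] by simp
  then show ?thesis by simp
qed

lemma hhom_minus: assumes "hhom L" shows "L (- x) = - L x"
proof -
  have "(- L x) \<odot>\<^sub>M (L x \<odot>\<^sub>M L (- x)) = (- L x) \<odot>\<^sub>M 0"
    using hhom_mul[OF assms, of x "- x"] hhom_0[OF assms] by simp
  then show ?thesis by simp
qed

text \<open>On \<open>VG 1\<close> squaring in the group is both the dilation by 2 and
  multiplication by 2. An h-homomorphism preserves this, and 2^i = 2 leaves only the component of
  degree one.\<close>

lemma hhom_V1: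
  assumes L: "hhom L" and v: "v \<in> VG 1"
  shows "L v \<in> VM 1" "t \<ge> 0 \<Longrightarrow> L (t *\<^sub>R v) = t *\<^sub>R L v"
proof -
  have "dil VM kM 2 (L v) = L (2 *\<^sub>R v)"
    using hhom_dil[OF L, of 2 v] G.dil_V1[OF v] by simp
  also have "\<dots> = L (v \<odot>\<^sub>G v)" using G.mul_scale[of 1 v 1] by simp
  also have "\<dots> = 2 *\<^sub>R L v" using hhom_mul[OF L, of v v] M.mul_scale[of 1 "L v" 1] by simp
  finally have d2: "dil VM kM 2 (L v) = 2 *\<^sub>R L v" .
  have c0: "comp VM kM i (L v) = 0" if "i \<noteq> 1" for i
  proof (cases "i = 0")
    case True then show ?thesis by (simp add: M.comp_out)
  next
    case False
    have "2 ^ i *\<^sub>R comp VM kM i (L v) = 2 *\<^sub>R comp VM kM i (L v)"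
      using arg_cong[OF d2, of "comp VM kM i"] by (simp add: M.comp_dil M.comp_simps)
    moreover have "(2::real) ^ i \<noteq> 2" using False that power_inject_exp[of "2::real" i 1] by simp
    ultimately show ?thesis by (metis scaleR_right_imp_eq)
  qed
  have "comp VM kM 1 (L v) = L v"
  proof (rule M.comp_eqI)
    fix i
    show "comp VM kM i (comp VM kM 1 (L v)) = comp VM kM i (L v)"
      unfolding M.comp_layer[OF M.comp_in_layer[of 1 "L v"], of i] using c0[of i] by (cases "i = 1") simp_all
  qed
  then show 1: "L v \<in> VM 1" using M.comp_in[of 1 "L v"] M.k1 by simp
  show "L (t *\<^sub>R v) = t *\<^sub>R L v" if "t \<ge> 0"
  proof (cases "t = 0")
    case False
    then show ?thesis using hhom_dil[OF L, of t v] that G.dil_V1[OF v] M.dil_V1[OF 1] by simp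
  qed (simp add: hhom_0[OF L])
qed

lemma hhom_hprod:
  assumes L: "hhom L" and S: "S \<subseteq> VG 1" "\<And>v. v \<in> S \<Longrightarrow> M.hn (L v) \<le> B" and \<tau>: "0 \<le> \<tau>"
    and x: "G.hprod S \<tau> n x"
  shows "M.hn (L x) \<le> real n * (\<tau> * B)"
  using x
proof (induction rule: G.hprod.induct)
  case (hprod_Suc v t n x)
  have v: "v \<in> VG 1" using hprod_Suc S by auto
  have "M.hn (L ((t *\<^sub>R v) \<odot>\<^sub>G x)) \<le> M.hn (t *\<^sub>R L v) + M.hn (L x)"
    using M.hn_mul[of "t *\<^sub>R L v" "L x"] hprod_Suc by (simp add: hhom_mul[OF L] hhom_V1(2)[OF L v])
  also have "M.hn (t *\<^sub>R L v) = t * M.hn (L v)" using hprod_Suc by (intro M.hn_scale_V1 hhom_V1(1)[OF L v]) auto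
  also have "\<dots> \<le> \<tau> * B" using hprod_Suc S(2) \<tau> by (intro mult_mono) auto
  finally show ?case using hprod_Suc by (simp add: algebra_simps)
qed (simp add: hhom_0[OF L])

text \<open>The definition of an h-homomorphism does not ask for continuity. The bound comes from
  its finitely many values on the generating directions.\<close>

lemma hhom_bounded:
  assumes L: "hhom L" obtains K where "K > 0" "\<And>x. M.hn (L x) \<le> K * G.hn x"
proof -
  obtain S n C where S: "finite S" "S \<subseteq> VG 1" "\<And>v. v \<in> S \<Longrightarrow> norm v \<le> 1" "C > 0" "\<And>x. G.hprod S (C * G.hn x) n x"
    by (rule G.horizontal_generation) blast
  define B where "B = (\<Sum>v\<in>S. M.hn (L v))"
  have B: "M.hn (L v) \<le> B" if "v \<in> S" for v
    unfolding B_def using member_le_sum[OF that _ S(1), of "\<lambda>v. M.hn (L v)"] by simp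
  have B0: "B \<ge> 0" unfolding B_def by (intro sum_nonneg) auto
  show thesis
  proof (rule that[of "real n * (C * B) + 1"])
    show "real n * (C * B) + 1 > 0" using S(4) B0 by (intro add_nonneg_pos mult_nonneg_nonneg) auto
    fix x
    have "M.hn (L x) \<le> real n * (C * G.hn x * B)"
      by (rule hhom_hprod[OF L S(2) B _ S(5)]) (use S(4) in auto)
    then show "M.hn (L x) \<le> (real n * (C * B) + 1) * G.hn x"
      by (simp add: algebra_simps add_increasing)
  qed
qed

lemma hhom_rho: "hhom L \<Longrightarrow> \<rho> (L x) (L y) = M.hn (L ((- x) \<odot>\<^sub>G y))"
  by (simp add: M.d_hn hhom_mul hhom_minus)

lemma continuous_by_distances:
  fixes g :: "'g \<Rightarrow> 'm"
  assumes "\<And>e. e > 0 \<Longrightarrow> \<exists>\<delta>>0. \<forall>y. dG x y < \<delta> \<longrightarrow> \<rho> (g x) (g y) < e"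
  shows "isCont g x"
  unfolding continuous_at_eps_delta
proof (intro allI impI)
  fix e :: real assume "e > 0"
  then obtain e' where e': "e' > 0" "\<And>y. \<rho> (g x) y < e' \<Longrightarrow> dist y (g x) < e" by (rule M.d_small_dist_small) blast
  obtain \<delta> where \<delta>: "\<delta> > 0" "\<forall>y. dG x y < \<delta> \<longrightarrow> \<rho> (g x) (g y) < e'" using assms[OF e'(1)] by blast
  obtain \<delta>' where "\<delta>' > 0" "\<And>y. dist y x < \<delta>' \<Longrightarrow> dG x y < \<delta>" using \<delta>(1) by (rule G.dist_small_d_small) blast
  then show "\<exists>\<delta>>0. \<forall>y. dist y x < \<delta> \<longrightarrow> dist (g y) (g x) < e" using \<delta> e' by blast
qed

lemma hhom_continuous:
  assumes L: "hhom L" shows "continuous_on S L"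
proof -
  obtain K where K: "K > 0" "\<And>x. M.hn (L x) \<le> K * G.hn x" using L by (rule hhom_bounded) blast
  have "isCont L x" for x
  proof (rule continuous_by_distances)
    fix e :: real assume e: "e > 0"
    show "\<exists>\<delta>>0. \<forall>y. dG x y < \<delta> \<longrightarrow> \<rho> (L x) (L y) < e"
    proof (intro exI[of _ "e / K"] conjI allI impI)
      fix y assume "dG x y < e / K"
      then have "K * G.hn ((- x) \<odot>\<^sub>G y) < e" using K(1) by (simp add: G.d_hn field_simps)
      then show "\<rho> (L x) (L y) < e" using K(2)[of "(- x) \<odot>\<^sub>G y"] by (simp add: hhom_rho[OF L])
    qed (use e K in simp)
  qed
  then show ?thesis by (simp add: continuous_at_imp_continuous_on)
qed

lemma pdiff_at_eps:
  assumes "pdiff_at brG VG kG dG brM VM kM \<rho> f x L" "e > 0"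
  obtains \<delta> where "\<delta> > 0" "\<And>h. G.hn h < \<delta> \<Longrightarrow> \<rho> ((- f x) \<odot>\<^sub>M f (x \<odot>\<^sub>G h)) (L h) \<le> e * G.hn h"
proof -
  have L: "hhom L" and lim: "((\<lambda>h. \<rho> ((- f x) \<odot>\<^sub>M f (x \<odot>\<^sub>G h)) (L h) / dG h 0) \<longlongrightarrow> 0) (at 0)"
    using assms(1) by (auto simp: pdiff_at_def)
  obtain \<eta> where \<eta>: "\<eta> > 0" "\<And>h. h \<noteq> 0 \<Longrightarrow> dist h 0 < \<eta> \<Longrightarrow> \<bar>\<rho> ((- f x) \<odot>\<^sub>M f (x \<odot>\<^sub>G h)) (L h) / dG h 0\<bar> < e"
    using lim assms(2) unfolding LIM_def by (metis diff_zero dist_norm real_norm_def)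
  obtain \<delta> where \<delta>: "\<delta> > 0" "\<And>h. dG 0 h < \<delta> \<Longrightarrow> dist h 0 < \<eta>" using \<eta>(1) by (rule G.d_small_dist_small) blast
  show thesis
  proof (rule that[OF \<delta>(1)])
    fix h assume h: "G.hn h < \<delta>"
    show "\<rho> ((- f x) \<odot>\<^sub>M f (x \<odot>\<^sub>G h)) (L h) \<le> e * G.hn h"
    proof (cases "h = 0")
      case True then show ?thesis by (simp add: hhom_0[OF L] M.d_eq_0)
    next
      case False
      have "\<bar>\<rho> ((- f x) \<odot>\<^sub>M f (x \<odot>\<^sub>G h)) (L h) / dG h 0\<bar> < e"
        using h by (intro \<eta> False \<delta>) (simp add: G.hn_def G.d_sym)
      then show ?thesis using G.hn_pos[OF False] M.d_nonneg by (simp add: G.hn_def field_simps)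
    qed
  qed
qed

lemma pdiff_at_isCont:
  assumes pd: "pdiff_at brG VG kG dG brM VM kM \<rho> f x L" shows "isCont f x"
proof (rule continuous_by_distances)
  have L: "hhom L" using pd by (simp add: pdiff_at_def)
  obtain K where K: "K > 0" "\<And>x. M.hn (L x) \<le> K * G.hn x" using L by (rule hhom_bounded) blast
  obtain \<delta> where \<delta>: "\<delta> > 0" "\<And>h. G.hn h < \<delta> \<Longrightarrow> \<rho> ((- f x) \<odot>\<^sub>M f (x \<odot>\<^sub>G h)) (L h) \<le> 1 * G.hn h"
    using pd zero_less_one by (rule pdiff_at_eps) blast
  fix e :: real assume e: "e > 0"
  show "\<exists>\<delta>>0. \<forall>y. dG x y < \<delta> \<longrightarrow> \<rho> (f x) (f y) < e"
  proof (intro exI[of _ "min \<delta> (e / (K + 1))"] conjI allI impI)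
    fix y assume y: "dG x y < min \<delta> (e / (K + 1))"
    define h where "h = (- x) \<odot>\<^sub>G y"
    have h: "G.hn h < \<delta>" "(K + 1) * G.hn h < e" using y K(1) by (auto simp: h_def G.d_hn field_simps)
    have "\<rho> (f x) (f y) = M.hn ((- f x) \<odot>\<^sub>M f (x \<odot>\<^sub>G h))" by (simp add: M.d_hn h_def)
    also have "\<dots> \<le> \<rho> ((- f x) \<odot>\<^sub>M f (x \<odot>\<^sub>G h)) (L h) + M.hn (L h)"
      unfolding M.hn_def by (rule M.d_tri)
    also have "\<dots> \<le> 1 * G.hn h + K * G.hn h" using \<delta>(2)[OF h(1)] K(2)[of h] by linarith
    also have "\<dots> < e" using h(2) by (simp add: algebra_simps)
    finally show "\<rho> (f x) (f y) < e" .
  qed (use e K \<delta> in auto)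
qed

end

locale cont_pdiff_map = pdiff_setting brG VG kG dG brM VM kM \<rho>
  for brG :: "'g::real_normed_vector \<Rightarrow> 'g \<Rightarrow> 'g" and VG kG dG
    and brM :: "'m::real_normed_vector \<Rightarrow> 'm \<Rightarrow> 'm" and VM kM \<rho> +
  fixes \<Omega> :: "'g set" and f :: "'g \<Rightarrow> 'm" and Df :: "'g \<Rightarrow> 'g \<Rightarrow> 'm"
  assumes open_\<Omega>: "open \<Omega>" and cpd: "cont_pdiff brG VG kG dG brM VM kM \<rho> \<Omega> f Df"
begin

lemma pd: "x \<in> \<Omega> \<Longrightarrow> pdiff_at brG VG kG dG brM VM kM \<rho> f x (Df x)"
  and Df_continuous: "x \<in> \<Omega> \<Longrightarrow> e > 0 \<Longrightarrow> \<exists>\<delta>>0. \<forall>y\<in>\<Omega>. dist y x < \<delta> \<longrightarrow> (\<forall>h. norm h \<le> 1 \<longrightarrow> norm (Df y h - Df x h) < e)"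
  using cpd by (auto simp: cont_pdiff_def)

lemma hhom_Df: "x \<in> \<Omega> \<Longrightarrow> hhom (Df x)"
  using pd by (auto simp: pdiff_at_def)

lemma continuous_f: "continuous_on \<Omega> f"
  using pdiff_at_isCont[OF pd] by (simp add: continuous_at_imp_continuous_on)

text \<open>Read from its starting point and dilated by 1/t, the image of the segment becomes a
  curve on the unit interval. Its horizontal velocity at \<sigma> is
  \<open>Df (p \<sigma>) v\<close>, close to \<open>Df x0 v\<close> for all \<sigma>, so
  \<open>M.curve_estimate\<close> applies.\<close>

lemma segment_estimate:
  assumes x0: "x0 \<in> \<Omega>" and v: "v \<in> VG 1" "norm v \<le> 1" and \<epsilon>: "\<epsilon> > 0"
  obtains \<delta> where "\<delta> > 0"
    "\<And>z t. dG x0 z < \<delta> \<Longrightarrow> 0 \<le> t \<Longrightarrow> t < \<delta> \<Longrightarrow>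
       \<rho> (Df x0 (t *\<^sub>R v)) ((- f z) \<odot>\<^sub>M f (z \<odot>\<^sub>G (t *\<^sub>R v))) \<le> \<epsilon> * t"
proof -
  define w0 where "w0 = Df x0 v"
  have w0: "w0 \<in> VM 1" unfolding w0_def by (rule hhom_V1(1)[OF hhom_Df[OF x0] v(1)])
  obtain \<eta> where \<eta>: "\<eta> > 0"
    "\<And>\<Gamma> w w0. \<Gamma> 0 = 0 \<Longrightarrow> continuous_on {0..1} \<Gamma> \<Longrightarrow> w0 \<in> VM 1 \<Longrightarrow> norm w0 \<le> norm (Df x0 v) \<Longrightarrow>
      (\<And>\<sigma>. 0 \<le> \<sigma> \<Longrightarrow> \<sigma> < 1 \<Longrightarrow> w \<sigma> \<in> VM 1 \<and> norm (w \<sigma> - w0) \<le> \<eta>) \<Longrightarrow>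
      (\<And>\<sigma> e. 0 \<le> \<sigma> \<Longrightarrow> \<sigma> < 1 \<Longrightarrow> e > 0 \<Longrightarrow>
         \<exists>\<delta>>0. \<forall>s. 0 < s \<longrightarrow> s < \<delta> \<longrightarrow> \<sigma> + s \<le> 1 \<longrightarrow> \<rho> ((- \<Gamma> \<sigma>) \<odot>\<^sub>M \<Gamma> (\<sigma> + s)) (s *\<^sub>R w \<sigma>) \<le> e * s) \<Longrightarrow>
      \<rho> w0 (\<Gamma> 1) \<le> \<epsilon>"
    using \<epsilon> by (rule M.curve_estimate[where K="norm (Df x0 v)"]) blast
  obtain \<delta>1 where \<delta>1: "\<delta>1 > 0" "\<And>y h. y \<in> \<Omega> \<Longrightarrow> dist y x0 < \<delta>1 \<Longrightarrow> norm h \<le> 1 \<Longrightarrow> norm (Df y h - Df x0 h) < \<eta>"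
    using Df_continuous[OF x0 \<eta>(1)] by blast
  obtain \<delta>2 where \<delta>2: "\<delta>2 > 0" "\<And>y. dist y x0 < \<delta>2 \<Longrightarrow> y \<in> \<Omega>"
    using open_\<Omega> x0 unfolding open_dist by blast
  have "min \<delta>1 \<delta>2 > 0" using \<delta>1 \<delta>2 by simp
  then obtain \<delta>3 where \<delta>3: "\<delta>3 > 0" "\<And>y. dG x0 y < \<delta>3 \<Longrightarrow> dist y x0 < min \<delta>1 \<delta>2"
    by (rule G.d_small_dist_small) blast
  have near: "y \<in> \<Omega>" "norm (Df y v - Df x0 v) < \<eta>" if "dG x0 y < \<delta>3" for y
    using \<delta>3(2)[OF that] \<delta>1(2)[OF \<delta>2(2)] \<delta>2(2) v(2) by auto
  \<comment> \<open>The denominator leaves room for the whole segment, whose points are at most t *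
    \<open>G.hn v\<close> further away from x0 than z is.\<close>
  define \<delta> where "\<delta> = \<delta>3 / (1 + G.hn v)"
  have hv: "1 + G.hn v > 0" using G.hn_nonneg[of v] by linarith
  show thesis
  proof (rule that)
    show "\<delta> > 0" unfolding \<delta>_def using \<delta>3(1) hv by simp
    fix z t assume z: "dG x0 z < \<delta>" and t: "0 \<le> t" "t < \<delta>"
    define p where "p \<sigma> = z \<odot>\<^sub>G ((t * \<sigma>) *\<^sub>R v)" for \<sigma>
    have p: "dG x0 (p \<sigma>) < \<delta>3" if \<sigma>: "0 \<le> \<sigma>" "\<sigma> \<le> 1" for \<sigma>
    proof -
      have "dG x0 (p \<sigma>) \<le> dG x0 z + dG z (p \<sigma>)" by (rule G.d_tri)
      also have "dG z (p \<sigma>) = (t * \<sigma>) * G.hn v"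
        using G.hn_scale_V1[OF v(1), of "t * \<sigma>"] \<sigma>(1) t(1) by (simp add: p_def G.d_hn)
      also have "dG x0 z + (t * \<sigma>) * G.hn v < \<delta> + \<delta> * G.hn v"
      proof (rule add_less_le_mono[OF z mult_right_mono])
        show "t * \<sigma> \<le> \<delta>" using mult_left_le[OF \<sigma>(2) t(1)] t(2) by linarith
      qed simp
      also have "\<dots> = \<delta> * (1 + G.hn v)" by (simp add: distrib_left)
      also have "\<dots> = \<delta>3" using hv by (simp add: \<delta>_def)
      finally show ?thesis .
    qed
    show "\<rho> (Df x0 (t *\<^sub>R v)) ((- f z) \<odot>\<^sub>M f (z \<odot>\<^sub>G (t *\<^sub>R v))) \<le> \<epsilon> * t"
    proof (cases "t = 0")
      case True then show ?thesis by (simp add: hhom_0[OF hhom_Df[OF x0]] M.d_eq_0)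
    next
      case False
      then have t0: "t > 0" using t by simp
      define \<Gamma> where "\<Gamma> \<sigma> = dil VM kM (1 / t) ((- f z) \<odot>\<^sub>M f (p \<sigma>))" for \<sigma>
      define w where "w \<sigma> = Df (p \<sigma>) v" for \<sigma>
      have "\<rho> w0 (\<Gamma> 1) \<le> \<epsilon>"
      proof (rule \<eta>(2)[where w=w])
        show "\<Gamma> 0 = 0" by (simp add: \<Gamma>_def p_def)
        have "continuous_on {0..1} (\<lambda>\<sigma>. f (p \<sigma>))"
        proof (rule continuous_on_compose2[OF continuous_f])
          show "continuous_on {0..1} p" unfolding p_def by (intro G.continuous_on_mul continuous_intros)
          show "p ` {0..1} \<subseteq> \<Omega>" using near(1) p by auto
        qed
        then show "continuous_on {0..1} \<Gamma>" unfolding \<Gamma>_def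
          by (intro M.continuous_on_dil M.continuous_on_mul continuous_intros)
        show "w0 \<in> VM 1" "norm w0 \<le> norm (Df x0 v)" using w0 by (auto simp: w0_def)
        fix \<sigma> :: real assume \<sigma>: "0 \<le> \<sigma>" "\<sigma> < 1"
        then have p\<sigma>: "dG x0 (p \<sigma>) < \<delta>3" by (intro p) auto
        note L = hhom_Df[OF near(1)[OF p\<sigma>]]
        show w: "w \<sigma> \<in> VM 1 \<and> norm (w \<sigma> - w0) \<le> \<eta>"
          unfolding w_def w0_def using hhom_V1(1)[OF L v(1)] near(2)[OF p\<sigma>] by simp
        fix e :: real assume e: "e > 0"
        \<comment> \<open>P-differentiability measures errors against the homogeneous size of the
          increment; the factor converts this to elapsed time, also when v = 0.\<close>
        then have "e / (1 + G.hn v) > 0" using hv by simp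
        with pd[OF near(1)[OF p\<sigma>]] obtain \<delta>' where \<delta>': "\<delta>' > 0"
          "\<And>h. G.hn h < \<delta>' \<Longrightarrow> \<rho> ((- f (p \<sigma>)) \<odot>\<^sub>M f (p \<sigma> \<odot>\<^sub>G h)) (Df (p \<sigma>) h) \<le> e / (1 + G.hn v) * G.hn h"
          by (rule pdiff_at_eps) blast
        show "\<exists>\<delta>>0. \<forall>s. 0 < s \<longrightarrow> s < \<delta> \<longrightarrow> \<sigma> + s \<le> 1 \<longrightarrow> \<rho> ((- \<Gamma> \<sigma>) \<odot>\<^sub>M \<Gamma> (\<sigma> + s)) (s *\<^sub>R w \<sigma>) \<le> e * s"
        proof (intro exI[of _ "\<delta>' / (t * (1 + G.hn v))"] conjI allI impI)
          show "0 < \<delta>' / (t * (1 + G.hn v))" using \<delta>'(1) t0 hv by simp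
          fix s assume s: "0 < s" "s < \<delta>' / (t * (1 + G.hn v))" "\<sigma> + s \<le> 1"
          define h where "h = (t * s) *\<^sub>R v"
          have hh: "G.hn h = (t * s) * G.hn v" unfolding h_def using t0 s by (intro G.hn_scale_V1 v) auto
          have "(t * s) * G.hn v \<le> s * (t * (1 + G.hn v))" using t0 s by (simp add: algebra_simps)
          also have "\<dots> < \<delta>'" using s(2) t0 hv pos_less_divide_eq[of "t * (1 + G.hn v)" s \<delta>'] by simp
          finally have hl: "G.hn h < \<delta>'" by (simp add: hh)
          have ps: "p (\<sigma> + s) = p \<sigma> \<odot>\<^sub>G h"
            by (simp add: p_def h_def G.mul_assoc G.mul_scale distrib_left)
          have "(- \<Gamma> \<sigma>) \<odot>\<^sub>M \<Gamma> (\<sigma> + s) = dil VM kM (1 / t) ((- f (p \<sigma>)) \<odot>\<^sub>M f (p \<sigma> \<odot>\<^sub>G h))"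
            unfolding \<Gamma>_def ps
            by (simp add: M.dil_mul M.minus_mul M.mul_assoc del: M.dil_simps)
               (simp add: M.dil_mul[symmetric] M.minus_mul M.mul_assoc flip: M.dil_simps(1))
          moreover have "s *\<^sub>R w \<sigma> = dil VM kM (1 / t) (Df (p \<sigma>) h)"
          proof -
            have "Df (p \<sigma>) h = (t * s) *\<^sub>R w \<sigma>" unfolding h_def w_def using t0 s by (intro hhom_V1(2)[OF L v(1)]) auto
            moreover have "(t * s) *\<^sub>R w \<sigma> \<in> VM 1"
              using w M.subspace_V[of 1] M.k1 by (auto intro: subspace_scale)
            ultimately show ?thesis using t0 by (simp add: M.dil_V1)
          qed
          ultimately have "\<rho> ((- \<Gamma> \<sigma>) \<odot>\<^sub>M \<Gamma> (\<sigma> + s)) (s *\<^sub>R w \<sigma>) = (1 / t) * \<rho> ((- f (p \<sigma>)) \<odot>\<^sub>M f (p \<sigma> \<odot>\<^sub>G h)) (Df (p \<sigma>) h)"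
            using t0 by (simp add: M.d_dil)
          also have "\<dots> \<le> (1 / t) * (e / (1 + G.hn v) * G.hn h)"
            using \<delta>'(2)[OF hl] t0 by (intro mult_left_mono) auto
          also have "\<dots> = e * s * (G.hn v / (1 + G.hn v))" using t0 by (simp add: hh)
          also have "\<dots> \<le> e * s" using e s hv by (intro mult_left_le) auto
          finally show "\<rho> ((- \<Gamma> \<sigma>) \<odot>\<^sub>M \<Gamma> (\<sigma> + s)) (s *\<^sub>R w \<sigma>) \<le> e * s" .
        qed
      qed
      moreover have "Df x0 (t *\<^sub>R v) = dil VM kM t w0"
        unfolding w0_def using t0 hhom_V1(2)[OF hhom_Df[OF x0] v(1), of t] M.dil_V1[OF w0, of t] by (simp add: w0_def)
      moreover have "(- f z) \<odot>\<^sub>M f (z \<odot>\<^sub>G (t *\<^sub>R v)) = dil VM kM t (\<Gamma> 1)"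
        using t0 by (simp add: \<Gamma>_def p_def)
      ultimately show ?thesis using t0 by (simp add: M.d_dil mult.commute)
    qed
  qed
qed

text \<open>Induction on the number of segments, splitting off the first. Its error q ends up
  conjugated by \<open>Df x0 h'\<close>, so it must be at most \<eta> \<tau>, with \<eta> from
  \<open>M.hn_conj_small\<close>; the conjugated error and that of the rest get \<epsilon>/2
  each.\<close>

lemma hprod_estimate:
  assumes x0: "x0 \<in> \<Omega>" and S: "finite S" "S \<subseteq> VG 1" "\<And>v. v \<in> S \<Longrightarrow> norm v \<le> 1" and \<epsilon>: "\<epsilon> > 0"
  shows "\<exists>\<delta>>0. \<forall>\<tau> x h. 0 < \<tau> \<longrightarrow> \<tau> < \<delta> \<longrightarrow> dG x0 x < \<delta> \<longrightarrow> G.hprod S \<tau> n h \<longrightarrow>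
     \<rho> (Df x0 h) ((- f x) \<odot>\<^sub>M f (x \<odot>\<^sub>G h)) \<le> \<epsilon> * \<tau>"
  using \<epsilon>
proof (induction n arbitrary: \<epsilon>)
  case 0
  have "\<rho> (Df x0 h) ((- f x) \<odot>\<^sub>M f (x \<odot>\<^sub>G h)) \<le> \<epsilon> * \<tau>" if "G.hprod S \<tau> 0 h" "\<tau> > 0" for \<tau> x h
  proof -
    have "h = 0" using that(1) by cases auto
    moreover have "\<rho> 0 0 = 0" by (simp add: M.d_eq_0)
    ultimately show ?thesis using 0 that by (simp add: hhom_0[OF hhom_Df[OF x0]])
  qed
  then show ?case by (intro exI[of _ 1]) auto
next
  case (Suc n)
  let ?L = "Df x0"
  note L = hhom_Df[OF x0]
  define B where "B = (\<Sum>v\<in>S. M.hn (?L v)) + 1"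
  have B: "M.hn (?L v) \<le> B" if "v \<in> S" for v
    unfolding B_def using member_le_sum[OF that _ S(1), of "\<lambda>v. M.hn (?L v)"] by simp
  define Mv where "Mv = (\<Sum>v\<in>S. G.hn v) + 1"
  have Mv: "G.hn v \<le> Mv" if "v \<in> S" for v
    unfolding Mv_def using member_le_sum[OF that _ S(1), of "\<lambda>v. G.hn v"] by simp
  have Mv0: "Mv > 0" unfolding Mv_def by (intro add_nonneg_pos sum_nonneg) auto
  have e2: "\<epsilon> / 2 > 0" using Suc.prems by simp
  then obtain \<eta> where \<eta>: "\<eta> > 0" "\<eta> \<le> 1"
    "\<And>\<tau> b q. \<tau> > 0 \<Longrightarrow> M.hn b \<le> (real n * B) * \<tau> \<Longrightarrow> M.hn q \<le> \<eta> * \<tau> \<Longrightarrow> M.hn ((- b) \<odot>\<^sub>M (q \<odot>\<^sub>M b)) \<le> \<epsilon> / 2 * \<tau>"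
    by (rule M.hn_conj_small[where K="real n * B"]) blast
  obtain \<delta>1 where \<delta>1: "\<delta>1 > 0" "\<And>\<tau> x h. 0 < \<tau> \<Longrightarrow> \<tau> < \<delta>1 \<Longrightarrow> dG x0 x < \<delta>1 \<Longrightarrow> G.hprod S \<tau> n h \<Longrightarrow>
     \<rho> (?L h) ((- f x) \<odot>\<^sub>M f (x \<odot>\<^sub>G h)) \<le> \<epsilon> / 2 * \<tau>"
    using Suc.IH[OF e2] by blast
  have "\<exists>\<delta>>0. \<forall>z t. dG x0 z < \<delta> \<longrightarrow> 0 \<le> t \<longrightarrow> t < \<delta> \<longrightarrow>
       \<rho> (?L (t *\<^sub>R v)) ((- f z) \<odot>\<^sub>M f (z \<odot>\<^sub>G (t *\<^sub>R v))) \<le> \<eta> * t" if "v \<in> S" for v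
  proof -
    have "v \<in> VG 1" "norm v \<le> 1" using that S by auto
    then obtain \<delta> where "\<delta> > 0" "\<And>z t. dG x0 z < \<delta> \<Longrightarrow> 0 \<le> t \<Longrightarrow> t < \<delta> \<Longrightarrow>
       \<rho> (Df x0 (t *\<^sub>R v)) ((- f z) \<odot>\<^sub>M f (z \<odot>\<^sub>G (t *\<^sub>R v))) \<le> \<eta> * t"
      by (rule segment_estimate[OF x0 _ _ \<eta>(1)]) blast
    then show ?thesis by blast
  qed
  then obtain \<Delta> where \<Delta>: "\<And>v. v \<in> S \<Longrightarrow> \<Delta> v > 0" "\<And>v z t. v \<in> S \<Longrightarrow> dG x0 z < \<Delta> v \<Longrightarrow> 0 \<le> t \<Longrightarrow> t < \<Delta> v \<Longrightarrow>
       \<rho> (?L (t *\<^sub>R v)) ((- f z) \<odot>\<^sub>M f (z \<odot>\<^sub>G (t *\<^sub>R v))) \<le> \<eta> * t" by metis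
  \<comment> \<open>Division by 1 + Mv allows for the first segment, which moves the base point by
    at most \<delta> * Mv; the induction hypothesis is used at its end point.\<close>
  define \<delta> where "\<delta> = Min (insert (\<delta>1 / (1 + Mv)) (\<Delta> ` S))"
  have \<delta>: "\<delta> > 0" "\<delta> \<le> \<delta>1 / (1 + Mv)" "\<And>v. v \<in> S \<Longrightarrow> \<delta> \<le> \<Delta> v"
    unfolding \<delta>_def using S(1) \<delta>1 Mv0 \<Delta>(1) by (auto simp: Min_gr_iff)
  have \<delta>2: "\<delta> + \<delta> * Mv \<le> \<delta>1" using \<delta>(2) Mv0 by (simp add: field_simps)
  have \<delta>3: "\<delta> \<le> \<delta>1" using \<delta>2 mult_pos_pos[OF \<delta>(1) Mv0] by linarith
  show ?case
  proof (intro exI[of _ \<delta>] conjI allI impI)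
    fix \<tau> x h assume \<tau>: "0 < \<tau>" "\<tau> < \<delta>" and x: "dG x0 x < \<delta>" and h: "G.hprod S \<tau> (Suc n) h"
    from h obtain v t h' where h': "h = (t *\<^sub>R v) \<odot>\<^sub>G h'" "v \<in> S" "0 \<le> t" "t \<le> \<tau>" "G.hprod S \<tau> n h'"
      by (rule G.hprod_SucE)
    define x' where "x' = x \<odot>\<^sub>G (t *\<^sub>R v)"
    have "dG x x' = t * G.hn v" 
      using G.hn_scale_V1[OF subsetD[OF S(2) h'(2)] h'(3)] by (simp add: x'_def G.d_hn)
    also have "\<dots> \<le> \<delta> * Mv" using h' \<tau> Mv by (intro mult_mono) auto
    finally have x': "dG x0 x' < \<delta>1" using G.d_tri[of x0 x' x] x \<delta>2 by linarith
    define a where "a = (- f x) \<odot>\<^sub>M f x'"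
    define b where "b = (- f x') \<odot>\<^sub>M f (x' \<odot>\<^sub>G h')"
    define q where "q = (- ?L (t *\<^sub>R v)) \<odot>\<^sub>M a"
    have "M.hn q \<le> \<eta> * t"
      using \<Delta>(2)[OF h'(2), of x t] x \<delta>(3)[OF h'(2)] h' \<tau> by (simp add: q_def a_def x'_def M.d_hn)
    then have q: "M.hn q \<le> \<eta> * \<tau>" using h'(4) \<eta>(1) by (meson mult_left_mono less_imp_le order_trans)
    have r: "M.hn ((- ?L h') \<odot>\<^sub>M b) \<le> \<epsilon> / 2 * \<tau>"
      using \<delta>1(2)[OF \<tau>(1) _ x' h'(5)] \<tau> \<delta>3 by (simp add: b_def M.d_hn)
    have "M.hn (?L h') \<le> real n * (\<tau> * B)" by (rule hhom_hprod[OF L S(2) B _ h'(5)]) (use \<tau> in auto)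
    then have conj: "M.hn ((- ?L h') \<odot>\<^sub>M (q \<odot>\<^sub>M ?L h')) \<le> \<epsilon> / 2 * \<tau>"
      using \<tau> q by (intro \<eta>(3)) (auto simp: mult_ac)
    have ab: "(- f x) \<odot>\<^sub>M f (x \<odot>\<^sub>G h) = a \<odot>\<^sub>M b"
      by (simp add: a_def b_def x'_def h'(1) G.mul_assoc M.mul_assoc)
    \<comment> \<open>As L h = L (t v) L h', removing L (t v) from a leaves q, and moving L h' past
      q conjugates it.\<close>
    have "(- ?L h) \<odot>\<^sub>M (a \<odot>\<^sub>M b) = ((- ?L h') \<odot>\<^sub>M (q \<odot>\<^sub>M ?L h')) \<odot>\<^sub>M ((- ?L h') \<odot>\<^sub>M b)"
      by (simp add: h'(1) hhom_mul[OF L] M.minus_mul M.mul_assoc q_def)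
    then have "M.hn ((- ?L h) \<odot>\<^sub>M (a \<odot>\<^sub>M b)) \<le> \<epsilon> / 2 * \<tau> + \<epsilon> / 2 * \<tau>"
      using order_trans[OF M.hn_mul add_mono[OF conj r]] by (simp only:)
    then show "\<rho> (?L h) ((- f x) \<odot>\<^sub>M f (x \<odot>\<^sub>G h)) \<le> \<epsilon> * \<tau>" by (simp add: M.d_hn ab)
  qed (rule \<delta>(1))
qed

text \<open>Every increment h is a horizontal product at scale C * \<open>G.hn h\<close>, so the
  estimate for products applies with \<epsilon> / C.\<close>

theorem strict_pdiff:
  assumes x0: "x0 \<in> \<Omega>" and \<epsilon>: "\<epsilon> > 0"
  obtains \<delta> where "\<delta> > 0" "\<And>x y. dG x0 x < \<delta> \<Longrightarrow> dG x0 y < \<delta> \<Longrightarrow>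
    M.hn ((- Df x0 ((- x) \<odot>\<^sub>G y)) \<odot>\<^sub>M ((- f x) \<odot>\<^sub>M f y)) \<le> \<epsilon> * dG x y"
proof -
  obtain S n C where S: "finite S" "S \<subseteq> VG 1" "\<And>v. v \<in> S \<Longrightarrow> norm v \<le> 1" "C > 0" "\<And>x. G.hprod S (C * G.hn x) n x"
    by (rule G.horizontal_generation) blast
  have "\<epsilon> / C > 0" using \<epsilon> S by simp
  from hprod_estimate[OF x0 S(1-3) this, of n]
  obtain \<delta> where \<delta>: "\<delta> > 0" "\<And>\<tau> x h. 0 < \<tau> \<Longrightarrow> \<tau> < \<delta> \<Longrightarrow> dG x0 x < \<delta> \<Longrightarrow> G.hprod S \<tau> n h \<Longrightarrow>
     \<rho> (Df x0 h) ((- f x) \<odot>\<^sub>M f (x \<odot>\<^sub>G h)) \<le> \<epsilon> / C * \<tau>" by blast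
  \<comment> \<open>Two points of the smaller ball are at distance below \<delta> / C, so the scale
    of the horizontal product stays below \<delta>.\<close>
  define \<delta>' where "\<delta>' = min \<delta> (\<delta> / (2 * C))"
  show thesis
  proof (rule that)
    show "\<delta>' > 0" using \<delta> S by (simp add: \<delta>'_def)
    fix x y assume x: "dG x0 x < \<delta>'" and y: "dG x0 y < \<delta>'"
    define h where "h = (- x) \<odot>\<^sub>G y"
    have hn: "G.hn h = dG x y" by (simp add: h_def G.d_hn)
    show "M.hn ((- Df x0 ((- x) \<odot>\<^sub>G y)) \<odot>\<^sub>M ((- f x) \<odot>\<^sub>M f y)) \<le> \<epsilon> * dG x y"
    proof (cases "x = y")
      case True then show ?thesis by (simp add: hhom_0[OF hhom_Df[OF x0]] G.d_eq_0)
    next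
      case False
      then have pos: "G.hn h > 0" unfolding hn using G.d_eq_0[of x y] G.d_nonneg[of x y] by linarith
      have "dG x y < 2 * (\<delta> / (2 * C))"
        using G.d_tri[of x y x0] G.d_sym[of x x0] x y by (simp add: \<delta>'_def)
      then have "C * G.hn h < \<delta>" using S(4) by (simp add: hn field_simps)
      then have "\<rho> (Df x0 h) ((- f x) \<odot>\<^sub>M f (x \<odot>\<^sub>G h)) \<le> \<epsilon> / C * (C * G.hn h)"
        using x pos S(4,5) by (intro \<delta>(2)) (auto simp: \<delta>'_def)
      then show ?thesis using S(4) by (simp add: M.d_hn h_def G.d_hn)
    qed
  qed
qed

end

subsection \<open>The implicit function theorem\<close>

context graded_algebra
begin

text \<open>The expression vanishes for n = n' and is built by three multiplications; the radii B,
  B2 and B3 contain the successive partial products.\<close>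

lemma conj_lipschitz:
  obtains C where "C > 0" "\<And>h n n'. norm h \<le> B \<Longrightarrow> norm n \<le> B \<Longrightarrow> norm n' \<le> B \<Longrightarrow>
    norm (((- h) \<odot> (- n)) \<odot> n' \<odot> h) \<le> C * norm (n - n')"
proof -
  obtain C1 where C1: "C1 \<ge> 0"
    "\<And>x x' y y'. norm x \<le> B \<Longrightarrow> norm x' \<le> B \<Longrightarrow> norm y \<le> B \<Longrightarrow> norm y' \<le> B \<Longrightarrow>
       norm (x \<odot> y - x' \<odot> y') \<le> C1 * (norm (x - x') + norm (y - y'))"
    by (rule mul_lipschitz[of B]) blast
  define B2 where "B2 = max B (C1 * (2 * B))"
  obtain C2 where C2: "C2 \<ge> 0"
    "\<And>x x' y y'. norm x \<le> B2 \<Longrightarrow> norm x' \<le> B2 \<Longrightarrow> norm y \<le> B2 \<Longrightarrow> norm y' \<le> B2 \<Longrightarrow>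
       norm (x \<odot> y - x' \<odot> y') \<le> C2 * (norm (x - x') + norm (y - y'))"
    by (rule mul_lipschitz[of B2]) blast
  define B3 where "B3 = \<bar>B\<bar> + C2 * \<bar>B2\<bar>"
  obtain C3 where C3: "C3 \<ge> 0"
    "\<And>x x' y y'. norm x \<le> B3 \<Longrightarrow> norm x' \<le> B3 \<Longrightarrow> norm y \<le> B3 \<Longrightarrow> norm y' \<le> B3 \<Longrightarrow>
       norm (x \<odot> y - x' \<odot> y') \<le> C3 * (norm (x - x') + norm (y - y'))"
    by (rule mul_lipschitz[of B3]) blast
  show thesis
  proof (rule that[of "C3 * (C2 * C1) + 1"])
    show "C3 * (C2 * C1) + 1 > 0" using C1 C2 C3 by (intro add_nonneg_pos mult_nonneg_nonneg) auto
    fix h n n' :: 'a assume b: "norm h \<le> B" "norm n \<le> B" "norm n' \<le> B"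
    have B0: "0 \<le> B" using b(1) norm_ge_zero[of h] by linarith
    define q where "q = (- n) \<odot> n'"
    have q1: "norm q \<le> C1 * norm (n - n')"
      using C1(2)[of "- n" "- n" n' n] b by (simp add: q_def norm_minus_commute)
    have "norm (n - n') \<le> 2 * B" using norm_triangle_ineq4[of n n'] b by linarith
    then have "norm q \<le> C1 * (2 * B)" using q1 C1(1) by (meson mult_left_mono order_trans)
    then have q2: "norm q \<le> B2" "B \<le> B2" by (auto simp: B2_def)
    define r where "r = (- h) \<odot> q"
    have r1: "norm (r - (- h)) \<le> C2 * norm q"
      using C2(2)[of "- h" "- h" q 0] b q2 B0 by (simp add: r_def)
    have "norm r \<le> norm (r - (- h)) + norm h" using norm_triangle_ineq[of "r - (- h)" "- h"] by simp
    also have "\<dots> \<le> C2 * B2 + B" using r1 b(1) mult_left_mono[OF q2(1) C2(1)] by linarith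
    also have "\<dots> \<le> B3" using mult_left_mono[OF abs_ge_self[of B2] C2(1)] by (simp add: B3_def)
    finally have r2: "norm r \<le> B3" .
    have "B \<le> B3" unfolding B3_def using C2(1) by (intro add_increasing2) auto
    then have "norm (r \<odot> h - (- h) \<odot> h) \<le> C3 * norm (r - (- h))"
      using C3(2)[of r "- h" h h] r2 b by simp
    also have "\<dots> \<le> C3 * (C2 * (C1 * norm (n - n')))"
      using r1 q1 C2 C3 by (intro mult_left_mono) (auto intro: order_trans mult_left_mono)
    also have "\<dots> \<le> (C3 * (C2 * C1) + 1) * norm (n - n')" by (simp add: algebra_simps)
    finally show "norm (((- h) \<odot> (- n)) \<odot> n' \<odot> h) \<le> (C3 * (C2 * C1) + 1) * norm (n - n')"
      by (simp add: r_def q_def mul_assoc)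
  qed
qed

end

context homogeneous_group
begin

lemma hn_tri: "hn a \<le> hn b + hn ((- a) \<odot> b)"
  using d_tri[of a 0 b] by (simp add: hn_def[symmetric] d_hn add.commute)

text \<open>The source of the exponent 1/k: conjugation is Lipschitz for the norm on bounded sets,
  and passing from the norm to \<open>hn\<close> costs a k-th root.\<close>

lemma hn_conj_hoelder:
  obtains C where "C > 0" "\<And>h n n'. norm h \<le> B \<Longrightarrow> norm n \<le> B \<Longrightarrow> norm n' \<le> B \<Longrightarrow>
    hn (((- h) \<odot> (- n)) \<odot> n' \<odot> h) \<le> C * norm (n - n') powr (1 / real k)"
proof -
  obtain D where D: "D > 0" "\<And>h n n'. norm h \<le> B \<Longrightarrow> norm n \<le> B \<Longrightarrow> norm n' \<le> B \<Longrightarrow>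
    norm (((- h) \<odot> (- n)) \<odot> n' \<odot> h) \<le> D * norm (n - n')" by (rule conj_lipschitz) blast
  obtain C where C: "C > 0" "\<And>x. norm x \<le> D * (2 * B) \<Longrightarrow> hn x \<le> C * norm x powr (1 / real k)"
    by (rule hn_le_norm_powr) blast
  show thesis
  proof (rule that[of "C * D powr (1 / real k)"])
    show "C * D powr (1 / real k) > 0" using C D by simp
    fix h n n' :: 'a assume b: "norm h \<le> B" "norm n \<le> B" "norm n' \<le> B"
    let ?b = "((- h) \<odot> (- n)) \<odot> n' \<odot> h"
    have 1: "norm ?b \<le> D * norm (n - n')" by (rule D(2)[OF b])
    have "norm (n - n') \<le> 2 * B" using norm_triangle_ineq4[of n n'] b by linarith
    then have "D * norm (n - n') \<le> D * (2 * B)" using D(1) by simp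
    with 1 have "hn ?b \<le> C * norm ?b powr (1 / real k)" by (intro C(2)) linarith
    also have "\<dots> \<le> C * (D * norm (n - n')) powr (1 / real k)"
      using 1 C(1) by (intro mult_left_mono powr_mono2) auto
    also have "\<dots> = C * D powr (1 / real k) * norm (n - n') powr (1 / real k)"
      using D(1) by (simp add: powr_mult)
    finally show "hn ?b \<le> C * D powr (1 / real k) * norm (n - n') powr (1 / real k)" .
  qed
qed

end

context pdiff_setting
begin

text \<open>On H only 0 is in the kernel, so \<open>M.hn (L h)\<close> has a positive minimum over
  the part of H with \<open>G.hn h\<close> equal to 1, and dilations extend the bound. For
  surjectivity a preimage under the right inverse is factored, and L ignores its kernel
  factor.\<close>

lemma epi_complement:
  assumes epi: "h_epi brG VG kG brM VM kM L" and H: "homog_subgroup brG VG kG H"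
    and NH: "complementary brG VG kG {n. L n = 0} H"
  obtains c where "c > 0" "\<And>h. h \<in> H \<Longrightarrow> c * G.hn h \<le> M.hn (L h)" "\<And>y. \<exists>h\<in>H. L h = y"
proof -
  have L: "hhom L" using epi by (simp add: h_epi_def)
  obtain R where R: "\<And>y. L (R y) = y" using epi by (auto simp: h_epi_def)
  have clH: "closed H" and dilH: "\<And>r x. r > 0 \<Longrightarrow> x \<in> H \<Longrightarrow> dil VG kG r x \<in> H"
    using H by (auto simp: homog_subgroup_def)
  have inj: "h = 0" if "h \<in> H" "L h = 0" for h
    using that NH by (auto simp: complementary_def)
  define S where "S = H \<inter> {x. G.hn x = 1}"
  have "closed S" unfolding S_def
    by (intro closed_Int clH closed_Collect_eq G.continuous_on_hn continuous_intros)
  then have "compact ({x. G.hn x \<le> 1} \<inter> S)" by (rule compact_Int_closed[OF G.compact_hn_ball])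
  moreover have "{x. G.hn x \<le> 1} \<inter> S = S" by (auto simp: S_def)
  ultimately have compS: "compact S" by (simp only:)
  have "\<exists>c>0. \<forall>h\<in>S. c \<le> M.hn (L h)"
  proof (cases "S = {}")
    case True then show ?thesis by (intro exI[of _ 1]) auto
  next
    case False
    have "continuous_on S (\<lambda>h. M.hn (L h))" by (intro M.continuous_on_hn hhom_continuous[OF L])
    then obtain h0 where h0: "h0 \<in> S" "\<And>h. h \<in> S \<Longrightarrow> M.hn (L h0) \<le> M.hn (L h)"
      using continuous_attains_inf[OF compS False] by blast
    have "L h0 \<noteq> 0"
    proof
      assume "L h0 = 0"
      then have "h0 = 0" using h0(1) by (intro inj) (auto simp: S_def)
      then show False using h0(1) by (simp add: S_def)
    qed
    then show ?thesis using M.hn_pos h0(2) by blast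
  qed
  then obtain c where c: "c > 0" "\<And>h. h \<in> S \<Longrightarrow> c \<le> M.hn (L h)" by blast
  show thesis
  proof (rule that[OF c(1)])
    fix h assume h: "h \<in> H"
    show "c * G.hn h \<le> M.hn (L h)"
    proof (cases "h = 0")
      case False
      then have r: "G.hn h > 0" by (rule G.hn_pos)
      then have "dil VG kG (1 / G.hn h) h \<in> S" using h dilH by (simp add: S_def G.hn_dil)
      then have "c \<le> M.hn (L (dil VG kG (1 / G.hn h) h))" by (rule c(2))
      also have "\<dots> = (1 / G.hn h) * M.hn (L h)" using r by (simp add: hhom_dil[OF L] M.hn_dil)
      finally show ?thesis using r by (simp add: field_simps)
    qed (simp add: hhom_0[OF L])
  next
    fix y
    have "R y \<in> setmul brG kG {n. L n = 0} H" using NH by (simp add: complementary_def)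
    then obtain n h where nh: "R y = n \<odot>\<^sub>G h" "L n = 0" "h \<in> H" by (auto simp: setmul_def)
    have "y = L h" using R[of y] nh by (simp add: hhom_mul[OF L])
    then show "\<exists>h\<in>H. L h = y" using nh by blast
  qed
qed

end

context cont_pdiff_map
begin

lemma mul_near:
  assumes "n0 \<odot>\<^sub>G h0 \<in> \<Omega>" "e > 0"
  obtains r where "r > 0" "\<And>n h. dG n0 n \<le> r \<Longrightarrow> dG h0 h \<le> r \<Longrightarrow> n \<odot>\<^sub>G h \<in> \<Omega> \<and> dG (n0 \<odot>\<^sub>G h0) (n \<odot>\<^sub>G h) < e"
proof -
  obtain \<delta> where \<delta>: "\<delta> > 0" "\<And>y. dist y (n0 \<odot>\<^sub>G h0) < \<delta> \<Longrightarrow> dG (n0 \<odot>\<^sub>G h0) y < e"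
    using assms(2) by (rule G.dist_small_d_small) blast
  obtain \<delta>' where \<delta>': "\<delta>' > 0" "\<And>y. dist y (n0 \<odot>\<^sub>G h0) < \<delta>' \<Longrightarrow> y \<in> \<Omega>"
    using open_\<Omega> assms(1) unfolding open_dist by blast
  have "continuous_on UNIV (\<lambda>p. fst p \<odot>\<^sub>G snd p)" by (intro G.continuous_on_mul continuous_intros)
  moreover have "min \<delta> \<delta>' > 0" using \<delta> \<delta>' by simp
  ultimately obtain \<eta> where \<eta>: "\<eta> > 0"
    "\<And>p. dist p (n0, h0) < \<eta> \<Longrightarrow> dist (fst p \<odot>\<^sub>G snd p) (fst (n0, h0) \<odot>\<^sub>G snd (n0, h0)) < min \<delta> \<delta>'"
    unfolding continuous_on_iff by (metis UNIV_I)
  have e2: "\<eta> / 2 > 0" using \<eta>(1) by simp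
  obtain r1 where r1: "r1 > 0" "\<And>y. dG n0 y < r1 \<Longrightarrow> dist y n0 < \<eta> / 2" using e2 by (rule G.d_small_dist_small) blast
  obtain r2 where r2: "r2 > 0" "\<And>y. dG h0 y < r2 \<Longrightarrow> dist y h0 < \<eta> / 2" using e2 by (rule G.d_small_dist_small) blast
  show thesis
  proof (rule that[of "min r1 r2 / 2"])
    show "min r1 r2 / 2 > 0" using r1 r2 by simp
    fix n h assume "dG n0 n \<le> min r1 r2 / 2" "dG h0 h \<le> min r1 r2 / 2"
    then have "dist n n0 < \<eta> / 2" "dist h h0 < \<eta> / 2" using r1 r2 by auto
    then have "dist (n, h) (n0, h0) < \<eta>"
      using sqrt_sum_squares_le_sum[of "dist n n0" "dist h h0"] by (simp add: dist_Pair_Pair)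
    from \<eta>(2)[OF this] show "n \<odot>\<^sub>G h \<in> \<Omega> \<and> dG (n0 \<odot>\<^sub>G h0) (n \<odot>\<^sub>G h) < e" using \<delta>(2) \<delta>'(2) by simp
  qed
qed

theorem implicit_function:
  assumes xbar: "xbar \<in> \<Omega>"
    and epi: "h_epi brG VG kG brM VM kM (Df xbar)"
    and Hh: "homog_subgroup brG VG kG H"
    and H: "complementary brG VG kG {n. Df xbar n = 0} H"
    and nbar: "nbar \<in> {n. Df xbar n = 0}" and hbar: "hbar \<in> H"
    and fact: "xbar = nbar \<odot>\<^sub>G hbar"
  shows "\<exists>r>0. \<exists>s>0.
     setmul brG kG (gball dG nbar r \<inter> {n. Df xbar n = 0}) (gball dG hbar s \<inter> H) \<subseteq> \<Omega> \<and>
     (\<exists>\<phi>. (\<phi> \<in> (gball dG nbar r \<inter> {n. Df xbar n = 0}) \<rightarrow>\<^sub>E (gball dG hbar s \<inter> H) \<and>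
           f -` {f xbar} \<inter> setmul brG kG (gball dG nbar r \<inter> {n. Df xbar n = 0}) (gball dG hbar s \<inter> H)
             = {n \<odot>\<^sub>G \<phi> n | n. n \<in> gball dG nbar r \<inter> {n. Df xbar n = 0}}) \<and>
       (\<forall>\<psi>. \<psi> \<in> (gball dG nbar r \<inter> {n. Df xbar n = 0}) \<rightarrow>\<^sub>E (gball dG hbar s \<inter> H) \<and>
           f -` {f xbar} \<inter> setmul brG kG (gball dG nbar r \<inter> {n. Df xbar n = 0}) (gball dG hbar s \<inter> H)
             = {n \<odot>\<^sub>G \<psi> n | n. n \<in> gball dG nbar r \<inter> {n. Df xbar n = 0}}
           \<longrightarrow> \<psi> = \<phi>) \<and>
       (\<exists>\<kappa>>0. \<forall>n\<in>gball dG nbar r \<inter> {n. Df xbar n = 0}. \<forall>n'\<in>gball dG nbar r \<inter> {n. Df xbar n = 0}.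
           dG (\<phi> n) (\<phi> n') \<le> \<kappa> * dG (((- \<phi> n') \<odot>\<^sub>G (- n)) \<odot>\<^sub>G n' \<odot>\<^sub>G \<phi> n') 0) \<and>
       (\<exists>C>0. \<forall>n\<in>gball dG nbar r \<inter> {n. Df xbar n = 0}. \<forall>n'\<in>gball dG nbar r \<inter> {n. Df xbar n = 0}.
           dG (\<phi> n) (\<phi> n') \<le> C * norm (n - n') powr (1 / real kG)))"
proof -
  define L where "L = Df xbar"
  have L: "hhom L" unfolding L_def by (rule hhom_Df[OF xbar])
  have mulH: "\<And>x y. x \<in> H \<Longrightarrow> y \<in> H \<Longrightarrow> x \<odot>\<^sub>G y \<in> H" and minusH: "\<And>x. x \<in> H \<Longrightarrow> - x \<in> H" and clH: "closed H"
    using Hh by (auto simp: homog_subgroup_def)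
  obtain c where c: "c > 0" "\<And>h. h \<in> H \<Longrightarrow> c * G.hn h \<le> M.hn (L h)" "\<And>y. \<exists>h\<in>H. L h = y"
    using epi Hh H unfolding L_def by (rule epi_complement) blast
  obtain K where K: "K > 0" "\<And>x. M.hn (L x) \<le> K * G.hn x" using L by (rule hhom_bounded) blast
  \<comment> \<open>Half of the lower bound of L on H is spent on the nonlinear error, so that half
    of it survives for f.\<close>
  have c2: "c / 2 > 0" using c(1) by simp
  obtain \<delta> where \<delta>: "\<delta> > 0" "\<And>x y. dG xbar x < \<delta> \<Longrightarrow> dG xbar y < \<delta> \<Longrightarrow>
    M.hn ((- L ((- x) \<odot>\<^sub>G y)) \<odot>\<^sub>M ((- f x) \<odot>\<^sub>M f y)) \<le> c / 2 * dG x y"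
    using xbar c2 unfolding L_def by (rule strict_pdiff) blast
  have near0: "nbar \<odot>\<^sub>G hbar \<in> \<Omega>" using xbar fact by simp
  obtain s where s: "s > 0" "\<And>n h. dG nbar n \<le> s \<Longrightarrow> dG hbar h \<le> s \<Longrightarrow> n \<odot>\<^sub>G h \<in> \<Omega> \<and> dG xbar (n \<odot>\<^sub>G h) < \<delta>"
    using near0 \<delta>(1) unfolding fact by (rule mul_near) blast
  define p where "p = f xbar"
  \<comment> \<open>The initial error \<mu> is then at most c s / 5. The minimiser lies within 4
    \<mu> / c of \<open>hbar\<close> and the Newton step adds at most \<mu> / c, which together stay
    within s.\<close>
  have "c * s / (5 * (K + c)) > 0" using c K s by simp
  with near0 obtain r' where r': "r' > 0" "\<And>n h. dG nbar n \<le> r' \<Longrightarrow> dG hbar h \<le> r' \<Longrightarrow> n \<odot>\<^sub>G h \<in> \<Omega> \<and> dG xbar (n \<odot>\<^sub>G h) < c * s / (5 * (K + c))"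
    unfolding fact by (rule mul_near) blast
  define r where "r = min r' s"
  have r: "r > 0" "r \<le> s" "r \<le> r'" using r' s by (auto simp: r_def)
  define DN where "DN = gball dG nbar r \<inter> {n. Df xbar n = 0}"
  define DH where "DH = gball dG hbar s \<inter> H"
  have DN: "dG nbar n \<le> r" "L n = 0" if "n \<in> DN" for n using that by (auto simp: DN_def gball_def L_def)
  have DH: "dG hbar h \<le> s" "h \<in> H" if "h \<in> DH" for h using that by (auto simp: DH_def gball_def)
  have hbarD: "hbar \<in> DH" using hbar s(1) by (simp add: DH_def gball_def)
  have inside: "n \<odot>\<^sub>G h \<in> \<Omega>" "dG xbar (n \<odot>\<^sub>G h) < \<delta>" if "n \<in> DN" "h \<in> DH" for n h
    using s(2)[of n h] DN(1)[OF that(1)] DH(1)[OF that(2)] r by auto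
  \<comment> \<open>The common left factor n cancels both in the increment and in the distance, so
    strict differentiability restricts to the fibre.\<close>
  have est: "M.hn ((- L ((- h) \<odot>\<^sub>G h')) \<odot>\<^sub>M ((- f (n \<odot>\<^sub>G h)) \<odot>\<^sub>M f (n \<odot>\<^sub>G h'))) \<le> c / 2 * dG h h'"
    if "n \<in> DN" "h \<in> DH" "h' \<in> DH" for n h h'
    using \<delta>(2)[OF inside(2)[OF that(1,2)] inside(2)[OF that(1,3)]]
    by (simp add: G.minus_mul G.mul_assoc G.d_left)
  have lower: "c / 2 * dG h h' \<le> \<rho> (f (n \<odot>\<^sub>G h)) (f (n \<odot>\<^sub>G h'))" if "n \<in> DN" "h \<in> DH" "h' \<in> DH" for n h h'
  proof -
    have "(- h) \<odot>\<^sub>G h' \<in> H" using DH that by (intro mulH minusH) auto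
    from c(2)[OF this] have "c * dG h h' \<le> M.hn (L ((- h) \<odot>\<^sub>G h'))" by (simp add: G.d_hn)
    also have "\<dots> \<le> \<rho> (f (n \<odot>\<^sub>G h)) (f (n \<odot>\<^sub>G h')) + c / 2 * dG h h'"
      using M.hn_tri[of "L ((- h) \<odot>\<^sub>G h')" "(- f (n \<odot>\<^sub>G h)) \<odot>\<^sub>M f (n \<odot>\<^sub>G h')"] est[OF that] by (simp add: M.d_hn)
    finally show ?thesis by simp
  qed
  have unique: "h = h'" if "n \<in> DN" "h \<in> DH" "h' \<in> DH" "f (n \<odot>\<^sub>G h) = p" "f (n \<odot>\<^sub>G h') = p" for n h h'
  proof -
    have "c / 2 * dG h h' \<le> 0" using lower[OF that(1-3)] that(4,5) by simp
    then have "dG h h' \<le> 0" using c(1) by (simp add: mult_le_0_iff)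
    then show ?thesis using G.d_nonneg[of h h'] G.d_eq_0[of h h'] by simp
  qed
  have ex: "\<exists>h\<in>DH. f (n \<odot>\<^sub>G h) = p" if n: "n \<in> DN" for n
  proof -
    define \<mu> where "\<mu> = \<rho> (f (n \<odot>\<^sub>G hbar)) p"
    have "M.hn ((- f xbar) \<odot>\<^sub>M f (n \<odot>\<^sub>G hbar)) \<le> M.hn (L ((- xbar) \<odot>\<^sub>G (n \<odot>\<^sub>G hbar))) + c / 2 * dG xbar (n \<odot>\<^sub>G hbar)"
      using M.hn_tri[of "(- f xbar) \<odot>\<^sub>M f (n \<odot>\<^sub>G hbar)" "L ((- xbar) \<odot>\<^sub>G (n \<odot>\<^sub>G hbar))"]
        \<delta>(2)[of xbar "n \<odot>\<^sub>G hbar"] \<delta>(1) inside(2)[OF n hbarD]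
        M.hn_minus[of "(- L ((- xbar) \<odot>\<^sub>G (n \<odot>\<^sub>G hbar))) \<odot>\<^sub>M ((- f xbar) \<odot>\<^sub>M f (n \<odot>\<^sub>G hbar))"]
      by (simp add: M.minus_mul M.mul_assoc)
    also have "M.hn (L ((- xbar) \<odot>\<^sub>G (n \<odot>\<^sub>G hbar))) \<le> K * dG xbar (n \<odot>\<^sub>G hbar)"
      using K(2) by (simp add: G.d_hn)
    finally have "\<mu> \<le> (K + c / 2) * dG xbar (n \<odot>\<^sub>G hbar)"
      by (simp add: \<mu>_def p_def M.d_hn[symmetric] M.d_sym distrib_right)
    also have "\<dots> \<le> (K + c) * dG xbar (n \<odot>\<^sub>G hbar)"
      using c(1) G.d_nonneg by (intro mult_right_mono) auto
    also have "\<dots> \<le> (K + c) * (c * s / (5 * (K + c)))"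
    proof (rule mult_left_mono)
      have "dG nbar n \<le> r'" using DN(1)[OF n] r(3) by linarith
      then show "dG xbar (n \<odot>\<^sub>G hbar) \<le> c * s / (5 * (K + c))"
        using r'(2)[of n hbar] r'(1) by (simp add: less_imp_le)
    qed (use K c in simp)
    also have "\<dots> = c * s / 5"
    proof -
      have "X * (a / (5 * X)) = a / 5" if "X \<noteq> 0" for X a :: real using that by simp
      moreover have "K + c \<noteq> 0" using K(1) c(1) by simp
      ultimately show ?thesis by blast
    qed
    finally have \<mu>: "\<mu> \<le> c * s / 5" .
    have "continuous_on DH (\<lambda>h. f (n \<odot>\<^sub>G h))"
      using inside(1)[OF n]
      by (intro continuous_on_compose2[OF continuous_f] G.continuous_on_mul continuous_intros) auto
    then have "continuous_on DH (\<lambda>h. \<rho> (f (n \<odot>\<^sub>G h)) p)" by (intro M.continuous_on_d continuous_intros)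
    moreover have "compact DH" unfolding DH_def by (intro compact_Int_closed G.compact_gball clH)
    ultimately obtain h where h: "h \<in> DH" "\<And>h'. h' \<in> DH \<Longrightarrow> \<rho> (f (n \<odot>\<^sub>G h)) p \<le> \<rho> (f (n \<odot>\<^sub>G h')) p"
      using continuous_attains_inf[of DH "\<lambda>h. \<rho> (f (n \<odot>\<^sub>G h)) p"] hbarD by blast
    define m where "m = \<rho> (f (n \<odot>\<^sub>G h)) p"
    have m\<mu>: "m \<le> \<mu>" using h(2)[OF hbarD] by (simp add: m_def \<mu>_def)
    \<comment> \<open>One step of the simplified Newton method from the minimiser would halve the distance to the target.\<close>
    obtain k where k: "k \<in> H" "L k = (- f (n \<odot>\<^sub>G h)) \<odot>\<^sub>M p" using c(3) by blast
    have ck: "c * G.hn k \<le> m" using c(2)[OF k(1)] by (simp add: k(2) m_def M.d_hn)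
    have "c / 2 * dG hbar h \<le> \<rho> (f (n \<odot>\<^sub>G hbar)) (f (n \<odot>\<^sub>G h))" by (rule lower[OF n hbarD h(1)])
    also have "\<dots> \<le> \<mu> + m"
      using M.d_tri[of "f (n \<odot>\<^sub>G hbar)" "f (n \<odot>\<^sub>G h)" p] by (simp add: \<mu>_def m_def M.d_sym)
    finally have "c * dG hbar h \<le> 4 * \<mu>" using m\<mu> by simp
    have "dG hbar (h \<odot>\<^sub>G k) \<le> dG hbar h + G.hn k"
      using G.d_tri[of hbar "h \<odot>\<^sub>G k" h] by (simp add: G.d_hn[of h])
    then have "c * dG hbar (h \<odot>\<^sub>G k) \<le> c * dG hbar h + c * G.hn k"
      using c(1) by (metis distrib_left mult_left_mono less_imp_le)
    also have "\<dots> \<le> c * s" using \<open>c * dG hbar h \<le> 4 * \<mu>\<close> ck m\<mu> \<mu> by linarith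
    finally have "h \<odot>\<^sub>G k \<in> DH" using c(1) k(1) DH(2)[OF h(1)] mulH by (simp add: DH_def gball_def)
    note hk = this
    \<comment> \<open>By the choice of k, L k is the missing increment from
      \<open>f (n \<odot>\<^sub>G h)\<close> to p; it cancels and leaves the new distance to the
      target.\<close>
    have "M.hn ((- p) \<odot>\<^sub>M f (n \<odot>\<^sub>G (h \<odot>\<^sub>G k))) \<le> c / 2 * G.hn k"
      using est[OF n h(1) hk] by (simp add: k(2) G.d_hn M.minus_mul M.mul_assoc)
    then have "\<rho> (f (n \<odot>\<^sub>G (h \<odot>\<^sub>G k))) p \<le> m / 2" using ck by (simp add: M.d_hn[symmetric] M.d_sym)
    then have "m \<le> m / 2" using h(2)[OF hk] by (simp add: m_def)
    then have "m \<le> 0" by simp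
    then have "f (n \<odot>\<^sub>G h) = p" using M.d_nonneg M.d_eq_0 by (metis m_def antisym)
    then show ?thesis using h(1) by blast
  qed
  \<comment> \<open>The value outside \<open>DN\<close> is fixed as \<open>undefined\<close>, so
    that uniqueness is equality of functions.\<close>
  define \<phi> where "\<phi> = (\<lambda>n\<in>DN. SOME h. h \<in> DH \<and> f (n \<odot>\<^sub>G h) = p)"
  have \<phi>: "\<phi> n \<in> DH" "f (n \<odot>\<^sub>G \<phi> n) = p" if "n \<in> DN" for n
    using someI_ex[of "\<lambda>h. h \<in> DH \<and> f (n \<odot>\<^sub>G h) = p"] ex[OF that] that by (auto simp: \<phi>_def)
  have \<phi>E: "\<phi> \<in> DN \<rightarrow>\<^sub>E DH" using \<phi>(1) by (auto simp: \<phi>_def)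
  have level: "f -` {f xbar} \<inter> setmul brG kG DN DH = {n \<odot>\<^sub>G \<phi> n | n. n \<in> DN}"
  proof (intro equalityI subsetI)
    fix x assume "x \<in> f -` {f xbar} \<inter> setmul brG kG DN DH"
    then obtain n h where x: "x = n \<odot>\<^sub>G h" "n \<in> DN" "h \<in> DH" "f x = p" by (auto simp: setmul_def p_def)
    then have "h = \<phi> n" using unique[of n h "\<phi> n"] \<phi> by auto
    then show "x \<in> {n \<odot>\<^sub>G \<phi> n | n. n \<in> DN}" using x by blast
  next
    fix x assume "x \<in> {n \<odot>\<^sub>G \<phi> n | n. n \<in> DN}"
    then show "x \<in> f -` {f xbar} \<inter> setmul brG kG DN DH" using \<phi> by (auto simp: setmul_def p_def)
  qed
  have uniq\<phi>: "\<psi> = \<phi>" if \<psi>: "\<psi> \<in> DN \<rightarrow>\<^sub>E DH" "f -` {f xbar} \<inter> setmul brG kG DN DH = {n \<odot>\<^sub>G \<psi> n | n. n \<in> DN}" for \<psi>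
  proof (rule PiE_ext[OF \<psi>(1) \<phi>E])
    fix n assume n: "n \<in> DN"
    then have "n \<odot>\<^sub>G \<psi> n \<in> f -` {f xbar}" using \<psi>(2) by blast
    then show "\<psi> n = \<phi> n" using n \<psi>(1) by (intro unique[of n]) (auto simp: p_def[symmetric] \<phi>)
  qed
  have \<kappa>: "dG (\<phi> n) (\<phi> n') \<le> G.hn (((- \<phi> n') \<odot>\<^sub>G (- n)) \<odot>\<^sub>G n' \<odot>\<^sub>G \<phi> n')" if n: "n \<in> DN" and n': "n' \<in> DN" for n n'
  proof -
    define a where "a = (- \<phi> n) \<odot>\<^sub>G \<phi> n'"
    define b where "b = ((- \<phi> n') \<odot>\<^sub>G (- n)) \<odot>\<^sub>G n' \<odot>\<^sub>G \<phi> n'"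
    let ?x = "n \<odot>\<^sub>G \<phi> n" and ?y = "n' \<odot>\<^sub>G \<phi> n'"
    have ab: "(- ?x) \<odot>\<^sub>G ?y = a \<odot>\<^sub>G b" by (simp add: a_def b_def G.minus_mul G.mul_assoc)
    \<comment> \<open>b is a conjugate of n^(-1) n', and the kernel of L is normal.\<close>
    have "L b = 0" using DN n n' by (simp add: b_def hhom_mul[OF L] hhom_minus[OF L])
    then have Lab: "L (a \<odot>\<^sub>G b) = L a" by (simp add: hhom_mul[OF L])
    have "a \<in> H" unfolding a_def using \<phi>(1) n n' DH by (intro mulH minusH) auto
    then have "c * G.hn a \<le> M.hn (L a)" by (rule c(2))
    also have "\<dots> \<le> c / 2 * G.hn (a \<odot>\<^sub>G b)"
      using \<delta>(2)[OF inside(2)[OF n \<phi>(1)[OF n]] inside(2)[OF n' \<phi>(1)[OF n']]] \<phi>(2)[OF n] \<phi>(2)[OF n']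
      by (simp add: ab Lab G.d_hn)
    also have "\<dots> \<le> c / 2 * (G.hn a + G.hn b)" using c(1) G.hn_mul by (intro mult_left_mono) auto
    finally have "c * G.hn a \<le> c * G.hn b" by (simp add: algebra_simps)
    then show ?thesis using c(1) by (simp add: a_def b_def G.d_hn)
  qed
  have "bounded (gball dG nbar r \<union> gball dG hbar s)"
    by (intro compact_imp_bounded compact_Un G.compact_gball)
  then obtain B where B: "\<And>x. x \<in> gball dG nbar r \<union> gball dG hbar s \<Longrightarrow> norm x \<le> B" by (auto simp: bounded_iff)
  obtain C where C: "C > 0" "\<And>h n n'. norm h \<le> B \<Longrightarrow> norm n \<le> B \<Longrightarrow> norm n' \<le> B \<Longrightarrow>
    G.hn (((- h) \<odot>\<^sub>G (- n)) \<odot>\<^sub>G n' \<odot>\<^sub>G h) \<le> C * norm (n - n') powr (1 / real kG)"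
    by (rule G.hn_conj_hoelder) blast
  have hoelder: "dG (\<phi> n) (\<phi> n') \<le> C * norm (n - n') powr (1 / real kG)" if "n \<in> DN" "n' \<in> DN" for n n'
  proof (rule order_trans[OF \<kappa>[OF that] C(2)])
    show "norm (\<phi> n') \<le> B" using \<phi>(1)[OF that(2)] by (intro B) (auto simp: DH_def)
  qed (use that in \<open>auto intro!: B simp: DN_def\<close>)
  have sub: "setmul brG kG DN DH \<subseteq> \<Omega>" using inside(1) by (auto simp: setmul_def)
  have main: "(\<phi> \<in> DN \<rightarrow>\<^sub>E DH \<and> f -` {f xbar} \<inter> setmul brG kG DN DH = {n \<odot>\<^sub>G \<phi> n | n. n \<in> DN}) \<and>
      (\<forall>\<psi>. \<psi> \<in> DN \<rightarrow>\<^sub>E DH \<and> f -` {f xbar} \<inter> setmul brG kG DN DH = {n \<odot>\<^sub>G \<psi> n | n. n \<in> DN} \<longrightarrow> \<psi> = \<phi>) \<and>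
      (\<exists>\<kappa>>0. \<forall>n\<in>DN. \<forall>n'\<in>DN.
           dG (\<phi> n) (\<phi> n') \<le> \<kappa> * dG (((- \<phi> n') \<odot>\<^sub>G (- n)) \<odot>\<^sub>G n' \<odot>\<^sub>G \<phi> n') 0) \<and>
      (\<exists>C>0. \<forall>n\<in>DN. \<forall>n'\<in>DN. dG (\<phi> n) (\<phi> n') \<le> C * norm (n - n') powr (1 / real kG))"
  proof (intro conjI allI impI \<phi>E level)
    show "\<psi> = \<phi>" if "\<psi> \<in> DN \<rightarrow>\<^sub>E DH \<and> f -` {f xbar} \<inter> setmul brG kG DN DH = {n \<odot>\<^sub>G \<psi> n | n. n \<in> DN}" for \<psi>
      using uniq\<phi> that by blast
    show "\<exists>\<kappa>>0. \<forall>n\<in>DN. \<forall>n'\<in>DN.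
           dG (\<phi> n) (\<phi> n') \<le> \<kappa> * dG (((- \<phi> n') \<odot>\<^sub>G (- n)) \<odot>\<^sub>G n' \<odot>\<^sub>G \<phi> n') 0"
      using \<kappa> unfolding G.hn_def by (intro exI[of _ 1]) simp
    show "\<exists>C>0. \<forall>n\<in>DN. \<forall>n'\<in>DN. dG (\<phi> n) (\<phi> n') \<le> C * norm (n - n') powr (1 / real kG)"
      using C(1) hoelder by blast
  qed
  show ?thesis
    by (rule exI[of _ r], rule conjI[OF r(1)], rule exI[of _ s], rule conjI[OF s(1)],
        rule conjI[OF sub[unfolded DN_def DH_def]], rule exI[of _ \<phi>], rule main[unfolded DN_def DH_def])
qed

end

theorem theorem1p3:
  fixes brG :: "'g::real_normed_vector \<Rightarrow> 'g \<Rightarrow> 'g" and VG :: "nat \<Rightarrow> 'g set" and \<iota> :: nat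
    and d :: "'g \<Rightarrow> 'g \<Rightarrow> real"
    and brM :: "'m::real_normed_vector \<Rightarrow> 'm \<Rightarrow> 'm" and VM :: "nat \<Rightarrow> 'm set" and kM :: nat
    and \<rho> :: "'m \<Rightarrow> 'm \<Rightarrow> real"
    and \<Omega> :: "'g set" and f :: "'g \<Rightarrow> 'm" and Df :: "'g \<Rightarrow> 'g \<Rightarrow> 'm"
    and xbar nbar hbar :: 'g and H :: "'g set"
  assumes G: "stratified_alg brG VG \<iota>"
    and M: "graded_alg brM VM kM"
    and d: "homog_dist brG VG \<iota> d"
    and \<rho>: "homog_dist brM VM kM \<rho>"
    and \<Omega>: "open \<Omega>"
    and f: "cont_pdiff brG VG \<iota> d brM VM kM \<rho> \<Omega> f Df"
    and xbar: "xbar \<in> \<Omega>"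
    and epi: "h_epi brG VG \<iota> brM VM kM (Df xbar)"
    and Hh: "homog_subgroup brG VG \<iota> H"
    and H: "complementary brG VG \<iota> {n. Df xbar n = 0} H"
    and nbar: "nbar \<in> {n. Df xbar n = 0}" and hbar: "hbar \<in> H"
    and fact: "xbar = bch brG \<iota> nbar hbar"
  shows "\<exists>r>0. \<exists>s>0.
     setmul brG \<iota> (gball d nbar r \<inter> {n. Df xbar n = 0}) (gball d hbar s \<inter> H) \<subseteq> \<Omega> \<and>
     (\<exists>\<phi>. (\<phi> \<in> (gball d nbar r \<inter> {n. Df xbar n = 0}) \<rightarrow>\<^sub>E (gball d hbar s \<inter> H) \<and>
           f -` {f xbar} \<inter> setmul brG \<iota> (gball d nbar r \<inter> {n. Df xbar n = 0}) (gball d hbar s \<inter> H)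
             = {bch brG \<iota> n (\<phi> n) | n. n \<in> gball d nbar r \<inter> {n. Df xbar n = 0}}) \<and>
       (\<forall>\<psi>. \<psi> \<in> (gball d nbar r \<inter> {n. Df xbar n = 0}) \<rightarrow>\<^sub>E (gball d hbar s \<inter> H) \<and>
           f -` {f xbar} \<inter> setmul brG \<iota> (gball d nbar r \<inter> {n. Df xbar n = 0}) (gball d hbar s \<inter> H)
             = {bch brG \<iota> n (\<psi> n) | n. n \<in> gball d nbar r \<inter> {n. Df xbar n = 0}}
           \<longrightarrow> \<psi> = \<phi>) \<and>
       (\<exists>\<kappa>>0. \<forall>n\<in>gball d nbar r \<inter> {n. Df xbar n = 0}. \<forall>n'\<in>gball d nbar r \<inter> {n. Df xbar n = 0}.
           d (\<phi> n) (\<phi> n') \<le> \<kappa> * d (bch brG \<iota> (bch brG \<iota> (bch brG \<iota> (- \<phi> n') (- n)) n') (\<phi> n')) 0) \<and>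
       (\<exists>C>0. \<forall>n\<in>gball d nbar r \<inter> {n. Df xbar n = 0}. \<forall>n'\<in>gball d nbar r \<inter> {n. Df xbar n = 0}.
           d (\<phi> n) (\<phi> n') \<le> C * norm (n - n') powr (1 / real \<iota>)))"
proof -
  interpret cont_pdiff_map brG VG \<iota> d brM VM kM \<rho> \<Omega> f Df
  proof unfold_locales
    show "graded_alg brG VG \<iota>" using G by (simp add: stratified_alg_def)
    show "span {brG x y | x y. x \<in> VG i \<and> y \<in> VG j} = VG (i + j)" if "1 \<le> i" "1 \<le> j" "i + j \<le> \<iota>" for i j
      using G that by (simp add: stratified_alg_def)
  qed (fact M d \<rho> \<Omega> f)+
  show ?thesis by (rule implicit_function[OF xbar epi Hh H nbar hbar fact])
qed

end
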